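(* Let $d\ge 1$, $\beta>0$, and let $Z=(Z(t))_{t\ge 0}$ be a strictly dyadic branching Brownian motion in $\mathbb{R}^d$ with constant branching rate $\beta$, started with a single particle at the origin. Let $0\leq\theta<1$, $0\leq k<(1-\theta^2)/d$, $r_0>0$, and let $\mathbf{e}$ be any unit vector in $\mathbb{R}^d$. For $t\ge 0$ let $x(t)=\theta\sqrt{2\beta}\,t$, $r(t)=r_0e^{-\beta kt}$ and $B_t=B(x(t)\mathbf{e},r(t))$. Then, for every $0\leq a<1-\theta^2-kd$, $$\lim_{t\to\infty}\frac{1}{t}\log P\left(Z_t(B_t)<e^{\beta a t}\right)=-\beta\, I(\theta,k,a),$$ where $$I(\theta,k,a)=\inf_{\rho\in(0,\bar\rho]}\left[\rho+\frac{\left(\sqrt{(1-\rho)^2-(a+kd)(1-\rho)}-\theta\right)^2}{\rho}\right]$$ and $$\bar\rho=\bar\rho(\theta,k,a)=1-\frac{a+kd}{2}-\sqrt{\left(\frac{a+kd}{2}\right)^2+\theta^2}.$$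
   Context: Strictly dyadic branching Brownian motion (BBM) with branching rate $\beta>0$ in $\mathbb{R}^d$: the process starts with a single particle, which performs a standard $d$-dimensional Brownian motion for an exponentially distributed random time of parameter $\beta$, at which it dies and simultaneously gives birth to exactly two offspring; each offspring, starting from the position where its parent died, repeats the same procedure independently of the others and of the parent. All Brownian motions and exponential lifetimes are independent. $Z(t)$ is the (random) discrete measure on $\mathbb{R}^d$ given by the sum of Dirac masses at the positions of the particles alive at time $t$. For a Borel set $B\subseteq\mathbb{R}^d$, $Z_t(B)$ is the number of particles located in $B$ at time $t$. $P$ is the law of the process with $Z(0)=\delta_0$. $B(x,r)$ is the open Euclidean ball of center $x$ and radius $r$. *)

theory Defs
  imports "HOL-Probability.Probability"
begin

locale brownian_motion = prob_space M
  for M :: "'w measure" +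
  fixes W :: "real \<Rightarrow> 'w \<Rightarrow> 'a::euclidean_space"
  assumes random_variable: "\<And>t. 0 \<le> t \<Longrightarrow> random_variable borel (W t)"
    and starts_at_zero: "\<And>\<omega>. \<omega> \<in> space M \<Longrightarrow> W 0 \<omega> = 0"
    and continuous_paths: "\<And>\<omega>. \<omega> \<in> space M \<Longrightarrow> continuous_on {0..} (\<lambda>t. W t \<omega>)"
    and gaussian_increments: "\<And>s t. 0 \<le> s \<Longrightarrow> s < t \<Longrightarrow>
      distributed M lborel (\<lambda>\<omega>. W t \<omega> - W s \<omega>)
        (\<lambda>x. ennreal (\<Prod>b\<in>Basis. normal_density 0 (sqrt (t - s)) (x \<bullet> b)))"
    and independent_increments: "\<And>(n::nat) \<tau>. 0 \<le> \<tau> 0 \<Longrightarrow> (\<And>i. i < n \<Longrightarrow> \<tau> i \<le> \<tau> (Suc i)) \<Longrightarrow>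
      indep_vars (\<lambda>_. borel) (\<lambda>i \<omega>. W (\<tau> (Suc i)) \<omega> - W (\<tau> i) \<omega>) {..<n}"

text \<open>Particles are labelled by the binary tree \<^typ>\<open>bool list\<close>: the root is \<^term>\<open>[]\<close> and the two
  children of \<open>u\<close> are \<open>False # u\<close> and \<open>True # u\<close>, so that the most recent branching comes first in a
  label. Particle \<open>u\<close> has lifetime \<open>T u\<close> and is displaced by \<open>W u s\<close> from its place of birth at age
  \<open>s\<close>. The \<open>\<sigma>\<close>-algebras generated by all lifetimes and all motions, indexed by a disjoint sum, are
  mutually independent. Properties of the lifetimes and paths that hold almost surely
  (positivity, continuity) are required everywhere: otherwise events involving
  \<open>W u (T u \<omega>) \<omega>\<close> need not be measurable when \<open>M\<close> is not complete.\<close>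

locale dyadic_bbm = prob_space M
  for M :: "'w measure" +
  fixes \<beta> :: real
    and T :: "bool list \<Rightarrow> 'w \<Rightarrow> real"
    and W :: "bool list \<Rightarrow> real \<Rightarrow> 'w \<Rightarrow> 'a::euclidean_space"
  assumes rate_pos: "0 < \<beta>"
    and lifetime_pos: "\<And>u \<omega>. \<omega> \<in> space M \<Longrightarrow> 0 < T u \<omega>"
    and lifetime: "\<And>u. distributed M lborel (T u) (\<lambda>x. ennreal (exponential_density \<beta> x))"
    and motion: "\<And>u. brownian_motion M (W u)"
    and independent: "indep_sets
      (\<lambda>i. case i of
          Inl u \<Rightarrow> sets (vimage_algebra (space M) (T u) borel)
        | Inr u \<Rightarrow> sets (vimage_algebra (space M) (\<lambda>\<omega>. \<lambda>t\<in>{0..}. W u t \<omega>)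
                     (\<Pi>\<^sub>M t\<in>{0..}. borel)))
      UNIV"

primrec birth_time :: "(bool list \<Rightarrow> 'w \<Rightarrow> real) \<Rightarrow> bool list \<Rightarrow> 'w \<Rightarrow> real" where
  "birth_time T [] \<omega> = 0"
| "birth_time T (b # u) \<omega> = birth_time T u \<omega> + T u \<omega>"

primrec birth_place ::
  "(bool list \<Rightarrow> 'w \<Rightarrow> real) \<Rightarrow> (bool list \<Rightarrow> real \<Rightarrow> 'w \<Rightarrow> 'a::euclidean_space)
    \<Rightarrow> bool list \<Rightarrow> 'w \<Rightarrow> 'a" where
  "birth_place T W [] \<omega> = 0"
| "birth_place T W (b # u) \<omega> = birth_place T W u \<omega> + W u (T u \<omega>) \<omega>"

definition alive :: "(bool list \<Rightarrow> 'w \<Rightarrow> real) \<Rightarrow> real \<Rightarrow> 'w \<Rightarrow> bool list set" where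
  "alive T t \<omega> = {u. birth_time T u \<omega> \<le> t \<and> t < birth_time T u \<omega> + T u \<omega>}"

definition position ::
  "(bool list \<Rightarrow> 'w \<Rightarrow> real) \<Rightarrow> (bool list \<Rightarrow> real \<Rightarrow> 'w \<Rightarrow> 'a::euclidean_space)
    \<Rightarrow> real \<Rightarrow> 'w \<Rightarrow> bool list \<Rightarrow> 'a" where
  "position T W t \<omega> u = birth_place T W u \<omega> + W u (t - birth_time T u \<omega>) \<omega>"

text \<open>The sum of the Dirac masses at the positions of the living particles, as the image of the
  counting measure on their labels.\<close>

definition bbm_measure ::
  "(bool list \<Rightarrow> 'w \<Rightarrow> real) \<Rightarrow> (bool list \<Rightarrow> real \<Rightarrow> 'w \<Rightarrow> 'a::euclidean_space)
    \<Rightarrow> real \<Rightarrow> 'w \<Rightarrow> 'a measure" where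
  "bbm_measure T W t \<omega> = distr (count_space (alive T t \<omega>)) borel (position T W t \<omega>)"

lemma emeasure_bbm_measure:
  assumes "B \<in> sets borel"
  shows "emeasure (bbm_measure T W t \<omega>) B =
    emeasure (count_space UNIV) {u \<in> alive T t \<omega>. position T W t \<omega> u \<in> B}"
proof -
  have "emeasure (bbm_measure T W t \<omega>) B =
      emeasure (count_space (alive T t \<omega>)) (position T W t \<omega> -` B \<inter> alive T t \<omega>)"
    using assms by (simp add: bbm_measure_def emeasure_distr)
  also have "position T W t \<omega> -` B \<inter> alive T t \<omega> = {u \<in> alive T t \<omega>. position T W t \<omega> u \<in> B}"
    by auto
  finally show ?thesis
    by (simp add: emeasure_count_space)
qed

definition rho_bar :: "nat \<Rightarrow> real \<Rightarrow> real \<Rightarrow> real \<Rightarrow> real" where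
  "rho_bar d \<theta> k a =
    1 - (a + k * real d) / 2 - sqrt (((a + k * real d) / 2)\<^sup>2 + \<theta>\<^sup>2)"

definition rate_function :: "nat \<Rightarrow> real \<Rightarrow> real \<Rightarrow> real \<Rightarrow> real" where
  "rate_function d \<theta> k a =
    (INF \<rho>\<in>{0<..rho_bar d \<theta> k a}.
      \<rho> + (sqrt ((1 - \<rho>)\<^sup>2 - (a + k * real d) * (1 - \<rho>)) - \<theta>)\<^sup>2 / \<rho>)"

end

theory Submission
  imports Defs "HOL-Real_Asymp.Real_Asymp"
begin

text \<open>On the exponential scale, the probability that fewer than \<open>L\<close> particles hit the target is the Laplace functional \<open>w t x = E (exp (- \<mu> Z))\<close> with \<open>\<mu>\<close> close to \<open>1 / L\<close>. Conditioning on the first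
  branching, \<open>w\<close> is a mild solution of the FKPP equation
  \<open>\<partial>\<^sub>t w = \<Delta> w / 2 - \<beta> w (1 - w)\<close>, and everything else is analysis of this equation.

  Lower bound: keep only the event that the first particle does not branch before time \<open>\<rho> t\<close> and
  has moved away from the target so far that the expected number of hits is too small.

  Upper bound: inside the region from which \<open>exp (\<beta> a t)\<close> hits are expected, \<open>1 - w\<close> grows along
  straight lines as long as it is small (a branching random walk with small blocks), hence exceeds a constant,
  hence is close to \<open>1\<close>. If \<open>w \<le> q\<close> off a bad set, then \<open>w\<^sup>2\<close> is at most \<open>q w\<close> plus the indicator of that
  set, so Duhamel's formula with killing rate \<open>\<beta> (1 - q)\<close> bounds \<open>w\<close> by an integral over the time \<open>\<rho> t\<close>
  of \<open>exp (- \<beta> (1 - q) \<rho> t)\<close> times a Gaussian tail; the best \<open>\<rho>\<close> gives the rate function.\<close>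

section \<open>Independence\<close>

text \<open>The solution \<open>w\<close> itself changes with \<open>t\<close>, since the target and
  \<mu> do; hence the spreading estimates quantify over all mild solutions, with thresholds fixed
  beforehand. A closed equation for one function requires the children to have the same Laplace
  functional as the root. This is no axiom; it follows from uniqueness for the integral recursion.
  Solutions are only measurable, so all analysis uses Duhamel's formula. One identity for changing
  its killing rate supplies the first-moment bound (rate \<open>- \<beta>\<close>), the bounds by
  not branching (rate \<open>\<beta>\<close>) and the decay estimate (rate
  \<open>\<beta> * (1 - q)\<close>). Decay is used twice: spreading only gives
  \<open>w \<le> 1 - \<eta>\<close> for some fixed \<eta>; decay with \<open>q = 1 - \<eta>\<close>
  over a short time improves this to \<open>w \<le> \<epsilon>\<close>, and only then does decay
  with \<open>q = \<epsilon>\<close> run at nearly the full rate \<beta>. The combination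
  \<open>a + k * d\<close> arises at the end of the time interval: a particle near the target one
  time unit before the end contributes \<mu>, of order \<open>exp (- \<beta> * a * t)\<close>, times
  the volume of the target, of order \<open>exp (- \<beta> * k * d * t)\<close>.\<close>

lemma measurable_continuous_process:
  fixes X :: "real \<Rightarrow> 'w \<Rightarrow> 'b::{second_countable_topology, metric_space}"
  assumes meas: "\<And>r. 0 \<le> r \<Longrightarrow> X r \<in> borel_measurable N"
    and cont: "\<And>\<omega>. \<omega> \<in> space N \<Longrightarrow> continuous_on {0..} (\<lambda>r. X r \<omega>)"
  shows "(\<lambda>(r, \<omega>). X (max 0 r) \<omega>) \<in> borel_measurable (borel \<Otimes>\<^sub>M N)"
proof (rule borel_measurable_LIMSEQ_metric)
  \<comment> \<open>Rounding the time down to a multiple of \<open>1 / 2 ^ n\<close> makes the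
    approximant depend on \<open>r\<close> through an integer only, so countably many measurable
    sections suffice; path continuity gives the limit. The clamp \<open>max 0\<close> is there
    because nothing is known about negative times.\<close>
  fix n :: nat
  have "(\<lambda>(i::int, \<omega>). X (max 0 (of_int i / 2 ^ n)) \<omega>) \<in> borel_measurable (count_space UNIV \<Otimes>\<^sub>M N)"
    by (rule measurable_pair_measure_countable1) (auto intro: meas)
  from measurable_compose[OF _ this] have *: "(\<lambda>p. case f p of (i, \<omega>) \<Rightarrow> X (max 0 (of_int i / 2 ^ n)) \<omega>) \<in> borel_measurable (borel \<Otimes>\<^sub>M N)"
    if "f \<in> borel \<Otimes>\<^sub>M N \<rightarrow>\<^sub>M count_space UNIV \<Otimes>\<^sub>M N" for f :: "real \<times> 'w \<Rightarrow> _"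
    using that by (simp add: case_prod_unfold)
  have "(\<lambda>(r::real, \<omega>). (\<lfloor>r * 2 ^ n\<rfloor>, \<omega>)) \<in> borel \<Otimes>\<^sub>M N \<rightarrow>\<^sub>M count_space UNIV \<Otimes>\<^sub>M N"
    by measurable
  from *[OF this] show "(\<lambda>(r::real, \<omega>). X (max 0 (of_int \<lfloor>r * 2 ^ n\<rfloor> / 2 ^ n)) \<omega>) \<in> borel_measurable (borel \<Otimes>\<^sub>M N)"
    by (simp add: case_prod_unfold)
next
  fix p assume "p \<in> space (borel \<Otimes>\<^sub>M N :: (real \<times> 'w) measure)"
  then obtain r \<omega> where p: "p = (r, \<omega>)" "\<omega> \<in> space N"
    by (auto simp: space_pair_measure)
  have "(\<lambda>n. of_int \<lfloor>r * 2 ^ n\<rfloor> / 2 ^ n) \<longlonglongrightarrow> r"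
  proof (rule tendsto_sandwich)
    show "\<forall>\<^sub>F n in sequentially. r - (1/2) ^ n \<le> of_int \<lfloor>r * 2 ^ n\<rfloor> / 2 ^ n"
    proof (intro always_eventually allI)
      fix n :: nat
      have "r * 2 ^ n - 1 \<le> of_int \<lfloor>r * 2 ^ n\<rfloor>" by linarith
      then have "(r * 2 ^ n - 1) / 2 ^ n \<le> of_int \<lfloor>r * 2 ^ n\<rfloor> / 2 ^ n"
        by (rule divide_right_mono) simp
      then show "r - (1/2) ^ n \<le> of_int \<lfloor>r * 2 ^ n\<rfloor> / 2 ^ n"
        by (simp add: diff_divide_distrib power_one_over inverse_eq_divide)
    qed
    show "\<forall>\<^sub>F n in sequentially. of_int \<lfloor>r * 2 ^ n\<rfloor> / 2 ^ n \<le> r"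
      by (intro always_eventually allI) (simp add: pos_divide_le_eq)
    have "(\<lambda>n. r - (1/2) ^ n) \<longlonglongrightarrow> r - 0"
      by (intro tendsto_intros LIMSEQ_power_zero) simp
    then show "(\<lambda>n. r - (1/2) ^ n) \<longlonglongrightarrow> r" by simp
  qed simp
  then have "(\<lambda>n. max 0 (of_int \<lfloor>r * 2 ^ n\<rfloor> / 2 ^ n)) \<longlonglongrightarrow> max 0 r"
    by (intro tendsto_intros)
  then have "(\<lambda>n. X (max 0 (of_int \<lfloor>r * 2 ^ n\<rfloor> / 2 ^ n)) \<omega>) \<longlonglongrightarrow> X (max 0 r) \<omega>"
    by (intro continuous_on_tendsto_compose[OF cont[OF p(2)]]) auto
  then show "(\<lambda>n. case p of (r, \<omega>) \<Rightarrow> X (max 0 (of_int \<lfloor>r * 2 ^ n\<rfloor> / 2 ^ n)) \<omega>)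
      \<longlonglongrightarrow> (case p of (r, \<omega>) \<Rightarrow> X (max 0 r) \<omega>)"
    using p by simp
qed

lemma measurable_subalgebraD:
  assumes "f \<in> N \<rightarrow>\<^sub>M S" "sets N \<subseteq> sets M" "space N = space M"
  shows "f \<in> M \<rightarrow>\<^sub>M S"
  using assms by (auto simp: measurable_def)

context prob_space
begin

lemma indep_var_subalgebraI:
  assumes ind: "indep_set (sets N1) (sets N2)"
    and sp: "space N1 = space M" "space N2 = space M"
    and X: "X \<in> N1 \<rightarrow>\<^sub>M S1" and Y: "Y \<in> N2 \<rightarrow>\<^sub>M S2"
  shows "indep_var S1 X S2 Y"
proof -
  have sub: "sets N1 \<subseteq> events" "sets N2 \<subseteq> events"
    using ind by (auto dest: indep_setD_ev1 indep_setD_ev2)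
  have sg: "sigma_sets (space M) {f -` A \<inter> space M |A. A \<in> sets S} \<subseteq> sets N"
    if "f \<in> N \<rightarrow>\<^sub>M S" "space N = space M" for f :: "'a \<Rightarrow> 'z" and N S
    using that measurable_sets[OF that(1)]
    by (subst that(2)[symmetric], intro sets.sigma_sets_subset) auto
  have "indep_set (sigma_sets (space M) {X -` A \<inter> space M |A. A \<in> sets S1})
          (sigma_sets (space M) {Y -` A \<inter> space M |A. A \<in> sets S2})"
    using ind sg[OF X sp(1)] sg[OF Y sp(2)]
    unfolding indep_set_def by (elim indep_sets_mono_sets) (auto split: bool.splits)
  moreover have "random_variable S1 X" "random_variable S2 Y"
    using X Y sub sp by (auto simp: measurable_def)
  ultimately show ?thesis
    unfolding indep_var_eq by blast
qed

text \<open>The second coordinate is the sample point itself, seen only through \<open>N2\<close>.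
  Pairing \<open>X\<close> with the identity lets an integrand depend on everything measurable in
  \<open>N2\<close> without naming the variables that generate it.\<close>

lemma distr_pair_indep_subalgebra:
  assumes ind: "indep_set (sets N1) (sets N2)"
    and sp: "space N1 = space M" "space N2 = space M"
    and X: "X \<in> N1 \<rightarrow>\<^sub>M S"
  shows "distr M S X \<Otimes>\<^sub>M distr M N2 (\<lambda>\<omega>. \<omega>) = distr M (S \<Otimes>\<^sub>M N2) (\<lambda>\<omega>. (X \<omega>, \<omega>))"
proof -
  have sub: "sets N1 \<subseteq> events" "sets N2 \<subseteq> events"
    using ind by (auto dest: indep_setD_ev1 indep_setD_ev2)
  have rv: "X \<in> M \<rightarrow>\<^sub>M S" "(\<lambda>\<omega>. \<omega>) \<in> M \<rightarrow>\<^sub>M N2"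
    using measurable_subalgebraD[OF X sub(1) sp(1)] measurable_subalgebraD[OF measurable_ident sub(2) sp(2)]
    by (simp_all add: id_def)
  interpret D1: prob_space "distr M S X" by (rule prob_space_distr) fact
  interpret D2: prob_space "distr M N2 (\<lambda>\<omega>. \<omega>)" by (rule prob_space_distr) fact
  show ?thesis
  proof (rule pair_measure_eqI)
    show "sigma_finite_measure (distr M S X)" "sigma_finite_measure (distr M N2 (\<lambda>\<omega>. \<omega>))"
      by unfold_locales
    show "sets (distr M S X \<Otimes>\<^sub>M distr M N2 (\<lambda>\<omega>. \<omega>)) = sets (distr M (S \<Otimes>\<^sub>M N2) (\<lambda>\<omega>. (X \<omega>, \<omega>)))"
      by simp
    fix A B assume A: "A \<in> sets (distr M S X)" and B: "B \<in> sets (distr M N2 (\<lambda>\<omega>. \<omega>))"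
    then have A': "X -` A \<inter> space M \<in> sets N1" and B': "B \<in> sets N2"
      using X sp by (auto simp: measurable_def)
    have m: "(\<lambda>\<omega>. (X \<omega>, \<omega>)) \<in> M \<rightarrow>\<^sub>M S \<Otimes>\<^sub>M N2" using rv by measurable
    have B'': "B \<in> events" "B \<subseteq> space M" using B' sub sets.sets_into_space[of B N2] sp by auto
    have "(\<lambda>\<omega>. (X \<omega>, \<omega>)) -` (A \<times> B) \<inter> space M = (X -` A \<inter> space M) \<inter> B"
      using B'' by auto
    moreover have "A \<times> B \<in> sets (S \<Otimes>\<^sub>M N2)" using A B by auto
    ultimately have "emeasure (distr M (S \<Otimes>\<^sub>M N2) (\<lambda>\<omega>. (X \<omega>, \<omega>))) (A \<times> B) = prob ((X -` A \<inter> space M) \<inter> B)"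
      using m by (simp add: emeasure_distr emeasure_eq_measure)
    also have "\<dots> = prob (X -` A \<inter> space M) * prob B"
      using indep_setD[OF ind A' B'] by simp
    also have "\<dots> = emeasure (distr M S X) A * emeasure (distr M N2 (\<lambda>\<omega>. \<omega>)) B"
    proof -
      have "emeasure (distr M S X) A = prob (X -` A \<inter> space M)"
        using A rv by (simp add: emeasure_distr emeasure_eq_measure)
      moreover have "emeasure (distr M N2 (\<lambda>\<omega>. \<omega>)) B = prob B"
        using B rv B'' by (simp add: emeasure_distr emeasure_eq_measure Int_absorb2)
      ultimately show ?thesis by (simp add: ennreal_mult)
    qed
    finally show "emeasure (distr M S X) A * emeasure (distr M N2 (\<lambda>\<omega>. \<omega>)) B =
        emeasure (distr M (S \<Otimes>\<^sub>M N2) (\<lambda>\<omega>. (X \<omega>, \<omega>))) (A \<times> B)" by simp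
  qed
qed

text \<open>This stands in for conditioning on \<open>X\<close>: the remaining randomness is
  measurable in \<open>N\<close>, independent of \<open>X\<close>, so \<open>X\<close> may be frozen
  at a value \<open>x\<close> by Fubini. It is applied to the first lifetime and then to the first
  displacement.\<close>

lemma integral_freeze:
  fixes f :: "'b \<Rightarrow> 'a \<Rightarrow> real"
  assumes ind: "indep_set (sets N1) (sets N)"
    and sp: "space N1 = space M" "space N = space M"
    and X: "X \<in> N1 \<rightarrow>\<^sub>M S"
    and f: "(\<lambda>(x, \<omega>). f x \<omega>) \<in> borel_measurable (S \<Otimes>\<^sub>M N)"
    and bd: "\<And>x \<omega>. \<bar>f x \<omega>\<bar> \<le> C"
  shows "expectation (\<lambda>\<omega>. f (X \<omega>) \<omega>) = (\<integral>x. expectation (\<lambda>\<omega>. f x \<omega>) \<partial>distr M S X)"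
proof -
  have sub: "sets N1 \<subseteq> events" "sets N \<subseteq> events"
    using ind by (auto dest: indep_setD_ev1 indep_setD_ev2)
  have rv: "X \<in> M \<rightarrow>\<^sub>M S" "(\<lambda>\<omega>. \<omega>) \<in> M \<rightarrow>\<^sub>M N"
    using measurable_subalgebraD[OF X sub(1) sp(1)] measurable_subalgebraD[OF measurable_ident sub(2) sp(2)]
    by (simp_all add: id_def)
  note eq = distr_pair_indep_subalgebra[OF ind sp X]
  interpret D1: prob_space "distr M S X" by (rule prob_space_distr) fact
  interpret D2: prob_space "distr M N (\<lambda>\<omega>. \<omega>)" by (rule prob_space_distr) fact
  interpret P: pair_prob_space "distr M S X" "distr M N (\<lambda>\<omega>. \<omega>)" ..
  have m: "(\<lambda>\<omega>. (X \<omega>, \<omega>)) \<in> M \<rightarrow>\<^sub>M S \<Otimes>\<^sub>M N" using rv by measurable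
  have "expectation (\<lambda>\<omega>. f (X \<omega>) \<omega>) = (\<integral>p. (case p of (x, \<omega>) \<Rightarrow> f x \<omega>) \<partial>distr M (S \<Otimes>\<^sub>M N) (\<lambda>\<omega>. (X \<omega>, \<omega>)))"
    by (subst integral_distr[OF m f]) simp
  also have "\<dots> = (\<integral>p. (case p of (x, \<omega>) \<Rightarrow> f x \<omega>) \<partial>(distr M S X \<Otimes>\<^sub>M distr M N (\<lambda>\<omega>. \<omega>)))"
    by (simp add: eq)
  also have "\<dots> = (\<integral>x. (\<integral>\<omega>. f x \<omega> \<partial>distr M N (\<lambda>\<omega>. \<omega>)) \<partial>distr M S X)"
  proof (subst P.integral_fst'[symmetric])
    show "integrable (distr M S X \<Otimes>\<^sub>M distr M N (\<lambda>\<omega>. \<omega>)) (\<lambda>(x, \<omega>). f x \<omega>)"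
      by (rule P.integrable_const_bound[where B=C]) (use f bd in \<open>auto cong: measurable_cong_sets\<close>)
  qed simp
  also have "\<dots> = (\<integral>x. expectation (\<lambda>\<omega>. f x \<omega>) \<partial>distr M S X)"
  proof (rule Bochner_Integration.integral_cong[OF refl])
    fix x assume "x \<in> space (distr M S X)"
    then have "(\<lambda>\<omega>. f x \<omega>) \<in> borel_measurable N"
      using f by (auto dest: measurable_Pair2)
    then show "(\<integral>\<omega>. f x \<omega> \<partial>distr M N (\<lambda>\<omega>. \<omega>)) = expectation (\<lambda>\<omega>. f x \<omega>)"
      by (subst integral_distr[OF rv(2)]) auto
  qed
  finally show ?thesis .
qed

end

section \<open>The first branching\<close>

text \<open>The value at \<open>\<top>\<close> is 0 for every \<mu>, even for
  \<open>\<mu> = 0\<close>; this makes the function multiplicative on all of \<open>ennreal\<close>,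
  so an infinite count is an ordinary value.\<close>

definition exp_neg :: "real \<Rightarrow> ennreal \<Rightarrow> real" where
  "exp_neg \<mu> z = (if z = \<top> then 0 else exp (- \<mu> * enn2real z))"

lemma exp_neg_nonneg: "0 \<le> exp_neg \<mu> z"
  and exp_neg_le_1: "0 \<le> \<mu> \<Longrightarrow> exp_neg \<mu> z \<le> 1"
  by (auto simp: exp_neg_def)

lemma exp_neg_add: "exp_neg \<mu> (x + y) = exp_neg \<mu> x * exp_neg \<mu> y"
  by (cases "x = \<top> \<or> y = \<top>")
    (auto simp: exp_neg_def enn2real_plus less_top algebra_simps simp flip: exp_add)

lemma measurable_exp_neg [measurable]: "exp_neg \<mu> \<in> borel_measurable borel"
  unfolding exp_neg_def by measurable

text \<open>The starting point \<open>y\<close> and the families \<open>T\<close>, \<open>W\<close>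
  are arguments because the same count is needed for the subtree of a child, started where its
  parent died.\<close>

definition hits ::
  "(bool list \<Rightarrow> 'w \<Rightarrow> real) \<Rightarrow> (bool list \<Rightarrow> real \<Rightarrow> 'w \<Rightarrow> 'a::euclidean_space)
    \<Rightarrow> 'a set \<Rightarrow> real \<Rightarrow> 'a \<Rightarrow> 'w \<Rightarrow> ennreal" where
  "hits T W B s y \<omega> = emeasure (count_space UNIV) {u \<in> alive T s \<omega>. y + position T W s \<omega> u \<in> B}"

lemma emeasure_bbm_measure_eq_hits:
  "B \<in> sets borel \<Longrightarrow> emeasure (bbm_measure T W t \<omega>) B = hits T W B t 0 \<omega>"
  by (simp add: emeasure_bbm_measure hits_def)

section \<open>Joint measurability of the hit count in time, place and sample\<close>

context
  fixes N :: "'w measure" and T :: "bool list \<Rightarrow> 'w \<Rightarrow> real"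
    and W :: "bool list \<Rightarrow> real \<Rightarrow> 'w \<Rightarrow> 'a::euclidean_space"
  assumes T [measurable]: "\<And>u. T u \<in> borel_measurable N"
    and W: "\<And>u t. 0 \<le> t \<Longrightarrow> W u t \<in> borel_measurable N"
    and cont: "\<And>u \<omega>. \<omega> \<in> space N \<Longrightarrow> continuous_on {0..} (\<lambda>t. W u t \<omega>)"
    and T_pos: "\<And>u \<omega>. \<omega> \<in> space N \<Longrightarrow> 0 < T u \<omega>"
begin

lemma measurable_birth_time [measurable]: "birth_time T u \<in> borel_measurable N"
  by (induction u) (auto simp: fun_eq_iff cong: measurable_cong)

lemma measurable_motion_at:
  assumes "f \<in> borel_measurable K" "g \<in> K \<rightarrow>\<^sub>M N"
  shows "(\<lambda>x. W u (max 0 (f x)) (g x)) \<in> borel_measurable K"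
proof -
  have "(\<lambda>(r, \<omega>). W u (max 0 r) \<omega>) \<in> borel_measurable (borel \<Otimes>\<^sub>M N)"
    by (rule measurable_continuous_process[OF W cont])
  from measurable_compose[OF measurable_Pair[OF assms] this] show ?thesis by simp
qed

lemma measurable_birth_place [measurable]: "birth_place T W u \<in> borel_measurable N"
proof (induction u)
  case (Cons b u)
  have "(\<lambda>\<omega>. birth_place T W u \<omega> + W u (max 0 (T u \<omega>)) \<omega>) \<in> borel_measurable N"
    by (intro borel_measurable_add Cons measurable_motion_at) auto
  then show ?case
    by (rule measurable_cong[THEN iffD1, rotated]) (auto simp: max_def dest: T_pos[of _ u])
qed simp

text \<open>Joint measurability is needed since a subtree starts at a random time and place. The
  count is a countable sum over labels of products of indicators. The space \<open>N\<close> is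
  arbitrary so that the statement covers \<open>M\<close> as well as the sub-\<sigma>-algebra of a
  part of the tree.\<close>

lemma measurable_hits:
  assumes B [measurable]: "B \<in> sets borel"
  shows "(\<lambda>((s, y), \<omega>). hits T W B s y \<omega>) \<in> borel_measurable ((borel \<Otimes>\<^sub>M borel) \<Otimes>\<^sub>M N)"
proof -
  \<comment> \<open>The clamp in the age is harmless: where the age is negative, the first indicator
    vanishes.\<close>
  define c where "c p u = (case p of ((s, y), \<omega>) \<Rightarrow>
    (indicator {r. birth_time T u \<omega> \<le> r \<and> r < birth_time T u \<omega> + T u \<omega>} s *
     indicator B (y + (birth_place T W u \<omega> + W u (max 0 (s - birth_time T u \<omega>)) \<omega>)) :: ennreal))"
    for p :: "(real \<times> 'a) \<times> 'w" and u
  let ?P = "(borel \<Otimes>\<^sub>M borel) \<Otimes>\<^sub>M N :: ((real \<times> 'a) \<times> 'w) measure"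
  have c: "(\<lambda>p. c p u) \<in> borel_measurable ?P" for u
  proof -
    have m: "(\<lambda>p. W u (max 0 (fst (fst p) - birth_time T u (snd p))) (snd p)) \<in> borel_measurable ?P"
      by (rule measurable_motion_at) measurable
    show ?thesis
      unfolding c_def case_prod_unfold
      by (intro borel_measurable_times_ennreal borel_measurable_indicator' ) (use m in \<open>measurable\<close>)
  qed
  interpret sigma_finite_measure "count_space (UNIV :: bool list set)"
    by (rule sigma_finite_measure_count_space_countable) simp
  have m: "(\<lambda>p. \<integral>\<^sup>+ u. c p u \<partial>count_space UNIV) \<in> borel_measurable ?P"
    by (rule borel_measurable_nn_integral, subst measurable_pair_swap_iff,
        rule measurable_pair_measure_countable1) (auto intro: c)
  have "(case p of ((s, y), \<omega>) \<Rightarrow> hits T W B s y \<omega>) = (\<integral>\<^sup>+ u. c p u \<partial>count_space UNIV)" for p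
  proof -
    obtain s y \<omega> where p: "p = ((s, y), \<omega>)" by (metis prod.exhaust)
    have "c p u = indicator {u \<in> alive T s \<omega>. y + position T W s \<omega> u \<in> B} u" for u
      by (auto simp: p c_def alive_def position_def indicator_def max_def add.assoc)
    then show ?thesis by (simp add: p hits_def)
  qed
  then have "(\<lambda>((s, y), \<omega>). hits T W B s y \<omega>) = (\<lambda>p. \<integral>\<^sup>+ u. c p u \<partial>count_space UNIV)"
    by (simp add: fun_eq_iff case_prod_unfold)
  with m show ?thesis by (simp only:)
qed

end

text \<open>The recursion peels off the latest branching, but conditioning on the first one needs
  the other end of a label: the descendants of child \<open>b\<close> of the root are exactly the
  labels ending in \<open>b\<close>.\<close>

lemma birth_time_snoc:
  "birth_time T (u @ [b]) \<omega> = T [] \<omega> + birth_time (\<lambda>v. T (v @ [b])) u \<omega>"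
  by (induction u) auto

lemma birth_place_snoc:
  "birth_place T W (u @ [b]) \<omega> =
    W [] (T [] \<omega>) \<omega> + birth_place (\<lambda>v. T (v @ [b])) (\<lambda>v. W (v @ [b])) u \<omega>"
  by (induction u) auto

lemma birth_time_nonneg: "(\<And>u. 0 < T u \<omega>) \<Longrightarrow> 0 \<le> birth_time T u \<omega>"
  by (induction u) (auto intro: add_nonneg_nonneg less_imp_le)

lemma hits_before_branching:
  assumes pos: "\<And>u. 0 < T u \<omega>" and t: "0 \<le> t" "t < T [] \<omega>"
  shows "hits T W B t y \<omega> = indicator B (y + W [] t \<omega>)"
proof -
  have "u = []" if "u \<in> alive T t \<omega>" for u
  proof (cases u rule: rev_exhaust)
    case (snoc v b)
    then show ?thesis
      using that t birth_time_nonneg[of "\<lambda>v. T (v @ [b])" \<omega> v] pos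
      by (auto simp: alive_def birth_time_snoc)
  qed
  moreover have "[] \<in> alive T t \<omega>" using t by (simp add: alive_def)
  ultimately have alive: "alive T t \<omega> = {[]}" by blast
  have "{u \<in> alive T t \<omega>. y + position T W t \<omega> u \<in> B} = (if y + W [] t \<omega> \<in> B then {[]} else {})"
    unfolding alive by (auto simp: position_def)
  then show ?thesis by (simp add: hits_def)
qed

text \<open>The living labels split according to their last entry. Lifetimes are half-open
  intervals, so at \<open>t = T [] \<omega>\<close> the root is already dead and equality belongs to
  this case.\<close>

lemma hits_after_branching:
  assumes t: "T [] \<omega> \<le> t"
  shows "hits T W B t y \<omega> =
    hits (\<lambda>v. T (v @ [False])) (\<lambda>v. W (v @ [False])) B (t - T [] \<omega>) (y + W [] (T [] \<omega>) \<omega>) \<omega> +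
    hits (\<lambda>v. T (v @ [True])) (\<lambda>v. W (v @ [True])) B (t - T [] \<omega>) (y + W [] (T [] \<omega>) \<omega>) \<omega>"
proof -
  let ?A = "\<lambda>b. {u \<in> alive (\<lambda>v. T (v @ [b])) (t - T [] \<omega>) \<omega>.
    y + W [] (T [] \<omega>) \<omega> + position (\<lambda>v. T (v @ [b])) (\<lambda>v. W (v @ [b])) (t - T [] \<omega>) \<omega> u \<in> B}"
  have mem: "u @ [b] \<in> alive T t \<omega> \<and> y + position T W t \<omega> (u @ [b]) \<in> B \<longleftrightarrow> u \<in> ?A b" for u b
    by (auto simp: alive_def position_def birth_time_snoc birth_place_snoc algebra_simps)
  have "{u \<in> alive T t \<omega>. y + position T W t \<omega> u \<in> B} = (\<lambda>u. u @ [False]) ` ?A False \<union> (\<lambda>u. u @ [True]) ` ?A True"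
    (is "?L = ?R")
  proof (intro set_eqI)
    fix u show "u \<in> ?L \<longleftrightarrow> u \<in> ?R"
    proof (cases u rule: rev_exhaust)
      case Nil
      then show ?thesis using t by (auto simp: alive_def)
    next
      case (snoc v b)
      then show ?thesis using mem[of v b] by (cases b) auto
    qed
  qed
  moreover have "emeasure (count_space UNIV) ((\<lambda>u. u @ [b]) ` A) = emeasure (count_space UNIV) A" for b and A :: "bool list set"
  proof (cases "finite A")
    case True then show ?thesis by (simp add: emeasure_count_space card_image inj_on_def)
  next
    case False then show ?thesis by (simp add: emeasure_count_space finite_image_iff inj_on_def)
  qed
  moreover have "emeasure (count_space UNIV) ((\<lambda>u. u @ [False]) ` ?A False \<union> (\<lambda>u. u @ [True]) ` ?A True) =
      emeasure (count_space UNIV) ((\<lambda>u. u @ [False]) ` ?A False) +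
      emeasure (count_space UNIV) ((\<lambda>u. u @ [True]) ` ?A True)"
    by (rule plus_emeasure[symmetric]) auto
  ultimately show ?thesis
    unfolding hits_def by presburger
qed

lemma (in prob_space) indep_sets_reindex_inj:
  assumes f: "inj_on f I" and F: "indep_sets F (f ` I)"
  shows "indep_sets (\<lambda>i. F (f i)) I"
  unfolding indep_sets_def
proof (intro conjI ballI allI impI)
  fix i assume "i \<in> I" then show "F (f i) \<subseteq> events" using F by (auto simp: indep_sets_def)
next
  fix J A assume J: "J \<subseteq> I" "J \<noteq> {}" "finite J" and A: "A \<in> (\<Pi> i\<in>J. F (f i))"
  have inj: "inj_on f J" using f J by (auto intro: inj_on_subset)
  let ?g = "the_inv_into J f"
  have g: "?g (f j) = j" if "j \<in> J" for j using that inj by (rule the_inv_into_f_f[rotated])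
  have "prob (\<Inter>k\<in>f ` J. A (?g k)) = (\<Prod>k\<in>f ` J. prob (A (?g k)))"
    by (rule indep_setsD[OF F]) (use J A g in auto)
  then show "prob (\<Inter>j\<in>J. A j) = (\<Prod>j\<in>J. prob (A j))"
    using g by (simp add: prod.reindex[OF inj])
qed

section \<open>Independence of disjoint parts of the tree\<close>

context dyadic_bbm
begin

sublocale motion: brownian_motion M "W u" for u
  by (rule motion)

definition source_sets :: "bool list + bool list \<Rightarrow> 'w set set" where
  "source_sets i = (case i of
     Inl u \<Rightarrow> sets (vimage_algebra (space M) (T u) borel)
   | Inr u \<Rightarrow> sets (vimage_algebra (space M) (\<lambda>\<omega>. \<lambda>t\<in>{0..}. W u t \<omega>) (\<Pi>\<^sub>M t\<in>{0..}. borel)))"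

lemma indep_source_sets: "indep_sets source_sets UNIV"
  using independent unfolding source_sets_def .

text \<open>The branching property at the level of the axioms: appending \<open>u\<close> is
  injective on labels, so the subtree inherits independence and is again a branching Brownian
  motion. Every result about the root thus applies to the children.\<close>

lemma dyadic_bbm_subtree: "dyadic_bbm M \<beta> (\<lambda>v. T (v @ u)) (\<lambda>v. W (v @ u))"
proof (unfold_locales)
  let ?f = "map_sum (\<lambda>v. v @ u) (\<lambda>v. v @ u)"
  have "indep_sets (\<lambda>i. source_sets (?f i)) UNIV"
  proof (rule indep_sets_reindex_inj[where F = source_sets and f = ?f])
    show "inj ?f" by (intro sum.inj_map injI) auto
    show "indep_sets source_sets (range ?f)"
      by (rule indep_sets_mono_index[OF _ indep_source_sets]) simp
  qed
  moreover have "(\<lambda>i. source_sets (?f i)) = (\<lambda>i. case i of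
      Inl v \<Rightarrow> sets (vimage_algebra (space M) (T (v @ u)) borel)
    | Inr v \<Rightarrow> sets (vimage_algebra (space M) (\<lambda>\<omega>. \<lambda>t\<in>{0..}. W (v @ u) t \<omega>) (\<Pi>\<^sub>M t\<in>{0..}. borel)))"
    by (auto simp: source_sets_def fun_eq_iff split: sum.splits)
  ultimately show "indep_sets (\<lambda>i. case i of
      Inl v \<Rightarrow> sets (vimage_algebra (space M) (T (v @ u)) borel)
    | Inr v \<Rightarrow> sets (vimage_algebra (space M) (\<lambda>\<omega>. \<lambda>t\<in>{0..}. W (v @ u) t \<omega>) (\<Pi>\<^sub>M t\<in>{0..}. borel))) UNIV"
    by simp
qed (use rate_pos lifetime_pos lifetime motion in auto)

text \<open>The information carried by the lifetimes and motions indexed by \<open>I\<close>. It is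
  kept as a measure space so that measurability with respect to it can be stated directly; disjoint
  index sets give independent \<sigma>-algebras.\<close>

definition sources :: "(bool list + bool list) set \<Rightarrow> 'w measure" where
  "sources I = sigma (space M) (\<Union>i\<in>I. source_sets i)"

lemma source_sets_subset: "source_sets i \<subseteq> Pow (space M)"
proof
  fix A assume "A \<in> source_sets i"
  then have "A \<in> events" using indep_source_sets by (auto simp: indep_sets_def)
  then show "A \<in> Pow (space M)" by (simp add: sets.sets_into_space)
qed

lemma space_sources [simp]: "space (sources I) = space M"
  unfolding sources_def using source_sets_subset by (intro space_measure_of) blast

lemma sets_sources: "sets (sources I) = sigma_sets (space M) (\<Union>i\<in>I. source_sets i)"
  unfolding sources_def using source_sets_subset by (intro sets_measure_of) blast

lemma indep_sources:
  assumes "I \<inter> J = {}"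
  shows "indep_set (sets (sources I)) (sets (sources J))"
proof -
  have "indep_sets (\<lambda>b. sigma_sets (space M) (\<Union>i\<in>case_bool I J b. source_sets i)) (UNIV :: bool set)"
  proof (rule indep_sets_collect_sigma)
    show "indep_sets source_sets (\<Union>b. case_bool I J b)"
      by (rule indep_sets_mono_index[OF _ indep_source_sets]) simp
    show "Int_stable (source_sets i)" for i
      by (auto simp: source_sets_def Int_stable_def split: sum.splits)
    show "disjoint_family (case_bool I J)"
      using assms by (auto simp: disjoint_family_on_def split: bool.splits)
  qed
  then show ?thesis
    unfolding indep_set_def sets_sources by (rule indep_sets_mono_sets) (auto split: bool.splits)
qed

lemma measurable_sources:
  assumes f: "f \<in> space M \<rightarrow> space K" and "i \<in> I"
    and "source_sets i = sets (vimage_algebra (space M) f K)"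
  shows "f \<in> sources I \<rightarrow>\<^sub>M K"
proof (rule measurableI)
  fix A assume "A \<in> sets K"
  then have "f -` A \<inter> space M \<in> source_sets i"
    by (simp add: assms in_vimage_algebra)
  then show "f -` A \<inter> space (sources I) \<in> sets (sources I)"
    using \<open>i \<in> I\<close> by (auto simp: sets_sources)
qed (use f in auto)

lemma lifetime_sources: "Inl u \<in> I \<Longrightarrow> T u \<in> borel_measurable (sources I)"
  by (rule measurable_sources) (auto simp: source_sets_def)

lemma motion_sources:
  assumes "Inr u \<in> I" "0 \<le> t"
  shows "W u t \<in> borel_measurable (sources I)"
proof -
  have "(\<lambda>\<omega>. \<lambda>t\<in>{0..}. W u t \<omega>) \<in> sources I \<rightarrow>\<^sub>M (\<Pi>\<^sub>M t\<in>{0..}. borel)"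
    by (rule measurable_sources[OF _ assms(1)]) (auto simp: source_sets_def space_PiM)
  from measurable_compose[OF this measurable_component_singleton[of t "{0..}"]]
  show ?thesis using assms by simp
qed

lemma sets_sources_subset: "sets (sources I) \<subseteq> events"
  using indep_setD_ev1[OF indep_sources[of I "{}"]] by simp

end

text \<open>\<open>T\<close> and \<open>W\<close> remain explicit so that the functionals of the two
  children can be written down before they are known to agree with that of the root.\<close>

definition bbm_laplace ::
  "'w measure \<Rightarrow> real \<Rightarrow> 'a::euclidean_space set \<Rightarrow> (bool list \<Rightarrow> 'w \<Rightarrow> real)
    \<Rightarrow> (bool list \<Rightarrow> real \<Rightarrow> 'w \<Rightarrow> 'a) \<Rightarrow> real \<Rightarrow> 'a \<Rightarrow> real" where
  "bbm_laplace M \<mu> B T W s y = (\<integral>\<omega>. exp_neg \<mu> (hits T W B s y \<omega>) \<partial>M)"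

context dyadic_bbm
begin

lemma measurable_exp_neg_hits:
  assumes B: "B \<in> sets borel"
    and I: "\<And>v. Inl (v @ u) \<in> I" "\<And>v. Inr (v @ u) \<in> I"
  shows "(\<lambda>((s, y), \<omega>). exp_neg \<mu> (hits (\<lambda>v. T (v @ u)) (\<lambda>v. W (v @ u)) B s y \<omega>))
    \<in> borel_measurable ((borel \<Otimes>\<^sub>M borel) \<Otimes>\<^sub>M sources I)"
proof -
  have "(\<lambda>((s, y), \<omega>). hits (\<lambda>v. T (v @ u)) (\<lambda>v. W (v @ u)) B s y \<omega>)
    \<in> borel_measurable ((borel \<Otimes>\<^sub>M borel) \<Otimes>\<^sub>M sources I)"
    by (rule measurable_hits)
      (use I B motion.continuous_paths lifetime_pos in \<open>auto intro: lifetime_sources motion_sources\<close>)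
  from measurable_compose[OF this measurable_exp_neg[of \<mu>]] show ?thesis
    by (simp add: case_prod_unfold)
qed

lemma measurable_sourcesD: "f \<in> sources I \<rightarrow>\<^sub>M K \<Longrightarrow> f \<in> M \<rightarrow>\<^sub>M K"
  by (rule measurable_subalgebraD[OF _ sets_sources_subset]) auto

lemma measurable_exp_neg_hits_pair:
  assumes "B \<in> sets borel"
  shows "(\<lambda>((s, y), \<omega>). exp_neg \<mu> (hits T W B s y \<omega>)) \<in> borel_measurable ((borel \<Otimes>\<^sub>M borel) \<Otimes>\<^sub>M M)"
proof -
  have id: "(\<lambda>p. (fst p, snd p)) \<in> ((borel \<Otimes>\<^sub>M borel) \<Otimes>\<^sub>M M) \<rightarrow>\<^sub>M ((borel \<Otimes>\<^sub>M borel) \<Otimes>\<^sub>M sources UNIV)"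
    by (intro measurable_Pair measurable_fst measurable_compose[OF measurable_snd measurable_sourcesD[OF measurable_ident, unfolded id_def]])
  show ?thesis
    using measurable_compose[OF id measurable_exp_neg_hits[of B "[]" UNIV \<mu>]] assms
    by (simp add: case_prod_unfold)
qed

lemma measurable_bbm_laplace:
  assumes "B \<in> sets borel"
  shows "(\<lambda>(s, y). bbm_laplace M \<mu> B T W s y) \<in> borel_measurable (borel \<Otimes>\<^sub>M borel)"
  using borel_measurable_lebesgue_integral[of "\<lambda>p \<omega>. exp_neg \<mu> (hits T W B (fst p) (snd p) \<omega>)" "borel \<Otimes>\<^sub>M borel"]
    measurable_exp_neg_hits_pair[OF assms, of \<mu>]
  by (simp add: bbm_laplace_def case_prod_unfold)

lemma measurable_exp_neg_hits_event:
  assumes "B \<in> sets borel"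
  shows "(\<lambda>\<omega>. exp_neg \<mu> (hits T W B s y \<omega>)) \<in> borel_measurable M"
  using measurable_Pair2[OF measurable_exp_neg_hits_pair[OF assms, of \<mu>], of "(s, y)"]
  by (simp add: space_pair_measure)

lemma bbm_laplace_nonneg: "0 \<le> bbm_laplace M \<mu> B T W s y"
  unfolding bbm_laplace_def by (intro Bochner_Integration.integral_nonneg) (simp add: exp_neg_nonneg)

lemma bbm_laplace_le_1:
  assumes "0 \<le> \<mu>" "B \<in> sets borel"
  shows "bbm_laplace M \<mu> B T W s y \<le> 1"
proof -
  have "bbm_laplace M \<mu> B T W s y \<le> (\<integral>\<omega>. 1 \<partial>M)"
    unfolding bbm_laplace_def
    by (intro integral_mono integrable_const_bound[where B = 1] measurable_exp_neg_hits_event assms AE_I2)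
      (auto simp: exp_neg_nonneg exp_neg_le_1 assms)
  then show ?thesis by (simp add: prob_space)
qed

abbreviation laplace_child :: "real \<Rightarrow> 'a set \<Rightarrow> bool \<Rightarrow> real \<Rightarrow> 'a \<Rightarrow> real" where
  "laplace_child \<mu> B b \<equiv> bbm_laplace M \<mu> B (\<lambda>v. T (v @ [b])) (\<lambda>v. W (v @ [b]))"

text \<open>Three splittings of the sources: the root lifetime against all the rest, the root motion
  against the two subtrees, and one subtree against the other. The two children keep separate
  functionals here; they are identified later by uniqueness.\<close>

lemma first_branching:
  assumes mu: "0 \<le> \<mu>" and B [measurable]: "B \<in> sets borel" and t: "0 \<le> t"
  shows "bbm_laplace M \<mu> B T W t x =
    exp (- \<beta> * t) * expectation (\<lambda>\<omega>. exp_neg \<mu> (indicator B (x + W [] t \<omega>))) +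
    (\<integral>s\<in>{0<..t}. \<beta> * exp (- \<beta> * s) * expectation (\<lambda>\<omega>.
      laplace_child \<mu> B False (t - s) (x + W [] s \<omega>) * laplace_child \<mu> B True (t - s) (x + W [] s \<omega>)) \<partial>lborel)"
proof -
  let ?H = "\<lambda>b s y \<omega>. exp_neg \<mu> (hits (\<lambda>v. T (v @ [b])) (\<lambda>v. W (v @ [b])) B s y \<omega>)"
  let ?L = "\<lambda>b. laplace_child \<mu> B b"
  \<comment> \<open>\<open>\<Phi> s\<close> is the integrand with the root lifetime frozen at
    \<open>s\<close>; it uses every source except that lifetime. The clamp makes it meaningful for
    all real \<open>s\<close>.\<close>
  define \<Phi> where "\<Phi> s \<omega> = (if t < s then exp_neg \<mu> (indicator B (x + W [] t \<omega>))
    else ?H False (t - s) (x + W [] (max 0 s) \<omega>) \<omega> * ?H True (t - s) (x + W [] (max 0 s) \<omega>) \<omega>)" for s \<omega>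
  let ?J = "- {Inl []} :: (bool list + bool list) set"
  define SUB where "SUB b = {i. \<exists>v. i = Inl (v @ [b]) \<or> i = Inr (v @ [b])}" for b :: bool
  have child: "dyadic_bbm M \<beta> (\<lambda>v. T (v @ [b])) (\<lambda>v. W (v @ [b]))" for b
    by (rule dyadic_bbm_subtree)
  have H01: "0 \<le> ?H b s y \<omega>" "?H b s y \<omega> \<le> 1" for b s y \<omega>
    by (auto simp: exp_neg_nonneg exp_neg_le_1 mu)
  have HS: "(\<lambda>p. ?H b (fst (fst p)) (snd (fst p)) (snd p)) \<in> borel_measurable ((borel \<Otimes>\<^sub>M borel) \<Otimes>\<^sub>M sources I)"
    if "SUB b \<subseteq> I" for b I
    using measurable_exp_neg_hits[OF B, of "[b]" I \<mu>] that by (auto simp: SUB_def case_prod_unfold)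
  have W0: "(\<lambda>p. W [] (max 0 (fst p)) (snd p)) \<in> borel_measurable (borel \<Otimes>\<^sub>M sources ?J)"
    using measurable_continuous_process[of "W []" "sources ?J"]
    by (auto simp: case_prod_unfold intro: motion_sources motion.continuous_paths)
  have Wt: "W [] t \<in> borel_measurable (sources ?J)"
    by (rule motion_sources) (use t in auto)
  have mPhi: "(\<lambda>(s, \<omega>). \<Phi> s \<omega>) \<in> borel_measurable (borel \<Otimes>\<^sub>M sources ?J)"
  proof -
    have "(\<lambda>p. ?H b (t - fst p) (x + W [] (max 0 (fst p)) (snd p)) (snd p)) \<in> borel_measurable (borel \<Otimes>\<^sub>M sources ?J)" for b
    proof -
      have "(\<lambda>p. ((t - fst p, x + W [] (max 0 (fst p)) (snd p)), snd p))
          \<in> borel \<Otimes>\<^sub>M sources ?J \<rightarrow>\<^sub>M (borel \<Otimes>\<^sub>M borel) \<Otimes>\<^sub>M sources ?J"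
        using W0 by measurable
      from measurable_compose[OF this HS[of b ?J]] show ?thesis
        by (auto simp: SUB_def)
    qed
    moreover have "(\<lambda>p. exp_neg \<mu> (indicator B (x + W [] t (snd p)))) \<in> borel_measurable (borel \<Otimes>\<^sub>M sources ?J)"
      using Wt by measurable
    ultimately show ?thesis
      unfolding \<Phi>_def case_prod_unfold by measurable
  qed
  have Phi01: "0 \<le> \<Phi> s \<omega>" "\<Phi> s \<omega> \<le> 1" for s \<omega>
    using H01 by (auto simp: \<Phi>_def exp_neg_nonneg exp_neg_le_1 mu intro!: mult_le_one)
  have eq: "exp_neg \<mu> (hits T W B t x \<omega>) = \<Phi> (T [] \<omega>) \<omega>" if "\<omega> \<in> space M" for \<omega>
  proof (cases "t < T [] \<omega>")
    case True
    then show ?thesis using lifetime_pos[OF that] t by (simp add: \<Phi>_def hits_before_branching)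
  next
    case False
    then show ?thesis using lifetime_pos[OF that, of "[]"] t
      by (simp add: \<Phi>_def hits_after_branching exp_neg_add)
  qed
  let ?D = "distr M borel (T [])"
  have "bbm_laplace M \<mu> B T W t x = expectation (\<lambda>\<omega>. \<Phi> (T [] \<omega>) \<omega>)"
    unfolding bbm_laplace_def by (rule Bochner_Integration.integral_cong) (auto simp: eq)
  also have "\<dots> = (\<integral>s. expectation (\<Phi> s) \<partial>?D)"
    by (rule integral_freeze[OF indep_sources[of "{Inl []}" ?J] _ _ lifetime_sources mPhi, where C = 1])
      (use Phi01 in \<open>auto simp: abs_le_iff intro: order_trans[of _ 0]\<close>)
  finally have L: "bbm_laplace M \<mu> B T W t x = (\<integral>s. expectation (\<Phi> s) \<partial>?D)" .
  define c where "c = expectation (\<lambda>\<omega>. exp_neg \<mu> (indicator B (x + W [] t \<omega>)))"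
  define K where "K s = expectation (\<lambda>\<omega>. ?L False (t - s) (x + W [] s \<omega>) * ?L True (t - s) (x + W [] s \<omega>))" for s
  have EPhi1: "expectation (\<Phi> s) = c" if "t < s" for s
    using that by (simp add: \<Phi>_def[abs_def] c_def)
  have EPhi2: "expectation (\<Phi> s) = K s" if s: "0 < s" "s \<le> t" for s
  proof -
    \<comment> \<open>Once the lifetime is a number, the root motion enters only through
      \<open>W [] s\<close>, which is independent of both subtrees and can be frozen in
      turn.\<close>
    let ?I = "SUB False \<union> SUB True"
    have "expectation (\<Phi> s) = expectation (\<lambda>\<omega>. ?H False (t - s) (x + W [] s \<omega>) \<omega> * ?H True (t - s) (x + W [] s \<omega>) \<omega>)"
      using s by (simp add: \<Phi>_def[abs_def] max_def)
    also have "\<dots> = (\<integral>z. expectation (\<lambda>\<omega>. ?H False (t - s) (x + z) \<omega> * ?H True (t - s) (x + z) \<omega>) \<partial>distr M borel (W [] s))"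
    proof (rule integral_freeze[OF indep_sources[of "{Inr []}" ?I], where C = 1])
      have "(\<lambda>p. ?H b (t - s) (x + fst p) (snd p)) \<in> borel_measurable (borel \<Otimes>\<^sub>M sources ?I)" for b
      proof -
        have "(\<lambda>p. ((t - s, x + fst p), snd p)) \<in> borel \<Otimes>\<^sub>M sources ?I \<rightarrow>\<^sub>M (borel \<Otimes>\<^sub>M borel) \<Otimes>\<^sub>M sources ?I"
          by measurable
        from measurable_compose[OF this HS[of b ?I]] show ?thesis
          by (cases b) auto
      qed
      then show "(\<lambda>(z, \<omega>). ?H False (t - s) (x + z) \<omega> * ?H True (t - s) (x + z) \<omega>) \<in> borel_measurable (borel \<Otimes>\<^sub>M sources ?I)"
        unfolding case_prod_unfold by measurable
      show "W [] s \<in> borel_measurable (sources {Inr []})"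
        by (rule motion_sources) (use s in auto)
      show "\<bar>?H False (t - s) (x + z) \<omega> * ?H True (t - s) (x + z) \<omega>\<bar> \<le> 1" for z \<omega>
        using H01 by (simp add: abs_mult mult_le_one)
    qed (auto simp: SUB_def)
    also have "\<dots> = (\<integral>z. ?L False (t - s) (x + z) * ?L True (t - s) (x + z) \<partial>distr M borel (W [] s))"
    proof (rule Bochner_Integration.integral_cong[OF refl])
      fix z
      have meas: "(\<lambda>\<omega>. ?H b (t - s) (x + z) \<omega>) \<in> borel_measurable (sources (SUB b))" for b
        using measurable_Pair2[OF HS[of b "SUB b"], of "(t - s, x + z)"]
          by (simp add: space_pair_measure)
      have "indep_var borel (?H False (t - s) (x + z)) borel (?H True (t - s) (x + z))"
        by (rule indep_var_subalgebraI[OF indep_sources _ _ meas meas]) (auto simp: SUB_def)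
      moreover have "integrable M (?H b (t - s) (x + z))" for b
        by (rule integrable_const_bound[where B = 1])
          (use H01 measurable_sourcesD[OF meas] in \<open>auto\<close>)
      ultimately show "expectation (\<lambda>\<omega>. ?H False (t - s) (x + z) \<omega> * ?H True (t - s) (x + z) \<omega>) =
          ?L False (t - s) (x + z) * ?L True (t - s) (x + z)"
        unfolding bbm_laplace_def by (intro indep_var_lebesgue_integral) auto
    qed
    also have "\<dots> = K s"
    proof -
      have [measurable]: "(\<lambda>y. ?L b (t - s) y) \<in> borel_measurable borel" for b
        using measurable_Pair2[OF dyadic_bbm.measurable_bbm_laplace[OF child B, of \<mu> b], of "t - s"] by simp
      have [measurable]: "W [] s \<in> borel_measurable M" using s by (intro motion.random_variable) auto
      show ?thesis unfolding K_def by (subst integral_distr) auto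
    qed
    finally show ?thesis .
  qed
  have T0 [measurable]: "T [] \<in> borel_measurable M"
    by (rule measurable_sourcesD[OF lifetime_sources[of _ UNIV]]) simp
  interpret D: prob_space ?D by (rule prob_space_distr) measurable
  have mE: "(\<lambda>s. expectation (\<Phi> s)) \<in> borel_measurable borel"
  proof -
    have id: "(\<lambda>p. (fst p, snd p)) \<in> (borel \<Otimes>\<^sub>M M) \<rightarrow>\<^sub>M (borel \<Otimes>\<^sub>M sources ?J)"
      by (intro measurable_Pair measurable_fst measurable_compose[OF measurable_snd measurable_sourcesD[OF measurable_ident, unfolded id_def]])
    from measurable_compose[OF id mPhi] have "(\<lambda>(s, \<omega>). \<Phi> s \<omega>) \<in> borel_measurable (borel \<Otimes>\<^sub>M M)"
      by (simp add: case_prod_unfold)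
    then show ?thesis by (rule borel_measurable_lebesgue_integral)
  qed
  have E01: "0 \<le> expectation (\<Phi> s)" "expectation (\<Phi> s) \<le> 1" for s
  proof -
    show "0 \<le> expectation (\<Phi> s)" using Phi01 by (intro Bochner_Integration.integral_nonneg) auto
    have "(\<Phi> s) \<in> borel_measurable M"
      using measurable_Pair2[OF mPhi, of s] by (auto intro: measurable_sourcesD)
    then have "expectation (\<Phi> s) \<le> expectation (\<lambda>\<omega>. 1)"
      using Phi01 by (intro integral_mono integrable_const_bound[where B = 1]) auto
    then show "expectation (\<Phi> s) \<le> 1" by (simp add: prob_space)
  qed
  \<comment> \<open>Lifetimes are positive, so up to a null set the line splits into
    \<open>{0<..t}\<close>, where branching has occurred, and \<open>{t<..}\<close>.\<close>
  have D_pos: "AE s in ?D. 0 < s"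
    by (subst AE_distr_iff) (auto intro: lifetime_pos)
  have "(\<integral>s. expectation (\<Phi> s) \<partial>?D) =
      (\<integral>s. indicator {t<..} s * c + indicator {0<..t} s * expectation (\<Phi> s) \<partial>?D)"
    by (rule integral_cong_AE) (use mE D_pos in \<open>auto simp: indicator_def EPhi1 elim!: eventually_mono\<close>)
  also have "\<dots> = (\<integral>s. indicator {t<..} s * c \<partial>?D) + (\<integral>s. indicator {0<..t} s * expectation (\<Phi> s) \<partial>?D)"
    by (intro Bochner_Integration.integral_add D.integrable_const_bound[where B = "max 1 \<bar>c\<bar>"])
      (use mE E01 in \<open>auto simp: indicator_def le_max_iff_disj\<close>)
  also have "(\<integral>s. indicator {t<..} s * c \<partial>?D) = exp (- \<beta> * t) * c"
  proof -
    have "(\<integral>s. indicator {t<..} s * c \<partial>?D) = measure ?D {t<..} * c" by simp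
    also have "measure ?D {t<..} = \<P>(\<omega> in M. t < T [] \<omega>)"
      by (subst measure_distr) (auto intro!: arg_cong[where f = prob])
    also have "\<dots> = exp (- \<beta> * t)"
      using exponential_distributedD_gt[OF lifetime[of "[]"] t rate_pos] by (simp add: mult.commute)
    finally show ?thesis by simp
  qed
  also have "(\<integral>s. indicator {0<..t} s * expectation (\<Phi> s) \<partial>?D) =
      (\<integral>s. exponential_density \<beta> s * (indicator {0<..t} s * expectation (\<Phi> s)) \<partial>lborel)"
    using distributed_integral[OF lifetime[of "[]"], of "\<lambda>s. indicator {0<..t} s * expectation (\<Phi> s)"] mE
    by (subst integral_distr) (auto simp: exponential_density_nonneg rate_pos)
  also have "\<dots> = (\<integral>s\<in>{0<..t}. \<beta> * exp (- \<beta> * s) * K s \<partial>lborel)"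
    unfolding set_lebesgue_integral_def
    by (rule Bochner_Integration.integral_cong)
      (auto simp: indicator_def exponential_density_def EPhi2 mult.commute)
  finally show ?thesis using L by (simp add: c_def K_def)
qed

end

section \<open>Mild equations with different rates\<close>

text \<open>One closure class for all integrands below. The bound is required on the whole type and
  not only on \<open>space K\<close>, so that it passes to compositions and slices without side
  conditions.\<close>

definition bounded_measurable :: "'b measure \<Rightarrow> ('b \<Rightarrow> real) \<Rightarrow> bool" where
  "bounded_measurable K f \<longleftrightarrow> f \<in> borel_measurable K \<and> (\<exists>C. \<forall>x. \<bar>f x\<bar> \<le> C)"

lemma bounded_measurableI: "f \<in> borel_measurable K \<Longrightarrow> (\<And>x. \<bar>f x\<bar> \<le> C) \<Longrightarrow> bounded_measurable K f"
  by (auto simp: bounded_measurable_def)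

lemma bounded_measurableD: "bounded_measurable K f \<Longrightarrow> f \<in> borel_measurable K"
  by (simp add: bounded_measurable_def)

lemma bounded_measurableE:
  assumes "bounded_measurable K f"
  obtains C where "0 \<le> C" "\<And>x. \<bar>f x\<bar> \<le> C"
proof -
  obtain C where C: "\<And>x. \<bar>f x\<bar> \<le> C" using assms by (auto simp: bounded_measurable_def)
  show ?thesis using C[of undefined] by (intro that[of C] C) linarith
qed

lemma bounded_measurable_const [simp]: "bounded_measurable K (\<lambda>x. c)"
  by (rule bounded_measurableI[of _ _ "\<bar>c\<bar>"]) auto

lemma bounded_measurable_add:
  assumes "bounded_measurable K f" "bounded_measurable K g"
  shows "bounded_measurable K (\<lambda>x. f x + g x)"
proof -
  from assms obtain C D where "\<And>x. \<bar>f x\<bar> \<le> C" "\<And>x. \<bar>g x\<bar> \<le> D" by (metis bounded_measurableE)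
  then show ?thesis using assms
    by (intro bounded_measurableI[of _ _ "C + D"])
      (auto intro: borel_measurable_add bounded_measurableD order_trans[OF abs_triangle_ineq add_mono])
qed

lemma bounded_measurable_mult:
  assumes "bounded_measurable K f" "bounded_measurable K g"
  shows "bounded_measurable K (\<lambda>x. f x * g x)"
proof -
  from assms obtain C D where "\<And>x. \<bar>f x\<bar> \<le> C" "\<And>x. \<bar>g x\<bar> \<le> D" "0 \<le> C" by (metis bounded_measurableE)
  then show ?thesis using assms
    by (intro bounded_measurableI[of _ _ "C * D"])
      (auto intro: borel_measurable_times bounded_measurableD simp: abs_mult intro!: mult_mono)
qed

lemma bounded_measurable_diff:
  assumes "bounded_measurable K f" "bounded_measurable K g"
  shows "bounded_measurable K (\<lambda>x. f x - g x)"
  using bounded_measurable_add[OF assms(1) bounded_measurable_mult[OF bounded_measurable_const[of K "-1"] assms(2)]]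
  by simp

lemma bounded_measurable_power2: "bounded_measurable K f \<Longrightarrow> bounded_measurable K (\<lambda>x. (f x)\<^sup>2)"
  unfolding power2_eq_square by (intro bounded_measurable_mult)

lemma bounded_measurable_abs:
  assumes "bounded_measurable K f"
  shows "bounded_measurable K (\<lambda>x. \<bar>f x\<bar>)"
proof -
  have [measurable]: "f \<in> borel_measurable K" using assms by (rule bounded_measurableD)
  from assms obtain C where "\<And>x. \<bar>f x\<bar> \<le> C" by (metis bounded_measurableE)
  then show ?thesis by (intro bounded_measurableI[of _ _ C]) auto
qed

lemma bounded_measurable_max_0:
  assumes "bounded_measurable K f"
  shows "bounded_measurable K (\<lambda>x. max 0 (f x))"
proof -
  have "bounded_measurable K (\<lambda>x. 1/2 * (f x + \<bar>f x\<bar>))"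
    using assms by (intro bounded_measurable_mult bounded_measurable_add bounded_measurable_abs) auto
  moreover have "(\<lambda>x. 1/2 * (f x + \<bar>f x\<bar>)) = (\<lambda>x. max 0 (f x))" by (auto simp: fun_eq_iff max_def)
  ultimately show ?thesis by simp
qed

lemma bounded_measurable_indicator: "A \<in> sets K \<Longrightarrow> bounded_measurable K (indicator A)"
  by (rule bounded_measurableI[of _ _ 1]) (auto simp: indicator_def)

lemma bounded_measurable_compose:
  "bounded_measurable K f \<Longrightarrow> g \<in> L \<rightarrow>\<^sub>M K \<Longrightarrow> bounded_measurable L (\<lambda>x. f (g x))"
  by (auto simp: bounded_measurable_def)

lemmas bounded_measurable_intros =
  bounded_measurable_const bounded_measurable_add bounded_measurable_mult bounded_measurable_diff
  bounded_measurable_power2 bounded_measurable_max_0 bounded_measurable_abs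

lemma (in finite_measure) bounded_measurable_integrable:
  assumes "bounded_measurable M f"
  shows "integrable M f"
proof -
  from assms obtain C where "\<And>x. \<bar>f x\<bar> \<le> C" by (metis bounded_measurableE)
  then show ?thesis
    by (intro integrable_const_bound[where B = C] bounded_measurableD[OF assms]) auto
qed

lemma bounded_measurable_set_integrable:
  fixes f :: "real \<Rightarrow> real"
  assumes "bounded_measurable borel f"
  shows "set_integrable lborel {0<..t} f"
proof -
  obtain C where C: "\<And>x. \<bar>f x\<bar> \<le> C" "0 \<le> C" using assms by (metis bounded_measurableE)
  show ?thesis
  proof (rule set_integrable_bound[where f = "\<lambda>_. C"])
    show "set_integrable lborel {0<..t} (\<lambda>_. C)"
      unfolding set_integrable_def scaleR_conv_of_real
      by (intro integrable_mult_left integrable_real_indicator) (cases "0 \<le> t", auto)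
  qed (use assms C in \<open>auto dest: bounded_measurableD simp: set_borel_measurable_def\<close>)
qed

lemma set_integrable_exp_mult:
  fixes f :: "real \<Rightarrow> real"
  assumes "bounded_measurable borel f"
  shows "set_integrable lborel {0<..t} (\<lambda>s. exp (c * s) * f s)"
proof -
  have "bounded_measurable borel (\<lambda>s. indicator {0<..t} s * exp (c * s))"
  proof (rule bounded_measurableI[of _ _ "exp (\<bar>c\<bar> * \<bar>t\<bar>)"])
    fix s :: real
    have "c * s \<le> \<bar>c\<bar> * \<bar>t\<bar>" if "s \<in> {0<..t}"
      by (rule order_trans[OF mult_right_mono[OF abs_ge_self] mult_left_mono]) (use that in auto)
    then show "\<bar>indicator {0<..t} s * exp (c * s)\<bar> \<le> exp (\<bar>c\<bar> * \<bar>t\<bar>)" by (auto simp: indicator_def)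
  qed simp
  from bounded_measurable_set_integrable[OF bounded_measurable_mult[OF this assms], of t]
  show ?thesis
    by (rule set_integrable_cong[THEN iffD1, rotated -1]) auto
qed

lemma set_integral_exp:
  fixes c t :: real
  assumes "0 \<le> t"
  shows "(\<integral>s\<in>{0<..t}. c * exp (c * s) \<partial>lborel) = exp (c * t) - 1"
proof -
  have "(\<integral>s. (c * exp (c * s)) * indicator {0..t} s \<partial>lborel) = exp (c * t) - exp (c * 0)"
    using assms by (intro integral_FTC_Icc_real) (auto intro!: derivative_eq_intros continuous_intros)
  moreover have "(\<integral>s\<in>{0<..t}. c * exp (c * s) \<partial>lborel) = (\<integral>s. (c * exp (c * s)) * indicator {0..t} s \<partial>lborel)"
    unfolding set_lebesgue_integral_def
  proof (rule integral_cong_AE)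
    show "AE s in lborel. indicator {0<..t} s *\<^sub>R (c * exp (c * s)) = c * exp (c * s) * indicator {0..t} s"
      using AE_lborel_singleton[of "0::real"] by eventually_elim (auto simp: indicator_def)
  qed simp_all
  ultimately show ?thesis by simp
qed

text \<open>In the application \<open>A s\<close> is the heat flow of \<open>w (t - s)\<close>,
  \<open>b s\<close> that of the source, and \<open>x\<close> is the same for all \<open>s\<close>
  because the equation can be restarted. Formally \<open>A' = \<beta> A - b\<close>, hence
  \<open>exp (- c s) A\<close> has derivative \<open>exp (- c s) ((\<beta> - c) A - b)\<close>, and
  integration gives the claim. As \<open>A\<close> need not be differentiable, the integration by
  parts is done with Fubini.\<close>

lemma rate_change:
  fixes A b :: "real \<Rightarrow> real"
  assumes b: "bounded_measurable borel b"
    and eq: "\<And>s. 0 \<le> s \<Longrightarrow> s \<le> r \<Longrightarrow> x = exp (- \<beta> * s) * A s + (\<integral>\<sigma>\<in>{0<..s}. exp (- \<beta> * \<sigma>) * b \<sigma> \<partial>lborel)"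
    and r: "0 \<le> r"
  shows "x = exp (- c * r) * A r + (\<integral>s\<in>{0<..r}. exp (- c * s) * (b s + (c - \<beta>) * A s) \<partial>lborel)"
proof -
  define k where "k = \<beta> - c"
  define f where "f \<sigma> = indicator {0<..r} \<sigma> * (exp (- \<beta> * \<sigma>) * b \<sigma>)" for \<sigma> :: real
  \<comment> \<open>The hypothesis reads \<open>exp (- \<beta> * s) * A s = x - I s\<close>; so
    every occurrence of \<open>A\<close> can be traded for \<open>I\<close>, and only the integral
    of \<open>k * exp (k * s) * I s\<close> remains to be computed.\<close>
  define I where "I s = (\<integral>\<sigma>\<in>{0<..s}. exp (- \<beta> * \<sigma>) * b \<sigma> \<partial>lborel)" for s
  define G where "G p = (case p of (s, \<sigma>) \<Rightarrow> indicator {0<..r} s * indicator {\<sigma>..} s * (k * exp (k * s)) * f \<sigma>)"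
    for p :: "real \<times> real"
  have fm [measurable]: "f \<in> borel_measurable borel"
    using bounded_measurableD[OF b] unfolding f_def by measurable
  have fi: "integrable lborel f"
    using set_integrable_exp_mult[OF b, of r "- \<beta>"] by (simp add: f_def[abs_def] set_integrable_def)
  have ei: "integrable lborel (\<lambda>s. indicator {0<..r} s * (k * exp (k * s)))"
    using set_integrable_exp_mult[OF bounded_measurable_const[of borel k], of r k]
    by (simp add: set_integrable_def mult.commute)
  have Gm [measurable]: "G \<in> borel_measurable (lborel \<Otimes>\<^sub>M lborel)"
  proof -
    have "G = (\<lambda>p. indicator {0<..r} (fst p) * (if snd p \<le> fst p then 1 else 0) * (k * exp (k * fst p)) * f (snd p))"
      by (auto simp: G_def fun_eq_iff indicator_def)
    then show ?thesis by simp
  qed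
  have Gi: "integrable (lborel \<Otimes>\<^sub>M lborel) G"
  proof (rule Bochner_Integration.integrable_bound[OF lborel_pair.integrable_product_swap])
    show "integrable (lborel \<Otimes>\<^sub>M lborel) (\<lambda>(\<sigma>, s). f \<sigma> * (indicator {0<..r} s * (k * exp (k * s))))"
    proof (rule lborel_pair.Fubini_integrable)
      show "integrable lborel (\<lambda>\<sigma>. \<integral>s. norm (case (\<sigma>, s) of (\<sigma>, s) \<Rightarrow> f \<sigma> * (indicator {0<..r} s * (k * exp (k * s)))) \<partial>lborel)"
        using fi by (simp add: abs_mult)
    qed (use ei in auto)
    show "AE p in lborel \<Otimes>\<^sub>M lborel. norm (G p) \<le> norm (case p of (x, y) \<Rightarrow> case (y, x) of (\<sigma>, s) \<Rightarrow> f \<sigma> * (indicator {0<..r} s * (k * exp (k * s))))"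
      by (auto simp: G_def indicator_def abs_mult)
  qed measurable
  have If: "indicator {0<..r} s * (k * exp (k * s)) * I s = (\<integral>\<sigma>. G (s, \<sigma>) \<partial>lborel)" for s
  proof -
    have "(\<integral>\<sigma>. G (s, \<sigma>) \<partial>lborel) = (\<integral>\<sigma>. indicator {0<..r} s * (k * exp (k * s)) * (indicator {0<..s} \<sigma> * (exp (- \<beta> * \<sigma>) * b \<sigma>)) \<partial>lborel)"
      by (rule Bochner_Integration.integral_cong) (auto simp: G_def f_def indicator_def)
    then show ?thesis by (simp add: I_def set_lebesgue_integral_def)
  qed
  have kexp: "(\<integral>s. indicator {0<..r} s * indicator {\<sigma>..} s * (k * exp (k * s)) \<partial>lborel) = exp (k * r) - exp (k * \<sigma>)"
    if "0 < \<sigma>" "\<sigma> \<le> r" for \<sigma>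
  proof -
    have "(\<integral>s. (k * exp (k * s)) * indicator {\<sigma>..r} s \<partial>lborel) = exp (k * r) - exp (k * \<sigma>)"
      using that by (intro integral_FTC_Icc_real) (auto intro!: derivative_eq_intros continuous_intros)
    moreover have "(\<lambda>s. indicator {0<..r} s * indicator {\<sigma>..} s * (k * exp (k * s))) = (\<lambda>s. (k * exp (k * s)) * indicator {\<sigma>..r} s)"
      using that by (auto simp: fun_eq_iff indicator_def)
    ultimately show ?thesis by simp
  qed
  \<comment> \<open>\<open>G\<close> lives on the triangle where \<sigma> is below \<open>s\<close>;
    integrating out \<open>s\<close> first is elementary.\<close>
  have fub: "(\<integral>s\<in>{0<..r}. k * exp (k * s) * I s \<partial>lborel) = (\<integral>\<sigma>. f \<sigma> * (exp (k * r) - exp (k * \<sigma>)) \<partial>lborel)"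
  proof -
    have "(\<integral>s\<in>{0<..r}. k * exp (k * s) * I s \<partial>lborel) = (\<integral>s. (\<integral>\<sigma>. G (s, \<sigma>) \<partial>lborel) \<partial>lborel)"
      unfolding set_lebesgue_integral_def If[symmetric] by (simp add: mult.assoc)
    also have "\<dots> = (\<integral>\<sigma>. (\<integral>s. G (s, \<sigma>) \<partial>lborel) \<partial>lborel)"
      using lborel_pair.Fubini_integral[of "\<lambda>s \<sigma>. G (s, \<sigma>)"] Gi by (simp add: case_prod_unfold)
    also have "\<dots> = (\<integral>\<sigma>. f \<sigma> * (exp (k * r) - exp (k * \<sigma>)) \<partial>lborel)"
    proof (rule Bochner_Integration.integral_cong[OF refl])
      fix \<sigma>
      show "(\<integral>s. G (s, \<sigma>) \<partial>lborel) = f \<sigma> * (exp (k * r) - exp (k * \<sigma>))"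
      proof (cases "0 < \<sigma> \<and> \<sigma> \<le> r")
        case True
        then show ?thesis by (simp add: G_def kexp mult.commute[of _ "f \<sigma>"])
      qed (auto simp: G_def f_def)
    qed
    finally show ?thesis .
  qed
  have fki: "integrable lborel (\<lambda>\<sigma>. f \<sigma> * exp (k * \<sigma>))"
    using set_integrable_exp_mult[OF b, of r "k - \<beta>"]
    by (simp add: f_def[abs_def] set_integrable_def exp_add[symmetric] algebra_simps exp_diff exp_minus divide_inverse)
  define E where "E = (\<integral>\<sigma>. f \<sigma> * exp (k * \<sigma>) \<partial>lborel)"
  have fub': "(\<integral>s\<in>{0<..r}. k * exp (k * s) * I s \<partial>lborel) = exp (k * r) * I r - E"
    unfolding fub E_def right_diff_distrib
    by (subst Bochner_Integration.integral_diff[OF _ fki])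
      (use fi in \<open>auto simp: I_def f_def[abs_def] set_lebesgue_integral_def mult.commute\<close>)
  have As: "exp (- c * s) * A s = exp (k * s) * (x - I s)" if "0 \<le> s" "s \<le> r" for s
  proof -
    have "x - I s = exp (- \<beta> * s) * A s" using eq[OF that] by (simp add: I_def)
    then show ?thesis by (simp add: k_def algebra_simps exp_add[symmetric] exp_diff exp_minus field_simps)
  qed
  have Iint: "set_integrable lborel {0<..r} (\<lambda>s. k * exp (k * s) * I s)"
    using lborel_pair.integrable_fst'[OF Gi] by (simp add: set_integrable_def If[symmetric] mult.assoc)
  have "(\<integral>s\<in>{0<..r}. exp (- c * s) * (b s + (c - \<beta>) * A s) \<partial>lborel) =
     (\<integral>s\<in>{0<..r}. exp (- c * s) * b s - x * (k * exp (k * s)) + k * exp (k * s) * I s \<partial>lborel)"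
  proof (rule set_lebesgue_integral_cong)
    show "\<forall>s. s \<in> {0<..r} \<longrightarrow> exp (- c * s) * (b s + (c - \<beta>) * A s) = exp (- c * s) * b s - x * (k * exp (k * s)) + k * exp (k * s) * I s"
    proof (intro allI impI)
      fix s assume "s \<in> {0<..r}"
      then have "exp (- c * s) * A s = exp (k * s) * (x - I s)" by (intro As) auto
      then have "(c - \<beta>) * (exp (- c * s) * A s) = - k * (exp (k * s) * (x - I s))" by (simp add: k_def)
      then show "exp (- c * s) * (b s + (c - \<beta>) * A s) = exp (- c * s) * b s - x * (k * exp (k * s)) + k * exp (k * s) * I s"
        by (simp add: algebra_simps)
    qed
  qed simp
  also have "\<dots> = (\<integral>s\<in>{0<..r}. exp (- c * s) * b s \<partial>lborel) - x * (exp (k * r) - 1) + (exp (k * r) * I r - E)"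
  proof -
    have i1: "set_integrable lborel {0<..r} (\<lambda>s. exp (- c * s) * b s)" by (rule set_integrable_exp_mult[OF b])
    have i2: "set_integrable lborel {0<..r} (\<lambda>s. x * (k * exp (k * s)))"
      using set_integrable_exp_mult[OF bounded_measurable_const[of borel "x * k"], of r k] by (simp add: mult_ac)
    have "(\<integral>s\<in>{0<..r}. x * (k * exp (k * s)) \<partial>lborel) = x * (exp (k * r) - 1)"
      using set_integral_exp[OF r, of k] by (simp only: set_integral_mult_right)
    then show ?thesis
      using i1 i2 Iint fub' by (simp only: set_integral_add set_integral_diff)
  qed
  also have "(\<integral>s\<in>{0<..r}. exp (- c * s) * b s \<partial>lborel) = E"
    unfolding E_def set_lebesgue_integral_def
    by (rule Bochner_Integration.integral_cong) (auto simp: f_def k_def exp_add[symmetric] algebra_simps exp_diff exp_minus divide_inverse indicator_def)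
  finally show ?thesis using As[of r] r by (simp add: algebra_simps)
qed

section \<open>The heat semigroup\<close>

definition gauss_density :: "real \<Rightarrow> 'a::euclidean_space \<Rightarrow> real" where
  "gauss_density s z = (\<Prod>b\<in>Basis. normal_density 0 (sqrt s) (z \<bullet> b))"

text \<open>The semigroup of half the Laplacian. Using the density instead of a path makes it depend
  neither on the probability space nor on the particle, so all motions \<open>W u\<close> share
  it.\<close>

definition heat :: "real \<Rightarrow> ('a::euclidean_space \<Rightarrow> real) \<Rightarrow> 'a \<Rightarrow> real" where
  "heat s f x = (if s \<le> 0 then f x else \<integral>z. gauss_density s z * f (x + z) \<partial>lborel)"

lemma heat_0 [simp]: "heat 0 f x = f x"
  by (simp add: heat_def)

lemma (in prob_space) indep_vars_imp_indep_var:
  assumes ind: "indep_vars (\<lambda>_. N) X I" and ij: "i \<in> I" "j \<in> I" "i \<noteq> j"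
  shows "indep_var N (X i) N (X j)"
proof -
  have rv: "\<And>i. i \<in> I \<Longrightarrow> random_variable N (X i)"
    and s: "indep_sets (\<lambda>i. {X i -` A \<inter> space M |A. A \<in> sets N}) I"
    using ind by (auto simp: indep_vars_def2)
  have "indep_sets (\<lambda>b. (\<lambda>i. {X i -` A \<inter> space M |A. A \<in> sets N}) (case_bool i j b)) UNIV"
    by (rule indep_sets_reindex_inj)
      (use ij in \<open>auto simp: inj_on_def intro!: indep_sets_mono_index[OF _ s] split: bool.splits\<close>)
  moreover have "(\<lambda>b. (\<lambda>i. {X i -` A \<inter> space M |A. A \<in> sets N}) (case_bool i j b)) =
      (\<lambda>b. {case_bool (X i) (X j) b -` A \<inter> space M |A. A \<in> sets (case_bool N N b)})"
    by (auto simp: fun_eq_iff split: bool.splits)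
  ultimately show ?thesis
    using rv ij unfolding indep_var_def indep_vars_def2 by (auto split: bool.splits)
qed

context brownian_motion
begin

lemma distributed_motion:
  assumes "0 < s"
  shows "distributed M lborel (W s) (\<lambda>z. ennreal (gauss_density s z))"
proof -
  have "distributed M lborel (\<lambda>\<omega>. W s \<omega> - W 0 \<omega>) (\<lambda>z. ennreal (gauss_density s z))"
    using gaussian_increments[of 0 s] assms by (simp add: gauss_density_def)
  then show ?thesis
    unfolding distributed_def
    by (auto simp: starts_at_zero cong: distr_cong measurable_cong)
qed

text \<open>Positivity, conservation of mass, measurability and the semigroup law are all read off
  from a Brownian motion through this identity, without computing with Gaussian densities.\<close>

lemma heat_eq_expectation:
  fixes f :: "'a \<Rightarrow> real"
  assumes f [measurable]: "f \<in> borel_measurable borel"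
  shows "heat s f x = expectation (\<lambda>\<omega>. f (x + W (max 0 s) \<omega>))"
proof (cases "s \<le> 0")
  case True
  have "expectation (\<lambda>\<omega>. f (x + W (max 0 s) \<omega>)) = expectation (\<lambda>\<omega>. f x)"
    using True by (intro Bochner_Integration.integral_cong) (auto simp: max_def starts_at_zero)
  then show ?thesis using True by (simp add: heat_def prob_space)
next
  case False
  have "(\<integral>z. gauss_density s z * f (x + z) \<partial>lborel) = expectation (\<lambda>\<omega>. f (x + W s \<omega>))"
    by (rule distributed_integral[OF distributed_motion])
      (use False in \<open>auto simp: gauss_density_def intro!: prod_nonneg\<close>)
  then show ?thesis using False by (simp add: heat_def max_def)
qed

lemma measurable_motion: "(\<lambda>(s, \<omega>). W (max 0 s) \<omega>) \<in> borel_measurable (borel \<Otimes>\<^sub>M M)"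
  by (rule measurable_continuous_process[OF random_variable continuous_paths])

lemma measurable_motion_event [measurable]: "W (max 0 s) \<in> borel_measurable M"
  by (rule random_variable) simp

lemma integrable_heat:
  assumes "bounded_measurable borel f"
  shows "integrable M (\<lambda>\<omega>. f (x + W (max 0 s) \<omega>))"
  by (rule bounded_measurable_integrable[OF bounded_measurable_compose[OF assms]]) measurable

lemma heat_mono:
  fixes f g :: "'a \<Rightarrow> real"
  assumes "bounded_measurable borel f" "bounded_measurable borel g" "\<And>y. f y \<le> g y"
  shows "heat s f x \<le> heat s g x"
  using assms by (auto simp: heat_eq_expectation bounded_measurableD intro!: integral_mono integrable_heat)

lemma heat_const [simp]: "heat s (\<lambda>y. c) (x :: 'a) = c"
  by (simp add: heat_eq_expectation prob_space)

lemma heat_nonneg: "(f :: 'a \<Rightarrow> real) \<in> borel_measurable borel \<Longrightarrow> (\<And>y. 0 \<le> f y) \<Longrightarrow> 0 \<le> heat s f x"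
  by (simp add: heat_eq_expectation)

lemma heat_le_const: "bounded_measurable borel (f :: 'a \<Rightarrow> real) \<Longrightarrow> (\<And>y. f y \<le> c) \<Longrightarrow> heat s f x \<le> c"
  using heat_mono[of f "\<lambda>_. c"] by simp

lemma heat_add:
  fixes f g :: "'a \<Rightarrow> real"
  assumes "bounded_measurable borel f" "bounded_measurable borel g"
  shows "heat s (\<lambda>y. f y + g y) x = heat s f x + heat s g x"
  using assms integrable_heat[OF assms(1)] integrable_heat[OF assms(2)]
  by (subst (1 2 3) heat_eq_expectation)
    (auto intro: bounded_measurableD bounded_measurable_intros)

lemma heat_cmult:
  fixes f :: "'a \<Rightarrow> real"
  assumes "bounded_measurable borel f"
  shows "heat s (\<lambda>y. c * f y) x = c * heat s f x"
  using assms
  by (subst (1 2) heat_eq_expectation) (auto intro: bounded_measurableD borel_measurable_times)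

lemma heat_diff:
  fixes f g :: "'a \<Rightarrow> real"
  assumes "bounded_measurable borel f" "bounded_measurable borel g"
  shows "heat s (\<lambda>y. f y - g y) x = heat s f x - heat s g x"
  using assms integrable_heat[OF assms(1)] integrable_heat[OF assms(2)]
  by (subst (1 2 3) heat_eq_expectation)
    (auto intro: bounded_measurableD bounded_measurable_intros)

lemma bounded_measurable_heat:
  fixes F :: "'p \<Rightarrow> 'a \<Rightarrow> real"
  assumes F: "bounded_measurable (K \<Otimes>\<^sub>M borel) (\<lambda>(p, y). F p y)"
    and [measurable]: "\<sigma> \<in> borel_measurable K" "\<xi> \<in> borel_measurable K"
  shows "bounded_measurable K (\<lambda>p. heat (\<sigma> p) (F p) (\<xi> p))"
proof -
  obtain C where C: "0 \<le> C" "\<And>p y. \<bar>F p y\<bar> \<le> C"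
    using bounded_measurableE[OF F] by (metis case_prod_conv)
  have Fm [measurable]: "(\<lambda>(p, y). F p y) \<in> borel_measurable (K \<Otimes>\<^sub>M borel)"
    using F by (rule bounded_measurableD)
  have "(\<lambda>q. W (max 0 (\<sigma> (fst q))) (snd q)) \<in> borel_measurable (K \<Otimes>\<^sub>M M)"
    using measurable_compose[OF _ measurable_motion, of "\<lambda>q. (\<sigma> (fst q), snd q)" "K \<Otimes>\<^sub>M M"] by simp
  then have "(\<lambda>q. (fst q, \<xi> (fst q) + W (max 0 (\<sigma> (fst q))) (snd q))) \<in> K \<Otimes>\<^sub>M M \<rightarrow>\<^sub>M K \<Otimes>\<^sub>M borel"
    by measurable
  from measurable_compose[OF this Fm]
  have m: "(\<lambda>(p, \<omega>). F p (\<xi> p + W (max 0 (\<sigma> p)) \<omega>)) \<in> borel_measurable (K \<Otimes>\<^sub>M M)"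
    by (simp add: case_prod_unfold)
  define E where "E p = expectation (\<lambda>\<omega>. F p (\<xi> p + W (max 0 (\<sigma> p)) \<omega>))" for p
  have Em: "E \<in> borel_measurable K"
    unfolding E_def[abs_def] by (rule borel_measurable_lebesgue_integral[OF m])
  have eq: "heat (\<sigma> p) (F p) (\<xi> p) = E p" if "p \<in> space K" for p
    using measurable_Pair2[OF Fm that] by (simp add: E_def heat_eq_expectation)
  \<comment> \<open>The bound has to hold for all \<open>p\<close>, also outside
    \<open>space K\<close>, where the slice \<open>F p\<close> may fail to be measurable; there a
    nonexistent integral has the value 0.\<close>
  have bd: "\<bar>heat (\<sigma> p) (F p) (\<xi> p)\<bar> \<le> C" for p
  proof (cases "\<sigma> p \<le> 0")
    case True then show ?thesis by (simp add: heat_def C)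
  next
    case False
    let ?g = "\<lambda>z :: 'a. gauss_density (\<sigma> p) z"
    show ?thesis
    proof (cases "integrable lborel (\<lambda>z. ?g z * F p (\<xi> p + z))")
      case True
      have g0: "0 \<le> ?g z" for z by (auto simp: gauss_density_def intro!: prod_nonneg)
      have gi: "integrable lborel ?g" "(\<integral>z. ?g z \<partial>lborel) = 1"
      proof -
        show 1: "(\<integral>z. ?g z \<partial>lborel) = 1"
          using distributed_integral[OF distributed_motion, of "\<sigma> p" "\<lambda>_. 1"] False
          by (auto simp: prob_space g0)
        show "integrable lborel ?g" using 1 by (metis not_integrable_integral_eq zero_neq_one)
      qed
      have "\<bar>\<integral>z. ?g z * F p (\<xi> p + z) \<partial>lborel\<bar> \<le> (\<integral>z. \<bar>?g z * F p (\<xi> p + z)\<bar> \<partial>lborel)"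
        by (rule integral_abs_bound)
      also have "\<dots> \<le> (\<integral>z. C * ?g z \<partial>lborel)"
        using True gi g0 C by (intro integral_mono integrable_abs) (auto simp: abs_mult mult.commute[of C] intro!: mult_left_mono)
      also have "\<dots> = C" using gi by simp
      finally show ?thesis using False by (simp add: heat_def)
    qed (use False C in \<open>simp add: heat_def not_integrable_integral_eq\<close>)
  qed
  show ?thesis
    by (rule bounded_measurableI[of _ _ C])
      (use Em eq bd in \<open>auto cong: measurable_cong\<close>)
qed

text \<open>Independence of the increments over \<open>[0, r]\<close> and \<open>[r, r + s]\<close>
  turns the expectation at time \<open>r + s\<close> into an iterated integral.\<close>

lemma heat_semigroup:
  fixes f :: "'a \<Rightarrow> real"
  assumes f: "bounded_measurable borel f" and "0 \<le> r" "0 \<le> s"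
  shows "heat r (heat s f) x = heat (r + s) f x"
proof (cases "r = 0 \<or> s = 0")
  case True
  have "heat s f = f" if "s = 0" using that by (simp add: fun_eq_iff)
  then show ?thesis using True by auto
next
  case False
  then have rs: "0 < r" "0 < s" using assms by auto
  have fm [measurable]: "f \<in> borel_measurable borel" using f by (rule bounded_measurableD)
  have [measurable]: "W r \<in> borel_measurable M" "W (r + s) \<in> borel_measurable M"
    using assms by (auto intro: random_variable)
  define Y where "Y \<omega> = W (r + s) \<omega> - W r \<omega>" for \<omega>
  have [measurable]: "Y \<in> borel_measurable M" unfolding Y_def by measurable
  define \<tau> where "\<tau> i = (if i = 0 then 0 else if i = 1 then r else r + s)" for i :: nat
  have "indep_vars (\<lambda>_. borel) (\<lambda>i \<omega>. W (\<tau> (Suc i)) \<omega> - W (\<tau> i) \<omega>) {..<2::nat}"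
    by (rule independent_increments) (use rs in \<open>auto simp: \<tau>_def\<close>)
  then have "indep_var borel (\<lambda>\<omega>. W (\<tau> (Suc 0)) \<omega> - W (\<tau> 0) \<omega>) borel (\<lambda>\<omega>. W (\<tau> (Suc 1)) \<omega> - W (\<tau> 1) \<omega>)"
    by (rule indep_vars_imp_indep_var) auto
  then have ind: "indep_var borel (\<lambda>\<omega>. W r \<omega> - W 0 \<omega>) borel Y"
    by (simp add: \<tau>_def Y_def[abs_def] cong: if_cong)
  let ?X = "\<lambda>\<omega>. W r \<omega> - W 0 \<omega>"
  have [measurable]: "?X \<in> borel_measurable M" using ind by (rule indep_var_rv1)
  let ?DX = "distr M borel ?X" and ?DY = "distr M borel Y"
  interpret X: prob_space ?DX by (rule prob_space_distr) measurable
  interpret Y: prob_space ?DY by (rule prob_space_distr) measurable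
  interpret P: pair_prob_space ?DX ?DY ..
  have eq: "?DX \<Otimes>\<^sub>M ?DY = distr M (borel \<Otimes>\<^sub>M borel) (\<lambda>\<omega>. (?X \<omega>, Y \<omega>))"
    using ind by (simp add: indep_var_distribution_eq)
  have "heat (r + s) f x = expectation (\<lambda>\<omega>. f (x + W (r + s) \<omega>))"
    using rs by (simp add: heat_eq_expectation max_def)
  also have "\<dots> = expectation (\<lambda>\<omega>. case (?X \<omega>, Y \<omega>) of (z, y) \<Rightarrow> f (x + z + y))"
    by (rule Bochner_Integration.integral_cong) (auto simp: Y_def starts_at_zero)
  also have "\<dots> = (\<integral>p. (case p of (z, y) \<Rightarrow> f (x + z + y)) \<partial>(?DX \<Otimes>\<^sub>M ?DY))"
    unfolding eq by (subst integral_distr) auto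
  also have "\<dots> = (\<integral>z. (\<integral>y. f (x + z + y) \<partial>?DY) \<partial>?DX)"
  proof (subst P.integral_fst'[symmetric])
    have "bounded_measurable (?DX \<Otimes>\<^sub>M ?DY) (\<lambda>p. f (x + fst p + snd p))"
      by (rule bounded_measurable_compose[OF f]) measurable
    then show "integrable (?DX \<Otimes>\<^sub>M ?DY) (\<lambda>(z, y). f (x + z + y))"
      using P.bounded_measurable_integrable by (simp add: case_prod_unfold)
  qed simp
  also have "\<dots> = (\<integral>z. heat s f (x + z) \<partial>?DX)"
  proof (rule Bochner_Integration.integral_cong[OF refl])
    fix z
    have "distributed M lborel Y (\<lambda>z. ennreal (gauss_density s z))"
      using gaussian_increments[of r "r + s"] rs by (simp add: gauss_density_def[abs_def] Y_def[abs_def])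
    then have "(\<integral>u. gauss_density s u * f (x + z + u) \<partial>lborel) = expectation (\<lambda>\<omega>. f (x + z + Y \<omega>))"
      by (rule distributed_integral) (auto simp: gauss_density_def intro!: prod_nonneg)
    then show "(\<integral>y. f (x + z + y) \<partial>?DY) = heat s f (x + z)"
      using rs by (subst integral_distr) (auto simp: heat_def)
  qed
  also have "\<dots> = heat r (heat s f) x"
  proof -
    have "bounded_measurable borel (\<lambda>y. heat s f y)"
      by (rule bounded_measurable_heat) (auto simp: case_prod_unfold intro: bounded_measurable_compose[OF f])
    then have [measurable]: "heat s f \<in> borel_measurable borel" by (auto dest: bounded_measurableD)
    have "(\<integral>z. heat s f (x + z) \<partial>?DX) = expectation (\<lambda>\<omega>. heat s f (x + ?X \<omega>))"
      by (subst integral_distr) auto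
    also have "\<dots> = expectation (\<lambda>\<omega>. heat s f (x + W r \<omega>))"
      by (rule Bochner_Integration.integral_cong) (auto simp: starts_at_zero)
    finally show ?thesis using rs by (simp add: heat_eq_expectation[of "heat s f"] max_def)
  qed
  finally show ?thesis by simp
qed

end

section \<open>Mild solutions of the FKPP equation\<close>

lemma set_integral_mono_Ioc:
  fixes f g :: "real \<Rightarrow> real"
  assumes "set_integrable lborel {0<..t} f" "set_integrable lborel {0<..t} g"
    and "\<And>s. 0 < s \<Longrightarrow> s \<le> t \<Longrightarrow> f s \<le> g s"
  shows "(\<integral>s\<in>{0<..t}. f s \<partial>lborel) \<le> (\<integral>s\<in>{0<..t}. g s \<partial>lborel)"
  using assms by (intro set_integral_mono) auto

lemma set_integral_power:
  fixes A C r :: real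
  assumes r: "0 \<le> r"
  shows "(\<integral>s\<in>{0<..r}. A * (C * (r - s)) ^ n / fact n \<partial>lborel) = A * C ^ n * r ^ Suc n / fact (Suc n)"
proof -
  have "(\<integral>s. (A * (C * (r - s)) ^ n / fact n) * indicator {0..r} s \<partial>lborel) =
      - A * C ^ n * (r - r) ^ Suc n / fact (Suc n) - (- A * C ^ n * (r - 0) ^ Suc n / fact (Suc n))"
  proof (rule integral_FTC_Icc_real)
    fix s
    have "((\<lambda>s. - A * C ^ n * (r - s) ^ Suc n / fact (Suc n)) has_real_derivative
        - A * C ^ n * (real (Suc n) * (r - s) ^ n * (- 1)) / fact (Suc n)) (at s)"
    proof -
      have "((\<lambda>s. (r - s) ^ Suc n) has_real_derivative real (Suc n) * (r - s) ^ n * (- 1)) (at s)"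
      proof -
        have "((\<lambda>s. r - s) has_real_derivative - 1) (at s)" by (auto intro!: derivative_eq_intros)
        from DERIV_power[OF this, of "Suc n"] show ?thesis by (simp del: power_Suc add: mult_ac)
      qed
      from DERIV_cdivide[OF DERIV_cmult[OF this, of "- A * C ^ n"], of "fact (Suc n)"]
      show ?thesis .
    qed
    also have "- A * C ^ n * (real (Suc n) * (r - s) ^ n * (- 1)) / fact (Suc n) = A * (C * (r - s)) ^ n / fact n"
      by (simp add: power_mult_distrib divide_simps)
    finally show "((\<lambda>s. - A * C ^ n * (r - s) ^ Suc n / fact (Suc n)) has_real_derivative A * (C * (r - s)) ^ n / fact n) (at s)" .
  qed (use r in \<open>auto intro!: continuous_intros\<close>)
  moreover have "(\<integral>s\<in>{0<..r}. A * (C * (r - s)) ^ n / fact n \<partial>lborel) = (\<integral>s. (A * (C * (r - s)) ^ n / fact n) * indicator {0..r} s \<partial>lborel)"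
    unfolding set_lebesgue_integral_def
  proof (rule integral_cong_AE)
    show "AE s in lborel. indicator {0<..r} s *\<^sub>R (A * (C * (r - s)) ^ n / fact n) = (A * (C * (r - s)) ^ n / fact n) * indicator {0..r} s"
      using AE_lborel_singleton[of "0::real"] by eventually_elim (auto simp: indicator_def)
  qed simp_all
  ultimately show ?thesis by simp
qed

section \<open>Space-time functions under the heat flow and a Gronwall lemma\<close>

context brownian_motion
begin

lemma bounded_measurable_heat_slice:
  fixes F :: "real \<Rightarrow> 'a \<Rightarrow> real" and \<sigma> \<rho> :: "real \<Rightarrow> real"
  assumes F: "bounded_measurable (borel \<Otimes>\<^sub>M borel) (\<lambda>(s, y). F s y)"
    and [measurable]: "\<sigma> \<in> borel_measurable borel" "\<rho> \<in> borel_measurable borel"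
  shows "bounded_measurable borel (\<lambda>s. heat (\<sigma> s) (F (\<rho> s)) x)"
proof (rule bounded_measurable_heat)
  show "bounded_measurable (borel \<Otimes>\<^sub>M borel) (\<lambda>(p, y). F (\<rho> p) y)"
    using bounded_measurable_compose[OF F, of "\<lambda>(p, y). (\<rho> p, y)"] by (simp add: case_prod_unfold)
qed measurable

lemma bounded_measurable_heat_pair:
  fixes F :: "real \<Rightarrow> 'a \<Rightarrow> real" and \<sigma> \<rho> :: "real \<Rightarrow> real"
  assumes F: "bounded_measurable (borel \<Otimes>\<^sub>M borel) (\<lambda>(s, y). F s y)"
    and [measurable]: "\<sigma> \<in> borel_measurable borel" "\<rho> \<in> borel_measurable borel"
  shows "bounded_measurable (borel \<Otimes>\<^sub>M borel) (\<lambda>(s, y). heat (\<sigma> s) (F (\<rho> s)) y)"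
proof -
  have "bounded_measurable (borel \<Otimes>\<^sub>M borel) (\<lambda>p. heat (\<sigma> (fst p)) (F (\<rho> (fst p))) (snd p :: 'a))"
  proof (rule bounded_measurable_heat)
    show "bounded_measurable ((borel \<Otimes>\<^sub>M borel) \<Otimes>\<^sub>M borel) (\<lambda>(p :: real \<times> 'a, y). F (\<rho> (fst p)) y)"
      using bounded_measurable_compose[OF F, of "\<lambda>(p :: real \<times> 'a, y). (\<rho> (fst p), y)"]
      by (simp add: case_prod_unfold)
  qed measurable
  then show ?thesis by (simp add: case_prod_unfold)
qed

lemma bounded_measurable_slice:
  fixes F :: "real \<Rightarrow> 'a \<Rightarrow> real"
  assumes F: "bounded_measurable (borel \<Otimes>\<^sub>M borel) (\<lambda>(s, y). F s y)"
  shows "bounded_measurable borel (F s)"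
  using bounded_measurable_compose[OF F, of "\<lambda>y. (s, y)"] by simp

lemma heat_set_integral:
  fixes F :: "real \<Rightarrow> 'a \<Rightarrow> real"
  assumes F: "bounded_measurable (borel \<Otimes>\<^sub>M borel) (\<lambda>(s, y). F s y)"
  shows "heat r (\<lambda>y. \<integral>s\<in>{0<..t}. exp (c * s) * F s y \<partial>lborel) x = (\<integral>s\<in>{0<..t}. exp (c * s) * heat r (F s) x \<partial>lborel)"
proof -
  obtain C where C: "0 \<le> C" "\<And>s y. \<bar>F s y\<bar> \<le> C"
    using bounded_measurableE[OF F] by (metis case_prod_conv)
  have [measurable]: "(\<lambda>(s, y). F s y) \<in> borel_measurable (borel \<Otimes>\<^sub>M borel)"
    using F by (rule bounded_measurableD)
  have [measurable]: "F s \<in> borel_measurable borel" for s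
    using bounded_measurable_slice[OF F] by (rule bounded_measurableD)
  let ?e = "\<lambda>s. indicator {0<..t} s * exp (c * s) :: real"
  let ?G = "\<lambda>s \<omega>. ?e s * F s (x + W (max 0 r) \<omega>)"
  interpret P: pair_sigma_finite lborel M by unfold_locales
  have Gm [measurable]: "(\<lambda>(s, \<omega>). ?G s \<omega>) \<in> borel_measurable (lborel \<Otimes>\<^sub>M M)"
  proof -
    have "(\<lambda>p. (fst p, x + W (max 0 r) (snd p))) \<in> lborel \<Otimes>\<^sub>M M \<rightarrow>\<^sub>M borel \<Otimes>\<^sub>M borel"
      by measurable
    from measurable_compose[OF this, of "\<lambda>(s, y). F s y" borel]
    have [measurable]: "(\<lambda>p. F (fst p) (x + W (max 0 r) (snd p))) \<in> borel_measurable (lborel \<Otimes>\<^sub>M M)"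
      by simp
    show ?thesis unfolding case_prod_unfold by measurable
  qed
  have ei: "integrable lborel ?e"
    using set_integrable_exp_mult[OF bounded_measurable_const[of borel 1], of t c] by (simp add: set_integrable_def)
  have Gi: "integrable (lborel \<Otimes>\<^sub>M M) (\<lambda>(s, \<omega>). ?G s \<omega>)"
  proof (rule Bochner_Integration.integrable_bound)
    show "integrable (lborel \<Otimes>\<^sub>M M) (\<lambda>(s, \<omega>). C * ?e s)"
      by (rule P.Fubini_integrable) (use ei in \<open>auto simp: prob_space abs_mult intro!: integrable_mult_right\<close>)
    show "AE p in lborel \<Otimes>\<^sub>M M. norm (case p of (s, \<omega>) \<Rightarrow> ?G s \<omega>) \<le> norm (case p of (s, \<omega>) \<Rightarrow> C * ?e s)"
      using C by (auto simp: abs_mult indicator_def)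
  qed measurable
  have "bounded_measurable (borel \<Otimes>\<^sub>M borel) (\<lambda>(y, s). F s y)"
    using bounded_measurable_compose[OF F, of "\<lambda>(y, s). (s, y)" "borel \<Otimes>\<^sub>M borel"] by (simp add: case_prod_unfold)
  have [measurable]: "(\<lambda>y. \<integral>s\<in>{0<..t}. exp (c * s) * F s y \<partial>lborel) \<in> borel_measurable borel"
    unfolding set_lebesgue_integral_def by measurable
  have "heat r (\<lambda>y. \<integral>s\<in>{0<..t}. exp (c * s) * F s y \<partial>lborel) x = expectation (\<lambda>\<omega>. \<integral>s. ?G s \<omega> \<partial>lborel)"
    by (subst heat_eq_expectation) (auto simp: set_lebesgue_integral_def mult.assoc)
  also have "\<dots> = (\<integral>s. expectation (\<lambda>\<omega>. ?G s \<omega>) \<partial>lborel)"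
    by (rule P.Fubini_integral[OF Gi])
  also have "\<dots> = (\<integral>s\<in>{0<..t}. exp (c * s) * heat r (F s) x \<partial>lborel)"
    unfolding set_lebesgue_integral_def
    by (rule Bochner_Integration.integral_cong) (auto simp: heat_eq_expectation)
  finally show ?thesis .
qed

text \<open>Gronwall by iteration: feeding a bound for the positive part back into the hypothesis
  \<open>n\<close> times gives \<open>A * (C * r) ^ n / fact n\<close>, which tends to 0. The heat
  flow does no harm because it preserves constants.\<close>

lemma comparison:
  fixes D :: "real \<Rightarrow> 'a \<Rightarrow> real"
  assumes D: "bounded_measurable (borel \<Otimes>\<^sub>M borel) (\<lambda>(s, y). D s y)"
    and C: "0 \<le> C"
    and le: "\<And>r x. 0 \<le> r \<Longrightarrow> r \<le> R \<Longrightarrow>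
      D r x \<le> C * (\<integral>s\<in>{0<..r}. heat s (\<lambda>y. max 0 (D (r - s) y)) x \<partial>lborel)"
    and r: "0 \<le> r" "r \<le> R"
  shows "D r x \<le> 0"
proof -
  obtain A where A: "0 \<le> A" "\<And>s y. \<bar>D s y\<bar> \<le> A"
    using bounded_measurableE[OF D] by (metis case_prod_conv)
  have Dp: "bounded_measurable (borel \<Otimes>\<^sub>M borel) (\<lambda>(s, y). max 0 (D s y))"
    using bounded_measurable_max_0[OF D] by (simp add: case_prod_unfold)
  have iter: "max 0 (D r x) \<le> A * (C * r) ^ n / fact n" if "0 \<le> r" "r \<le> R" for n r x
    using that
  proof (induction n arbitrary: r x)
    case 0
    then show ?case using A(1) A(2)[of r x] by simp
  next
    case (Suc n)
    have "(\<integral>s\<in>{0<..r}. heat s (\<lambda>y. max 0 (D (r - s) y)) x \<partial>lborel) \<le> (\<integral>s\<in>{0<..r}. A * (C * (r - s)) ^ n / fact n \<partial>lborel)"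
    proof (rule set_integral_mono_Ioc)
      show "set_integrable lborel {0<..r} (\<lambda>s. heat s (\<lambda>y. max 0 (D (r - s) y)) x)"
        by (rule bounded_measurable_set_integrable, rule bounded_measurable_heat_slice[OF Dp]) auto
      show "set_integrable lborel {0<..r} (\<lambda>s. A * (C * (r - s)) ^ n / fact n)"
        by (rule set_integrable_subset[OF borel_integrable_atLeastAtMost'[of 0 r]]) (auto intro!: continuous_intros)
      fix s assume s: "0 < s" "s \<le> r"
      show "heat s (\<lambda>y. max 0 (D (r - s) y)) x \<le> A * (C * (r - s)) ^ n / fact n"
        by (rule heat_le_const[OF bounded_measurable_slice[OF Dp]]) (use s Suc in auto)
    qed
    also have "\<dots> = A * C ^ n * r ^ Suc n / fact (Suc n)"
      by (rule set_integral_power) fact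
    finally have "D r x \<le> C * (A * C ^ n * r ^ Suc n / fact (Suc n))"
      using le[OF Suc.prems, of x] C by (meson mult_left_mono order_trans)
    also have "\<dots> = A * (C * r) ^ Suc n / fact (Suc n)" by (simp add: power_mult_distrib)
    finally show ?case using A C Suc.prems by simp
  qed
  have "(\<lambda>n. A * ((C * r) ^ n / fact n)) \<longlonglongrightarrow> A * 0"
    using summable_LIMSEQ_zero[OF summable_exp[of "C * r"]]
    by (intro tendsto_mult_left) (simp add: divide_inverse mult.commute)
  then have "max 0 (D r x) \<le> A * 0"
    by (rule LIMSEQ_le_const) (use iter[OF r] in auto)
  then show ?thesis by simp
qed

end

text \<open>Duhamel's formula with killing rate \<beta> and source
  \<open>\<beta> * w\<^sup>2\<close>, which is precisely the form of the first-branching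
  decomposition: survive unbranched until \<open>t\<close>, or branch at \<open>s\<close> into two
  independent copies.\<close>

locale mild_solution = brownian_motion M W
  for M :: "'w measure" and W :: "real \<Rightarrow> 'w \<Rightarrow> 'a::euclidean_space" +
  fixes \<beta> :: real and w :: "real \<Rightarrow> 'a \<Rightarrow> real"
  assumes \<beta>_pos: "0 < \<beta>"
    and w_meas: "(\<lambda>(s, y). w s y) \<in> borel_measurable (borel \<Otimes>\<^sub>M borel)"
    and w_nonneg: "0 \<le> w s y" and w_le_1: "w s y \<le> 1"
    and mild: "0 \<le> t \<Longrightarrow> w t x = exp (- \<beta> * t) * heat t (w 0) x +
      (\<integral>s\<in>{0<..t}. exp (- \<beta> * s) * heat s (\<lambda>y. \<beta> * (w (t - s) y)\<^sup>2) x \<partial>lborel)"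
begin

lemma bounded_measurable_w: "bounded_measurable (borel \<Otimes>\<^sub>M borel) (\<lambda>(s, y). w s y)"
  by (rule bounded_measurableI[of _ _ 1]) (use w_meas w_nonneg w_le_1 in auto)

lemma bounded_measurable_w_slice: "bounded_measurable borel (w s)"
  by (rule bounded_measurable_slice[OF bounded_measurable_w])

lemma bounded_measurable_nonlinearity:
  "bounded_measurable (borel \<Otimes>\<^sub>M borel) (\<lambda>(s, y). a * (w s y)\<^sup>2 + b * w s y + c)"
proof -
  have "bounded_measurable (borel \<Otimes>\<^sub>M borel) (\<lambda>p. a * (case p of (s, y) \<Rightarrow> w s y)\<^sup>2 + b * (case p of (s, y) \<Rightarrow> w s y) + c)"
    by (intro bounded_measurable_intros bounded_measurable_w)
  then show ?thesis by (simp add: case_prod_unfold)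
qed

text \<open>The flow property: insert the equation for \<open>w (t - r)\<close> into
  \<open>heat r\<close>, merge the two heat flows by the semigroup law and Fubini, and shift the
  time variable by \<open>r\<close>; what appears is the part of the original integral over
  \<open>{r<..t}\<close>.\<close>

lemma restart:
  assumes r: "0 \<le> r" "r \<le> t"
  shows "w t x = exp (- \<beta> * r) * heat r (w (t - r)) x +
      (\<integral>s\<in>{0<..r}. exp (- \<beta> * s) * heat s (\<lambda>y. \<beta> * (w (t - s) y)\<^sup>2) x \<partial>lborel)"
proof -
  define F where "F s y = heat s (\<lambda>y. \<beta> * (w (t - r - s) y)\<^sup>2) y" for s y
  define \<phi> where "\<phi> s = exp (- \<beta> * s) * heat s (\<lambda>y. \<beta> * (w (t - s) y)\<^sup>2) x" for s
  have sq: "bounded_measurable (borel \<Otimes>\<^sub>M borel) (\<lambda>(s, y). \<beta> * (w s y)\<^sup>2)"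
    using bounded_measurable_nonlinearity[of \<beta> 0 0] by simp
  have F: "bounded_measurable (borel \<Otimes>\<^sub>M borel) (\<lambda>(s, y). F s y)"
    unfolding F_def by (rule bounded_measurable_heat_pair[OF sq]) auto
  have \<phi>: "set_integrable lborel {0<..a} \<phi>" for a
    unfolding \<phi>_def[abs_def] by (rule set_integrable_exp_mult, rule bounded_measurable_heat_slice[OF sq]) auto
  have h0: "bounded_measurable borel (\<lambda>y. heat (t - r) (w 0) y)"
    by (rule bounded_measurable_heat)
      (auto simp: case_prod_unfold intro: bounded_measurable_compose[OF bounded_measurable_w_slice])
  have w': "w (t - r) = (\<lambda>y. exp (- \<beta> * (t - r)) * heat (t - r) (w 0) y + (\<integral>s\<in>{0<..t - r}. exp (- \<beta> * s) * F s y \<partial>lborel))"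
    using r by (auto simp: fun_eq_iff F_def mild[of "t - r"])
  \<comment> \<open>Boundedness and measurability of the integral in \<open>y\<close> come from
    solving the equation for it.\<close>
  have bI: "bounded_measurable borel (\<lambda>y. \<integral>s\<in>{0<..t - r}. exp (- \<beta> * s) * F s y \<partial>lborel)"
  proof -
    have "(\<lambda>y. \<integral>s\<in>{0<..t - r}. exp (- \<beta> * s) * F s y \<partial>lborel) = (\<lambda>y. w (t - r) y - exp (- \<beta> * (t - r)) * heat (t - r) (w 0) y)"
      by (simp add: w')
    then show ?thesis
      using h0 bounded_measurable_w_slice by (auto intro!: bounded_measurable_intros)
  qed
  have "heat r (w (t - r)) x = exp (- \<beta> * (t - r)) * heat r (\<lambda>y. heat (t - r) (w 0) y) x +
      heat r (\<lambda>y. \<integral>s\<in>{0<..t - r}. exp (- \<beta> * s) * F s y \<partial>lborel) x"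
    by (subst w', subst heat_add[OF _ bI], intro bounded_measurable_intros h0, subst heat_cmult[OF h0]) simp
  also have "heat r (\<lambda>y. heat (t - r) (w 0) y) x = heat t (w 0) x"
    using heat_semigroup[OF bounded_measurable_w_slice[of 0], of r "t - r" x] r by simp
  also have "heat r (\<lambda>y. \<integral>s\<in>{0<..t - r}. exp (- \<beta> * s) * F s y \<partial>lborel) x = (\<integral>s\<in>{0<..t - r}. exp (- \<beta> * s) * heat r (F s) x \<partial>lborel)"
    by (rule heat_set_integral[OF F])
  also have "\<dots> = exp (\<beta> * r) * (\<integral>s\<in>{0<..t - r}. \<phi> (s + r) \<partial>lborel)"
  proof -
    have "exp (- \<beta> * s) * heat r (F s) x = exp (\<beta> * r) * \<phi> (s + r)" if "s \<in> {0<..t - r}" for s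
    proof -
      have "heat r (F s) x = heat (r + s) (\<lambda>y. \<beta> * (w (t - r - s) y)\<^sup>2) x"
        using that r heat_semigroup[OF bounded_measurable_slice[OF sq], of r s "t - r - s" x]
        by (simp add: F_def[abs_def])
      then show ?thesis by (simp add: \<phi>_def algebra_simps exp_add[symmetric] exp_diff exp_minus divide_inverse)
    qed
    then show ?thesis
      unfolding set_integral_mult_right[symmetric] by (intro set_lebesgue_integral_cong) auto
  qed
  also have "(\<integral>s\<in>{0<..t - r}. \<phi> (s + r) \<partial>lborel) = (\<integral>s\<in>{r<..t}. \<phi> s \<partial>lborel)"
  proof -
    have "(\<integral>s\<in>{r<..t}. \<phi> s \<partial>lborel) = (\<integral>s. indicator {r<..t} (r + 1 * s) *\<^sub>R \<phi> (r + 1 * s) \<partial>lborel)"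
      unfolding set_lebesgue_integral_def by (subst lborel_integral_real_affine[of 1 _ r]) auto
    also have "\<dots> = (\<integral>s\<in>{0<..t - r}. \<phi> (s + r) \<partial>lborel)"
      unfolding set_lebesgue_integral_def
      by (rule Bochner_Integration.integral_cong) (auto simp: indicator_def add.commute)
    finally show ?thesis by simp
  qed
  finally have h: "exp (- \<beta> * r) * heat r (w (t - r)) x = exp (- \<beta> * t) * heat t (w 0) x + (\<integral>s\<in>{r<..t}. \<phi> s \<partial>lborel)"
    by (simp add: algebra_simps exp_add[symmetric] exp_diff exp_minus divide_inverse)
      (simp add: field_simps exp_add[symmetric])
  have "{0<..t} = {0<..r} \<union> {r<..t}" using r by auto
  then have "(\<integral>s\<in>{0<..t}. \<phi> s \<partial>lborel) = (\<integral>s\<in>{0<..r}. \<phi> s \<partial>lborel) + (\<integral>s\<in>{r<..t}. \<phi> s \<partial>lborel)"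
    using set_integral_Un[of "{0<..r}" "{r<..t}" lborel \<phi>] \<phi> set_integrable_subset[OF \<phi>[of t], of "{r<..t}"] r
    by auto
  then show ?thesis
    using mild[of t x] r h by (simp add: \<phi>_def)
qed

text \<open>Any real \<open>c\<close> is allowed, negative ones included. Choosing it so that the
  new nonlinearity has a sign or a simple bound is the source of all the estimates that
  follow.\<close>

lemma restart_rate:
  assumes r: "0 \<le> r" "r \<le> t"
  shows "w t x = exp (- c * r) * heat r (w (t - r)) x +
      (\<integral>s\<in>{0<..r}. exp (- c * s) * heat s (\<lambda>y. \<beta> * (w (t - s) y)\<^sup>2 + (c - \<beta>) * w (t - s) y) x \<partial>lborel)"
proof -
  have sq: "bounded_measurable (borel \<Otimes>\<^sub>M borel) (\<lambda>(s, y). \<beta> * (w s y)\<^sup>2)"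
    using bounded_measurable_nonlinearity[of \<beta> 0 0] by simp
  have "w t x = exp (- c * r) * heat r (w (t - r)) x +
      (\<integral>s\<in>{0<..r}. exp (- c * s) * (heat s (\<lambda>y. \<beta> * (w (t - s) y)\<^sup>2) x + (c - \<beta>) * heat s (w (t - s)) x) \<partial>lborel)"
    by (rule rate_change[OF bounded_measurable_heat_slice[OF sq]]) (use r restart[of _ t x] in auto)
  also have "(\<lambda>s. heat s (\<lambda>y. \<beta> * (w (t - s) y)\<^sup>2) x + (c - \<beta>) * heat s (w (t - s)) x) =
      (\<lambda>s. heat s (\<lambda>y. \<beta> * (w (t - s) y)\<^sup>2 + (c - \<beta>) * w (t - s) y) x)"
    by (subst heat_add, rule bounded_measurable_slice[OF sq])
      (auto simp: heat_cmult bounded_measurable_w_slice intro!: bounded_measurable_intros)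
  finally show ?thesis .
qed

end

lemma set_integral_exp_decay:
  fixes c K r :: real
  assumes "0 \<le> r"
  shows "(\<integral>s\<in>{0<..r}. exp (- c * s) * (c * K) \<partial>lborel) = K * (1 - exp (- c * r))"
proof -
  have "(\<integral>s\<in>{0<..r}. exp (- c * s) * (c * K) \<partial>lborel) = (\<integral>s\<in>{0<..r}. - K * (- c * exp (- c * s)) \<partial>lborel)"
    by (simp add: mult_ac)
  also have "\<dots> = - K * (\<integral>s\<in>{0<..r}. - c * exp (- c * s) \<partial>lborel)"
    by (rule set_integral_mult_right)
  also have "(\<integral>s\<in>{0<..r}. - c * exp (- c * s) \<partial>lborel) = exp (- c * r) - 1"
    by (rule set_integral_exp[OF assms])
  finally show ?thesis by (simp add: algebra_simps)
qed

section \<open>Estimates from a suitable killing rate\<close>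

context mild_solution
begin

lemma bounded_measurable_nonlinearity_slice:
  "bounded_measurable borel (\<lambda>y. a * (w s y)\<^sup>2 + b * w s y + c)"
  by (rule bounded_measurable_slice[OF bounded_measurable_nonlinearity])

lemma bounded_measurable_heat_nonlinearity:
  "bounded_measurable borel (\<lambda>s. heat s (\<lambda>y. a * (w (t - s) y)\<^sup>2 + b * w (t - s) y + c) x)"
  by (rule bounded_measurable_heat_slice[OF bounded_measurable_nonlinearity]) auto

lemma restart_le:
  assumes r: "0 \<le> r" "r \<le> t"
    and h: "bounded_measurable (borel \<Otimes>\<^sub>M borel) (\<lambda>(s, y). h s y)"
    and le: "\<And>s y. 0 < s \<Longrightarrow> s \<le> r \<Longrightarrow> \<beta> * (w (t - s) y)\<^sup>2 + (c - \<beta>) * w (t - s) y \<le> h s y"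
  shows "w t x \<le> exp (- c * r) * heat r (w (t - r)) x + (\<integral>s\<in>{0<..r}. exp (- c * s) * heat s (h s) x \<partial>lborel)"
proof -
  let ?f = "\<lambda>s y. \<beta> * (w (t - s) y)\<^sup>2 + (c - \<beta>) * w (t - s) y"
  have f: "bounded_measurable borel (\<lambda>s. heat s (?f s) x)" "bounded_measurable borel (?f s)" for s
    using bounded_measurable_heat_nonlinearity[of \<beta> t "c - \<beta>" 0 x]
      bounded_measurable_nonlinearity_slice[of \<beta> "t - s" "c - \<beta>" 0] by simp_all
  have "(\<integral>s\<in>{0<..r}. exp (- c * s) * heat s (?f s) x \<partial>lborel) \<le> (\<integral>s\<in>{0<..r}. exp (- c * s) * heat s (h s) x \<partial>lborel)"
    using le
    by (intro set_integral_mono_Ioc set_integrable_exp_mult f mult_left_mono heat_mono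
        bounded_measurable_slice[OF h] bounded_measurable_heat_slice[OF h]) auto
  then show ?thesis using restart_rate[OF r, of x c] by linarith
qed

text \<open>The lower bound for the nonlinearity is written as \<open>c * K\<close> because the
  integral of \<open>exp (- c * s) * (c * K)\<close> is \<open>K * (1 - exp (- c * r))\<close> for
  every \<open>c\<close>, with no division.\<close>

lemma restart_ge:
  assumes r: "0 \<le> r" "r \<le> t"
    and ge: "\<And>s y. 0 < s \<Longrightarrow> s \<le> r \<Longrightarrow> c * K \<le> \<beta> * (w (t - s) y)\<^sup>2 + (c - \<beta>) * w (t - s) y"
  shows "exp (- c * r) * heat r (w (t - r)) x + K * (1 - exp (- c * r)) \<le> w t x"
proof -
  let ?f = "\<lambda>s y. \<beta> * (w (t - s) y)\<^sup>2 + (c - \<beta>) * w (t - s) y"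
  have f: "bounded_measurable borel (\<lambda>s. heat s (?f s) x)" "bounded_measurable borel (?f s)" for s
    using bounded_measurable_heat_nonlinearity[of \<beta> t "c - \<beta>" 0 x]
      bounded_measurable_nonlinearity_slice[of \<beta> "t - s" "c - \<beta>" 0] by simp_all
  have "(\<integral>s\<in>{0<..r}. exp (- c * s) * heat s (\<lambda>y. c * K) x \<partial>lborel) \<le> (\<integral>s\<in>{0<..r}. exp (- c * s) * heat s (?f s) x \<partial>lborel)"
    using ge
    by (intro set_integral_mono_Ioc set_integrable_exp_mult f mult_left_mono heat_mono) auto
  moreover have "(\<integral>s\<in>{0<..r}. exp (- c * s) * heat s (\<lambda>y. c * K) x \<partial>lborel) = K * (1 - exp (- c * r))"
    unfolding heat_const by (rule set_integral_exp_decay[OF r(1)])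
  ultimately show ?thesis using restart_rate[OF r, of x c] by linarith
qed

text \<open>The first-moment bound: survival is at most the mean number of particles times the
  average survival of one. With killing rate \<open>- \<beta>\<close> it amounts to
  \<open>(1 - w)\<^sup>2 \<ge> 0\<close>.\<close>

lemma survival_le:
  assumes r: "0 \<le> r" "r \<le> t"
  shows "1 - w t x \<le> exp (\<beta> * r) * heat r (\<lambda>y. 1 - w (t - r) y) x"
proof -
  have "exp (\<beta> * r) * heat r (w (t - r)) x + (1 - exp (\<beta> * r)) \<le> w t x"
  proof (rule restart_ge[where c = "- \<beta>" and K = 1, simplified])
    fix s y
    have "0 \<le> \<beta> * (1 - w (t - s) y)\<^sup>2" using \<beta>_pos by simp
    then show "- \<beta> \<le> \<beta> * (w (t - s) y)\<^sup>2 - 2 * \<beta> * w (t - s) y"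
      by (simp add: power2_eq_square algebra_simps)
  qed (use r in auto)
  then show ?thesis
    by (simp add: heat_diff bounded_measurable_w_slice right_diff_distrib)
qed

lemma ge_no_branching:
  assumes r: "0 \<le> r" "r \<le> t"
  shows "exp (- \<beta> * r) * heat r (w (t - r)) x \<le> w t x"
  using restart_ge[OF r, of \<beta> 0 x] \<beta>_pos by simp

text \<open>With killing rate \<beta> and \<open>w\<^sup>2 \<le> 1\<close>: only the contribution of
  an unbranched first particle to the survival is kept.\<close>

lemma survival_ge_no_branching:
  assumes r: "0 \<le> r" "r \<le> t"
  shows "exp (- \<beta> * r) * heat r (\<lambda>y. 1 - w (t - r) y) x \<le> 1 - w t x"
proof -
  have "w t x \<le> exp (- \<beta> * r) * heat r (w (t - r)) x + (\<integral>s\<in>{0<..r}. exp (- \<beta> * s) * heat s (\<lambda>y. \<beta> * 1) x \<partial>lborel)"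
    using \<beta>_pos w_nonneg w_le_1 by (intro restart_le r) (auto simp: power_le_one case_prod_unfold)
  also have "(\<integral>s\<in>{0<..r}. exp (- \<beta> * s) * heat s (\<lambda>y. \<beta> * 1) x \<partial>lborel) = 1 * (1 - exp (- \<beta> * r))"
    unfolding heat_const by (rule set_integral_exp_decay[OF r(1)])
  finally show ?thesis
    by (simp add: heat_diff bounded_measurable_w_slice right_diff_distrib)
qed

text \<open>Duhamel's formula with killing rate \<open>\<beta> * (1 - q)\<close>: the nonlinearity \<open>w\<^sup>2 - q * w\<close> is nonpositive off
  the bad set and at most \<open>1\<close> on it.\<close>

lemma decay:
  assumes r: "0 \<le> r" "r \<le> t" and q: "0 \<le> q"
    and Bad: "{(s, y). y \<in> Bad s} \<in> sets (borel \<Otimes>\<^sub>M borel)"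
    and small: "\<And>s y. 0 < s \<Longrightarrow> s \<le> r \<Longrightarrow> y \<notin> Bad s \<Longrightarrow> w (t - s) y \<le> q"
    and bound: "\<And>s. 0 < s \<Longrightarrow> s \<le> r \<Longrightarrow> exp (- \<beta> * (1 - q) * s) * heat s (indicator (Bad s)) x \<le> C"
  shows "w t x \<le> exp (- \<beta> * (1 - q) * r) + \<beta> * C * r"
proof -
  define c where "c = \<beta> * (1 - q)"
  have bad: "bounded_measurable (borel \<Otimes>\<^sub>M borel) (\<lambda>(s, y). indicator (Bad s) y :: real)"
  proof -
    have "(\<lambda>(s, y). indicator (Bad s) y :: real) = indicator {(s, y). y \<in> Bad s}"
      by (auto simp: fun_eq_iff indicator_def)
    then show ?thesis using bounded_measurable_indicator[OF Bad] by simp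
  qed
  have badc: "bounded_measurable (borel \<Otimes>\<^sub>M borel) (\<lambda>(s, y). \<beta> * indicator (Bad s) y)"
    using bounded_measurable_mult[OF bounded_measurable_const bad, of \<beta>] by (simp add: case_prod_unfold)
  have "w t x \<le> exp (- c * r) * heat r (w (t - r)) x +
      (\<integral>s\<in>{0<..r}. exp (- c * s) * heat s (\<lambda>y. \<beta> * indicator (Bad s) y) x \<partial>lborel)"
  proof (rule restart_le[OF r badc])
    fix s y assume s: "0 < s" "s \<le> r"
    have "w (t - s) y * (w (t - s) y - q) \<le> indicator (Bad s) y"
    proof (cases "w (t - s) y \<le> q")
      case True
      then have "w (t - s) y * (w (t - s) y - q) \<le> 0"
        using w_nonneg by (intro mult_nonneg_nonpos) auto
      then show ?thesis by (simp add: indicator_def)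
    next
      case False
      then have "y \<in> Bad s" using small[OF s] by blast
      moreover have "w (t - s) y * (w (t - s) y - q) \<le> 1 * 1"
        using False q w_nonneg[of "t - s" y] w_le_1[of "t - s" y] by (intro mult_mono) linarith+
      ultimately show ?thesis by simp
    qed
    from mult_left_mono[OF this, of \<beta>] \<beta>_pos
    show "\<beta> * (w (t - s) y)\<^sup>2 + (c - \<beta>) * w (t - s) y \<le> \<beta> * indicator (Bad s) y"
      by (simp add: c_def power2_eq_square algebra_simps)
  qed
  also have "\<dots> \<le> exp (- c * r) + \<beta> * C * r"
  proof (rule add_mono)
    show "exp (- c * r) * heat r (w (t - r)) x \<le> exp (- c * r)"
      using heat_le_const[OF bounded_measurable_w_slice w_le_1, of r "t - r" x] by simp
    have "(\<integral>s\<in>{0<..r}. exp (- c * s) * heat s (\<lambda>y. \<beta> * indicator (Bad s) y) x \<partial>lborel) \<le> (\<integral>s\<in>{0<..r}. \<beta> * C \<partial>lborel)"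
    proof (rule set_integral_mono_Ioc)
      show "set_integrable lborel {0<..r} (\<lambda>s. exp (- c * s) * heat s (\<lambda>y. \<beta> * indicator (Bad s) y) x)"
        by (rule set_integrable_exp_mult, rule bounded_measurable_heat_slice[OF badc]) auto
      show "set_integrable lborel {0<..r} (\<lambda>s. \<beta> * C)"
        by (rule bounded_measurable_set_integrable) simp
      fix s assume "0 < s" "s \<le> r"
      from mult_left_mono[OF bound[OF this], of \<beta>] \<beta>_pos
      show "exp (- c * s) * heat s (\<lambda>y. \<beta> * indicator (Bad s) y) x \<le> \<beta> * C"
        by (simp add: heat_cmult bounded_measurable_slice[OF bad] c_def mult_ac)
    qed
    then show "(\<integral>s\<in>{0<..r}. exp (- c * s) * heat s (\<lambda>y. \<beta> * indicator (Bad s) y) x \<partial>lborel) \<le> \<beta> * C * r"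
      using r by (simp add: set_lebesgue_integral_def mult_ac)
  qed
  finally show ?thesis by (simp add: c_def)
qed

text \<open>\<open>V = 1 - w\<close> grows like the linear equation at rate \<beta>, reduced by
  \<open>\<beta> * V\<^sup>2\<close>. The cap on \<open>f\<close> keeps the linear flow
  \<open>z\<close> at rate \<open>\<beta> * (1 - \<delta>)\<close> below \<delta> up to time \<tau>;
  there \<open>\<delta> * z \<ge> z\<^sup>2\<close>, so \<open>z\<close> is a subsolution and
  comparison gives \<open>z \<le> V\<close>.\<close>

lemma growth:
  assumes \<tau>: "0 \<le> \<tau>" "\<tau> \<le> t" and \<delta>: "0 < \<delta>" "\<delta> \<le> 1"
    and f: "f \<in> borel_measurable borel" "\<And>y. 0 \<le> f y" "\<And>y. f y \<le> \<delta> * exp (- \<beta> * \<tau>)"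
    and le: "\<And>y. f y \<le> 1 - w (t - \<tau>) y"
  shows "exp (\<beta> * (1 - \<delta>) * \<tau>) * heat \<tau> f x \<le> 1 - w t x"
proof -
  define g where "g = \<beta> * (1 - \<delta>)"
  \<comment> \<open>Only times in \<open>[0, \<tau>]\<close> matter; the truncation of the exponent
    makes \<open>z\<close> bounded by \<delta> for all real \<open>r\<close>.\<close>
  define z where "z r y = exp (g * max 0 (min r \<tau>)) * heat r f y" for r y
  define V where "V r y = 1 - w (t - \<tau> + r) y" for r y
  have g: "0 \<le> g" "g \<le> \<beta>" using \<beta>_pos \<delta> by (auto simp: g_def algebra_simps)
  have fb: "bounded_measurable borel f"
    by (rule bounded_measurableI[of _ _ "\<delta> * exp (- \<beta> * \<tau>)"]) (use f in \<open>auto simp: abs_le_iff intro: order_trans[of _ 0]\<close>)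
  have fbj: "bounded_measurable (borel \<Otimes>\<^sub>M borel) (\<lambda>(s :: real, y). f y)"
    using bounded_measurable_compose[OF fb, of snd "borel \<Otimes>\<^sub>M borel"] by (simp add: case_prod_unfold)
  have hf: "heat r f y \<le> \<delta> * exp (- \<beta> * \<tau>)" "0 \<le> heat r f y" for r y
    by (rule heat_le_const[OF fb f(3)], rule heat_nonneg[OF f(1,2)])
  have z01: "0 \<le> z r y" "z r y \<le> \<delta>" for r y
  proof -
    have "z r y \<le> exp (\<beta> * \<tau>) * (\<delta> * exp (- \<beta> * \<tau>))"
    proof -
      have "g * max 0 (min r \<tau>) \<le> \<beta> * \<tau>" using g \<tau> \<beta>_pos by (intro mult_mono) auto
      then show ?thesis unfolding z_def using hf by (intro mult_mono) auto
    qed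
    also have "\<dots> = \<delta>" by (simp add: exp_minus field_simps)
    finally show "z r y \<le> \<delta>" .
    show "0 \<le> z r y" using hf by (simp add: z_def)
  qed
  have zb: "bounded_measurable (borel \<Otimes>\<^sub>M borel) (\<lambda>(s, y). z s y)"
  proof (rule bounded_measurableI)
    have "(\<lambda>(s, y). heat s f y) \<in> borel_measurable (borel \<Otimes>\<^sub>M borel)"
      by (rule bounded_measurableD[OF bounded_measurable_heat_pair[OF fbj, where \<rho> = "\<lambda>s. s"]]) auto
    then show "(\<lambda>(s, y). z s y) \<in> borel_measurable (borel \<Otimes>\<^sub>M borel)"
      unfolding z_def case_prod_unfold by measurable
    show "\<bar>case p of (s, y) \<Rightarrow> z s y\<bar> \<le> \<delta>" for p using z01 by (auto simp: case_prod_unfold)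
  qed
  have Vb: "bounded_measurable (borel \<Otimes>\<^sub>M borel) (\<lambda>(s, y). V s y)"
    using bounded_measurable_diff[OF bounded_measurable_const[of _ 1]
        bounded_measurable_compose[OF bounded_measurable_w, of "\<lambda>(s, y). (t - \<tau> + s, y)" "borel \<Otimes>\<^sub>M borel"]]
    by (simp add: V_def case_prod_unfold)
  have V01: "0 \<le> V r y" "V r y \<le> 1" for r y using w_nonneg w_le_1 by (auto simp: V_def)
  have Db: "bounded_measurable (borel \<Otimes>\<^sub>M borel) (\<lambda>(s, y). z s y - V s y)"
    using bounded_measurable_diff[OF zb Vb] by (simp add: case_prod_unfold)
  have "z \<tau> x - V \<tau> x \<le> 0"
  proof (rule comparison[OF Db, where C = "2 * \<beta>" and R = \<tau>])
    fix r x assume r: "0 \<le> r" "r \<le> \<tau>"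
    let ?hz = "\<lambda>s. heat s (\<lambda>y. \<beta> * (2 - \<delta>) * z (r - s) y) x"
    let ?hV = "\<lambda>s. heat s (\<lambda>y. \<beta> * (2 * V (r - s) y - (V (r - s) y)\<^sup>2)) x"
    let ?hD = "\<lambda>s. heat s (\<lambda>y. max 0 (z (r - s) y - V (r - s) y)) x"
    let ?hw = "\<lambda>s. heat s (\<lambda>y. \<beta> * (w (t - \<tau> + r - s) y)\<^sup>2) x"
    have zr: "z r x = exp (- \<beta> * r) * heat r f x + (\<integral>s\<in>{0<..r}. exp (- \<beta> * s) * ?hz s \<partial>lborel)"
    proof -
      \<comment> \<open>The rate change with no source: \<open>z r x\<close> equals
        \<open>exp (g * s)\<close> times \<open>exp (g * (r - s)) * heat r f x\<close> for every
        \<open>s\<close>, and passing from rate \<open>- g\<close> to \<beta> produces the factor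
        \<open>\<beta> + g = \<beta> * (2 - \<delta>)\<close>.\<close>
      have "z r x = exp (- \<beta> * r) * (exp (g * (r - r)) * heat r f x) +
          (\<integral>s\<in>{0<..r}. exp (- \<beta> * s) * (0 + (\<beta> - (- g)) * (exp (g * (r - s)) * heat r f x)) \<partial>lborel)"
        by (rule rate_change[where \<beta> = "- g" and b = "\<lambda>_. 0"])
          (use r \<tau> in \<open>auto simp: z_def min_def max_def exp_add[symmetric] algebra_simps\<close>)
      also have "(\<integral>s\<in>{0<..r}. exp (- \<beta> * s) * (0 + (\<beta> - (- g)) * (exp (g * (r - s)) * heat r f x)) \<partial>lborel) =
          (\<integral>s\<in>{0<..r}. exp (- \<beta> * s) * ?hz s \<partial>lborel)"
      proof (rule set_lebesgue_integral_cong)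
        show "\<forall>s. s \<in> {0<..r} \<longrightarrow> exp (- \<beta> * s) * (0 + (\<beta> - (- g)) * (exp (g * (r - s)) * heat r f x)) =
            exp (- \<beta> * s) * ?hz s"
        proof (intro allI impI)
          fix s assume s: "s \<in> {0<..r}"
          have "?hz s = heat s (\<lambda>y. (\<beta> * (2 - \<delta>) * exp (g * (r - s))) * heat (r - s) f y) x"
            using s r by (simp add: z_def mult.assoc)
          also have "\<dots> = (\<beta> * (2 - \<delta>) * exp (g * (r - s))) * heat s (\<lambda>y. heat (r - s) f y) x"
            by (rule heat_cmult, rule bounded_measurable_heat)
              (auto simp: case_prod_unfold intro: bounded_measurable_compose[OF fb])
          also have "heat s (\<lambda>y. heat (r - s) f y) x = heat r f x"
            using heat_semigroup[OF fb, of s "r - s" x] s by simp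
          finally have eq: "?hz s =
            \<beta> * (2 - \<delta>) * exp (g * (r - s)) * heat r f x" .
          show "exp (- \<beta> * s) * (0 + (\<beta> - (- g)) * (exp (g * (r - s)) * heat r f x)) =
            exp (- \<beta> * s) * ?hz s"
            unfolding eq by (simp add: g_def algebra_simps)
        qed
      qed simp
      finally show ?thesis by simp
    qed
    have Vr: "V r x = exp (- \<beta> * r) * heat r (V 0) x + (\<integral>s\<in>{0<..r}. exp (- \<beta> * s) * ?hV s \<partial>lborel)"
    proof -
      \<comment> \<open>Killing at rate \<beta> makes the source of \<open>V\<close> equal to
        \<open>\<beta> * (1 - w\<^sup>2) = \<beta> * (2 * V - V\<^sup>2)\<close>, which is
        increasing in \<open>V\<close> on \<open>[0, 1]\<close>, as comparison requires.\<close>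
      have H: "?hV s = \<beta> - ?hw s" for s
      proof -
        have "(\<lambda>y. \<beta> * (2 * V (r - s) y - (V (r - s) y)\<^sup>2)) = (\<lambda>y. \<beta> - \<beta> * (w (t - \<tau> + r - s) y)\<^sup>2)"
          by (auto simp: V_def power2_eq_square algebra_simps)
        then show ?thesis
          using bounded_measurable_nonlinearity_slice[of \<beta> _ 0 0] by (simp add: heat_diff)
      qed
      have "(\<integral>s\<in>{0<..r}. exp (- \<beta> * s) * ?hV s \<partial>lborel)
        = (\<integral>s\<in>{0<..r}. (- 1) * (- \<beta> * exp (- \<beta> * s)) - exp (- \<beta> * s) * ?hw s \<partial>lborel)"
        unfolding H by (simp add: right_diff_distrib mult.commute)
      also have "\<dots> = (- 1) * (exp (- \<beta> * r) - 1) - (\<integral>s\<in>{0<..r}. exp (- \<beta> * s) * ?hw s \<partial>lborel)"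
      proof -
        have 1: "set_integrable lborel {0<..r} (\<lambda>s. (- 1) * (- \<beta> * exp (- \<beta> * s)))"
          using set_integrable_exp_mult[OF bounded_measurable_const[of borel \<beta>], of r "- \<beta>"] by (simp add: mult.commute)
        have 2: "set_integrable lborel {0<..r} (\<lambda>s. exp (- \<beta> * s) * ?hw s)"
          using set_integrable_exp_mult[OF bounded_measurable_heat_nonlinearity[of \<beta> "t - \<tau> + r" 0 0 x], of r "- \<beta>"] by simp
        show ?thesis
          using set_integral_exp[OF r(1), of "- \<beta>"]
          by (subst set_integral_diff(2)[OF 1 2]) (simp only: set_integral_mult_right)
      qed
      finally have I: "(\<integral>s\<in>{0<..r}. exp (- \<beta> * s) * ?hV s \<partial>lborel) =
        1 - exp (- \<beta> * r) - (\<integral>s\<in>{0<..r}. exp (- \<beta> * s) * ?hw s \<partial>lborel)" by simp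
      have "exp (- \<beta> * r) * heat r (V 0) x = exp (- \<beta> * r) - exp (- \<beta> * r) * heat r (w (t - \<tau>)) x"
        unfolding V_def[abs_def] by (simp add: heat_diff bounded_measurable_w_slice right_diff_distrib)
      moreover have "V r x = 1 - w (t - \<tau> + r) x" by (simp add: V_def)
      moreover have "w (t - \<tau> + r) x = exp (- \<beta> * r) * heat r (w (t - \<tau>)) x +
          (\<integral>s\<in>{0<..r}. exp (- \<beta> * s) * ?hw s \<partial>lborel)"
        using restart[of r "t - \<tau> + r" x] r \<tau> by simp
      ultimately show ?thesis
        using I by linarith
    qed
    have i1: "bounded_measurable borel (\<lambda>s. ?hz s)"
      using bounded_measurable_mult[OF bounded_measurable_const[of "borel \<Otimes>\<^sub>M borel" "\<beta> * (2 - \<delta>)"] zb]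
      by (intro bounded_measurable_heat_slice[where F = "\<lambda>s y. \<beta> * (2 - \<delta>) * z s y"]) (auto simp: case_prod_unfold)
    have V2: "bounded_measurable (borel \<Otimes>\<^sub>M borel) (\<lambda>(s, y). \<beta> * (2 * V s y - (V s y)\<^sup>2))"
      using bounded_measurable_mult[OF bounded_measurable_const[of "borel \<Otimes>\<^sub>M borel" \<beta>]
        bounded_measurable_diff[OF bounded_measurable_mult[OF bounded_measurable_const[of _ 2] Vb] bounded_measurable_power2[OF Vb]]]
      by (simp add: case_prod_unfold)
    have i2: "bounded_measurable borel (\<lambda>s. ?hV s)"
      by (rule bounded_measurable_heat_slice[OF V2]) auto
    have Dp: "bounded_measurable (borel \<Otimes>\<^sub>M borel) (\<lambda>(s, y). max 0 (z s y - V s y))"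
      using bounded_measurable_max_0[OF Db] by (simp add: case_prod_unfold)
    have i3: "bounded_measurable borel (\<lambda>s. ?hD s)"
      by (rule bounded_measurable_heat_slice[OF Dp]) auto
    have h0: "heat r f x \<le> heat r (V 0) x"
      using le by (intro heat_mono fb bounded_measurable_slice[OF Vb]) (simp add: V_def)
    have "z r x - V r x = exp (- \<beta> * r) * (heat r f x - heat r (V 0) x) +
       (\<integral>s\<in>{0<..r}. exp (- \<beta> * s) * (?hz s - ?hV s) \<partial>lborel)"
    proof -
      have diff: "(\<integral>s\<in>{0<..r}. exp (- \<beta> * s) * (h1 s - h2 s) \<partial>lborel) =
          (\<integral>s\<in>{0<..r}. exp (- \<beta> * s) * h1 s \<partial>lborel) - (\<integral>s\<in>{0<..r}. exp (- \<beta> * s) * h2 s \<partial>lborel)"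
        if "bounded_measurable borel h1" "bounded_measurable borel h2" for h1 h2
        using set_integral_diff(2)[OF set_integrable_exp_mult[OF that(1)] set_integrable_exp_mult[OF that(2)], of r "- \<beta>" "- \<beta>"]
        by (simp add: right_diff_distrib)
      show ?thesis unfolding diff[OF i1 i2] using zr Vr by (simp only: right_diff_distrib)
    qed
    also have "\<dots> \<le> 0 + (\<integral>s\<in>{0<..r}. 2 * \<beta> * ?hD s \<partial>lborel)"
    proof (rule add_mono)
      show "exp (- \<beta> * r) * (heat r f x - heat r (V 0) x) \<le> 0"
        using h0 by (simp add: mult_nonneg_nonpos)
      show "(\<integral>s\<in>{0<..r}. exp (- \<beta> * s) * (?hz s - ?hV s) \<partial>lborel)
        \<le> (\<integral>s\<in>{0<..r}. 2 * \<beta> * ?hD s \<partial>lborel)"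
      proof (rule set_integral_mono_Ioc)
        show "set_integrable lborel {0<..r} (\<lambda>s. exp (- \<beta> * s) * (?hz s - ?hV s))"
          by (rule set_integrable_exp_mult[OF bounded_measurable_diff[OF i1 i2]])
        show "set_integrable lborel {0<..r} (\<lambda>s. 2 * \<beta> * ?hD s)"
          by (rule bounded_measurable_set_integrable[OF bounded_measurable_mult[OF bounded_measurable_const i3]])
        fix s assume s: "0 < s" "s \<le> r"
        have bz: "bounded_measurable borel (\<lambda>y. \<beta> * (2 - \<delta>) * z (r - s) y)"
          by (rule bounded_measurable_mult[OF bounded_measurable_const bounded_measurable_slice[OF zb]])
        have bV: "bounded_measurable borel (\<lambda>y. \<beta> * (2 * V (r - s) y - (V (r - s) y)\<^sup>2))"
          by (rule bounded_measurable_slice[OF V2])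
        have bp: "bounded_measurable borel (\<lambda>y. max 0 (z (r - s) y - V (r - s) y))"
          by (rule bounded_measurable_slice[OF Dp])
        have "?hz s - ?hV s
          = heat s (\<lambda>y. \<beta> * (2 - \<delta>) * z (r - s) y - \<beta> * (2 * V (r - s) y - (V (r - s) y)\<^sup>2)) x"
          by (rule heat_diff[symmetric, OF bz bV])
        also have "\<dots> \<le> heat s (\<lambda>y. 2 * \<beta> * max 0 (z (r - s) y - V (r - s) y)) x"
        proof (rule heat_mono)
          show "bounded_measurable borel (\<lambda>y. \<beta> * (2 - \<delta>) * z (r - s) y - \<beta> * (2 * V (r - s) y - (V (r - s) y)\<^sup>2))"
            by (rule bounded_measurable_diff[OF bz bV])
          show "bounded_measurable borel (\<lambda>y. 2 * \<beta> * max 0 (z (r - s) y - V (r - s) y))"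
            by (rule bounded_measurable_mult[OF bounded_measurable_const bp])
          fix y
          define a v where "a = z (r - s) y" and "v = V (r - s) y"
          have av: "0 \<le> a" "a \<le> \<delta>" "0 \<le> v" "v \<le> 1" using z01 V01 by (auto simp: a_def v_def)
          \<comment> \<open>This is where \<open>a \<le> \<delta>\<close> is used. What remains is a
            difference of values of \<open>2 * v - v\<^sup>2\<close>, a function that is monotone
            and has Lipschitz constant 2 on \<open>[0, 1]\<close>.\<close>
          have "(2 - \<delta>) * a - (2 * v - v\<^sup>2) \<le> 2 * a - a\<^sup>2 - (2 * v - v\<^sup>2)"
            using mult_right_mono[OF av(2) av(1)] by (simp add: power2_eq_square algebra_simps)
          also have "\<dots> = (a - v) * (2 - a - v)" by (simp add: power2_eq_square algebra_simps)
          also have "\<dots> \<le> 2 * max 0 (a - v)"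
          proof (cases "v \<le> a")
            case True
            have "(a - v) * (2 - a - v) \<le> (a - v) * 2" using True av by (intro mult_left_mono) auto
            then show ?thesis using True by simp
          next
            case False
            then have "(a - v) * (2 - a - v) \<le> 0" using av \<delta> by (intro mult_nonpos_nonneg) auto
            then show ?thesis using False by simp
          qed
          finally have "\<beta> * ((2 - \<delta>) * a - (2 * v - v\<^sup>2)) \<le> \<beta> * (2 * max 0 (a - v))"
            using \<beta>_pos by (intro mult_left_mono) auto
          then show "\<beta> * (2 - \<delta>) * z (r - s) y - \<beta> * (2 * V (r - s) y - (V (r - s) y)\<^sup>2) \<le> 2 * \<beta> * max 0 (z (r - s) y - V (r - s) y)"
            unfolding a_def[symmetric] v_def[symmetric]
            by (simp only: right_diff_distrib[of \<beta> "(2 - \<delta>) * a"] mult.assoc mult.left_commute[of \<beta> 2])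
        qed
        also have "\<dots> = 2 * \<beta> * ?hD s"
          by (rule heat_cmult[OF bp])
        finally have le2: "?hz s - ?hV s
            \<le> 2 * \<beta> * ?hD s" (is "?a \<le> ?b") .
        have "0 \<le> ?b" using \<beta>_pos bounded_measurableD[OF bp] by (auto intro!: mult_nonneg_nonneg heat_nonneg)
        have "exp (- \<beta> * s) * ?a \<le> exp (- \<beta> * s) * ?b" using le2 by simp
        also have "\<dots> \<le> 1 * ?b" using \<open>0 \<le> ?b\<close> \<beta>_pos s by (intro mult_right_mono) auto
        finally show "exp (- \<beta> * s) * ?a \<le> ?b" by simp
      qed
    qed
    finally show "z r x - V r x \<le> 2 * \<beta> * (\<integral>s\<in>{0<..r}. ?hD s \<partial>lborel)"
      by (simp add: mult.assoc)
  qed (use \<tau> \<beta>_pos in auto)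
  then show ?thesis using \<tau> by (simp add: z_def V_def g_def)
qed

end

section \<open>The Laplace functional of branching Brownian motion\<close>

context dyadic_bbm
begin

lemma bounded_measurable_bbm_laplace:
  assumes mu: "0 \<le> \<mu>" and B: "B \<in> sets borel"
  shows "bounded_measurable (borel \<Otimes>\<^sub>M borel) (\<lambda>(s, y). bbm_laplace M \<mu> B T W s y)"
  by (rule bounded_measurableI[of _ _ 1, OF measurable_bbm_laplace[OF B]])
    (auto simp: bbm_laplace_nonneg bbm_laplace_le_1 mu B)

lemma first_branching_heat:
  assumes mu: "0 \<le> \<mu>" and B [measurable]: "B \<in> sets borel" and t: "0 \<le> t"
  shows "bbm_laplace M \<mu> B T W t x = exp (- \<beta> * t) * heat t (\<lambda>y. exp_neg \<mu> (indicator B y)) x +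
    (\<integral>s\<in>{0<..t}. exp (- \<beta> * s) * heat s (\<lambda>y. \<beta> * (laplace_child \<mu> B False (t - s) y * laplace_child \<mu> B True (t - s) y)) x \<partial>lborel)"
proof -
  have [measurable]: "(\<lambda>y. laplace_child \<mu> B b s y) \<in> borel_measurable borel" for b s
    using measurable_Pair2[OF dyadic_bbm.measurable_bbm_laplace[OF dyadic_bbm_subtree B, of \<mu> "[b]"], of s] by simp
  have h: "heat s f x = expectation (\<lambda>\<omega>. f (x + W [] s \<omega>))" if "0 \<le> s" "f \<in> borel_measurable borel" for s f
    using motion.heat_eq_expectation[OF that(2), of s x "[]"] that(1) by (simp add: max_def)
  have "exp_neg \<mu> \<circ> indicator B \<in> borel_measurable borel" by measurable
  then have 1: "heat t (\<lambda>y. exp_neg \<mu> (indicator B y)) x = expectation (\<lambda>\<omega>. exp_neg \<mu> (indicator B (x + W [] t \<omega>)))"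
    using t by (intro h) (auto simp: comp_def)
  have 2: "(\<integral>s\<in>{0<..t}. \<beta> * exp (- \<beta> * s) * expectation (\<lambda>\<omega>.
      laplace_child \<mu> B False (t - s) (x + W [] s \<omega>) * laplace_child \<mu> B True (t - s) (x + W [] s \<omega>)) \<partial>lborel) =
    (\<integral>s\<in>{0<..t}. exp (- \<beta> * s) * heat s (\<lambda>y. \<beta> * (laplace_child \<mu> B False (t - s) y * laplace_child \<mu> B True (t - s) y)) x \<partial>lborel)"
    by (rule set_lebesgue_integral_cong) (auto simp: h)
  show ?thesis
    using first_branching[OF mu B t, of x] unfolding 1 2 .
qed

lemma bounded_measurable_children:
  assumes "0 \<le> \<mu>" "B \<in> sets borel"
  shows "bounded_measurable (borel \<Otimes>\<^sub>M borel)
    (\<lambda>(s, y). \<beta> * (laplace_child \<mu> B False s y * laplace_child \<mu> B True s y))"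
proof -
  have "bounded_measurable (borel \<Otimes>\<^sub>M borel) (\<lambda>p. \<beta> * ((case p of (s, y) \<Rightarrow> laplace_child \<mu> B False s y) * (case p of (s, y) \<Rightarrow> laplace_child \<mu> B True s y)))"
    by (intro bounded_measurable_mult bounded_measurable_const dyadic_bbm.bounded_measurable_bbm_laplace[OF dyadic_bbm_subtree assms])
  then show ?thesis by (simp add: case_prod_unfold)
qed

end

text \<open>Both functionals obey the same recursion, with the same term for no branching; the
  difference sits in the products over the children, which are again branching Brownian motions.
  Hence the induction ranges over all pairs of trees and bounds the error by Picard iteration. A
  one-sided bound is enough by symmetry.\<close>

lemma bbm_laplace_close:
  assumes "dyadic_bbm M \<beta> T W" "dyadic_bbm M \<beta> T' W'"
    and "0 \<le> \<mu>" "B \<in> sets borel" "0 \<le> t"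
  shows "bbm_laplace M \<mu> B T W t x - bbm_laplace M \<mu> B T' W' t x \<le> (2 * \<beta> * t) ^ n / fact n"
  using assms(1,2,5)
proof (induction n arbitrary: T W T' W' t x)
  case 0
  then show ?case
    using dyadic_bbm.bbm_laplace_le_1[OF 0(1) assms(3,4), of t x] dyadic_bbm.bbm_laplace_nonneg[OF 0(2), of \<mu> B t x] by simp
next
  case (Suc n)
  interpret X: dyadic_bbm M \<beta> T W by fact
  interpret Y: dyadic_bbm M \<beta> T' W' by fact
  define f where "f s y = \<beta> * (X.laplace_child \<mu> B False s y * X.laplace_child \<mu> B True s y)" for s y
  define g where "g s y = \<beta> * (Y.laplace_child \<mu> B False s y * Y.laplace_child \<mu> B True s y)" for s y
  have fb: "bounded_measurable (borel \<Otimes>\<^sub>M borel) (\<lambda>(s, y). f s y)"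
    and gb: "bounded_measurable (borel \<Otimes>\<^sub>M borel) (\<lambda>(s, y). g s y)"
    unfolding f_def g_def by (rule X.bounded_measurable_children[OF assms(3,4)] Y.bounded_measurable_children[OF assms(3,4)])+
  have hf: "bounded_measurable borel (\<lambda>s. heat s (f (t - s)) x)"
    and hg: "bounded_measurable borel (\<lambda>s. heat s (g (t - s)) x)"
    by (rule X.motion.bounded_measurable_heat_slice[OF fb] X.motion.bounded_measurable_heat_slice[OF gb]; measurable)+
  have close: "f s y - g s y \<le> 2 * \<beta> * ((2 * \<beta> * s) ^ n / fact n)" if "0 \<le> s" for s y
  proof -
    let ?x = "\<lambda>b. X.laplace_child \<mu> B b s y" and ?y = "\<lambda>b. Y.laplace_child \<mu> B b s y"
    let ?e = "(2 * \<beta> * s) ^ n / fact n"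
    have d: "?x b - ?y b \<le> ?e" for b
      by (rule Suc.IH[OF X.dyadic_bbm_subtree Y.dyadic_bbm_subtree that])
    have x: "0 \<le> ?x b" "?x b \<le> 1" for b
      using dyadic_bbm.bbm_laplace_le_1[OF X.dyadic_bbm_subtree assms(3,4)] dyadic_bbm.bbm_laplace_nonneg[OF X.dyadic_bbm_subtree] by auto
    have y: "0 \<le> ?y b" "?y b \<le> 1" for b
      using dyadic_bbm.bbm_laplace_le_1[OF Y.dyadic_bbm_subtree assms(3,4)] dyadic_bbm.bbm_laplace_nonneg[OF Y.dyadic_bbm_subtree] by auto
    have e: "0 \<le> ?e" using that X.rate_pos by simp
    \<comment> \<open>Telescoping a product of two factors in \<open>[0, 1]\<close> doubles the
      error, whence the constant \<open>2 * \<beta>\<close>.\<close>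
    have "?x False * ?x True - ?y False * ?y True = (?x False - ?y False) * ?x True + ?y False * (?x True - ?y True)"
      by (simp add: algebra_simps)
    also have "\<dots> \<le> ?e * 1 + 1 * ?e"
    proof (rule add_mono)
      have "(?x False - ?y False) * ?x True \<le> ?e * ?x True" using d x by (intro mult_right_mono) auto
      also have "\<dots> \<le> ?e * 1" using x e by (intro mult_left_mono) auto
      finally show "(?x False - ?y False) * ?x True \<le> ?e * 1" .
      have "?y False * (?x True - ?y True) \<le> ?y False * ?e" using d y by (intro mult_left_mono) auto
      also have "\<dots> \<le> 1 * ?e" using y e by (intro mult_right_mono) auto
      finally show "?y False * (?x True - ?y True) \<le> 1 * ?e" .
    qed
    finally have "?x False * ?x True - ?y False * ?y True \<le> 2 * ?e" by simp
    then have "\<beta> * (?x False * ?x True - ?y False * ?y True) \<le> \<beta> * (2 * ?e)"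
      using X.rate_pos by (intro mult_left_mono) auto
    then show ?thesis by (simp add: f_def g_def algebra_simps)
  qed
  have "bbm_laplace M \<mu> B T W t x - bbm_laplace M \<mu> B T' W' t x =
      (\<integral>s\<in>{0<..t}. exp (- \<beta> * s) * heat s (f (t - s)) x \<partial>lborel) - (\<integral>s\<in>{0<..t}. exp (- \<beta> * s) * heat s (g (t - s)) x \<partial>lborel)"
    using X.first_branching_heat[OF assms(3,4) Suc.prems(3), of x] Y.first_branching_heat[OF assms(3,4) Suc.prems(3), of x]
    by (simp add: f_def[abs_def] g_def[abs_def])
  also have "\<dots> = (\<integral>s\<in>{0<..t}. exp (- \<beta> * s) * heat s (f (t - s)) x - exp (- \<beta> * s) * heat s (g (t - s)) x \<partial>lborel)"
    by (rule set_integral_diff(2)[OF set_integrable_exp_mult[OF hf] set_integrable_exp_mult[OF hg], symmetric])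
  also have "\<dots> \<le> (\<integral>s\<in>{0<..t}. 2 * \<beta> * (2 * \<beta> * (t - s)) ^ n / fact n \<partial>lborel)"
  proof (rule set_integral_mono_Ioc)
    show "set_integrable lborel {0<..t} (\<lambda>s. exp (- \<beta> * s) * heat s (f (t - s)) x - exp (- \<beta> * s) * heat s (g (t - s)) x)"
      by (rule set_integral_diff(1)[OF set_integrable_exp_mult[OF hf] set_integrable_exp_mult[OF hg]])
    show "set_integrable lborel {0<..t} (\<lambda>s. 2 * \<beta> * (2 * \<beta> * (t - s)) ^ n / fact n)"
      by (rule set_integrable_subset[OF borel_integrable_atLeastAtMost'[of 0 t]]) (auto intro!: continuous_intros)
    fix s assume s: "0 < s" "s \<le> t"
    let ?e = "2 * \<beta> * ((2 * \<beta> * (t - s)) ^ n / fact n)"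
    have fs: "bounded_measurable borel (f (t - s))" and gs: "bounded_measurable borel (g (t - s))"
      by (rule X.motion.bounded_measurable_slice[OF fb] X.motion.bounded_measurable_slice[OF gb])+
    have "heat s (f (t - s)) x - heat s (g (t - s)) x = heat s (\<lambda>y. f (t - s) y - g (t - s) y) x"
      by (rule X.motion.heat_diff[OF fs gs, symmetric])
    also have "\<dots> \<le> ?e"
      using close s by (intro X.motion.heat_le_const bounded_measurable_diff fs gs) auto
    finally have "exp (- \<beta> * s) * (heat s (f (t - s)) x - heat s (g (t - s)) x) \<le> exp (- \<beta> * s) * ?e"
      by (rule mult_left_mono) simp
    also have "\<dots> \<le> 1 * ?e" using s X.rate_pos by (intro mult_right_mono) auto
    finally show "exp (- \<beta> * s) * heat s (f (t - s)) x - exp (- \<beta> * s) * heat s (g (t - s)) x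
        \<le> 2 * \<beta> * (2 * \<beta> * (t - s)) ^ n / fact n"
      by (simp add: algebra_simps)
  qed
  also have "\<dots> = 2 * \<beta> * (2 * \<beta>) ^ n * t ^ Suc n / fact (Suc n)"
    by (rule set_integral_power) fact
  also have "\<dots> = (2 * \<beta> * t) ^ Suc n / fact (Suc n)"
    by (simp add: power_mult_distrib mult_ac del: fact_Suc)
  finally show ?case .
qed

text \<open>The Laplace functional depends only on \<beta>, not on the tree that realises it.
  Applied to root and children, this turns the recursion into an equation for a single
  function.\<close>

lemma bbm_laplace_unique:
  assumes X: "dyadic_bbm M \<beta> T W" and Y: "dyadic_bbm M \<beta> T' W'"
    and *: "0 \<le> \<mu>" "B \<in> sets borel" "0 \<le> t"
  shows "bbm_laplace M \<mu> B T W t x = bbm_laplace M \<mu> B T' W' t x"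
proof -
  have "(\<lambda>n. (2 * \<beta> * t) ^ n / fact n) \<longlonglongrightarrow> 0"
    using summable_LIMSEQ_zero[OF summable_exp[of "2 * \<beta> * t"]] by (simp add: divide_inverse mult.commute)
  then have "bbm_laplace M \<mu> B T W t x - bbm_laplace M \<mu> B T' W' t x \<le> 0"
    "bbm_laplace M \<mu> B T' W' t x - bbm_laplace M \<mu> B T W t x \<le> 0"
    by (rule LIMSEQ_le_const; use bbm_laplace_close[OF X Y *, of x] bbm_laplace_close[OF Y X *, of x] in blast)+
  then show ?thesis by simp
qed

context dyadic_bbm
begin

lemma bbm_laplace_0:
  shows "bbm_laplace M \<mu> B T W 0 y = exp_neg \<mu> (indicator B y)"
proof -
  have "bbm_laplace M \<mu> B T W 0 y = expectation (\<lambda>\<omega>. exp_neg \<mu> (indicator B y))"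
    unfolding bbm_laplace_def
  proof (rule Bochner_Integration.integral_cong)
    fix \<omega> assume "\<omega> \<in> space M"
    then show "exp_neg \<mu> (hits T W B 0 y \<omega>) = exp_neg \<mu> (indicator B y)"
      using lifetime_pos by (subst hits_before_branching) (auto simp: motion.starts_at_zero)
  qed simp
  then show ?thesis by (simp add: prob_space)
qed

lemma mild_solution_bbm_laplace:
  assumes mu: "0 \<le> \<mu>" and B: "B \<in> sets borel"
  shows "mild_solution M (W []) \<beta> (bbm_laplace M \<mu> B T W)"
proof
  show "0 < \<beta>" by (rule rate_pos)
  show "(\<lambda>(s, y). bbm_laplace M \<mu> B T W s y) \<in> borel_measurable (borel \<Otimes>\<^sub>M borel)"
    by (rule measurable_bbm_laplace[OF B])
  show "0 \<le> bbm_laplace M \<mu> B T W s y" "bbm_laplace M \<mu> B T W s y \<le> 1" for s y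
    by (rule bbm_laplace_nonneg, rule bbm_laplace_le_1[OF mu B])
  fix t :: real and x :: 'a assume t: "0 \<le> t"
  have "laplace_child \<mu> B b (t - s) y = bbm_laplace M \<mu> B T W (t - s) y" if "s \<le> t" for b s y
    using that by (intro bbm_laplace_unique[OF dyadic_bbm_subtree dyadic_bbm_axioms mu B]) auto
  then have "(\<integral>s\<in>{0<..t}. exp (- \<beta> * s) * heat s (\<lambda>y. \<beta> * (laplace_child \<mu> B False (t - s) y * laplace_child \<mu> B True (t - s) y)) x \<partial>lborel) =
     (\<integral>s\<in>{0<..t}. exp (- \<beta> * s) * heat s (\<lambda>y. \<beta> * (bbm_laplace M \<mu> B T W (t - s) y)\<^sup>2) x \<partial>lborel)"
    by (intro set_lebesgue_integral_cong) (auto simp: power2_eq_square)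
  then show "bbm_laplace M \<mu> B T W t x = exp (- \<beta> * t) * heat t (bbm_laplace M \<mu> B T W 0) x +
      (\<integral>s\<in>{0<..t}. exp (- \<beta> * s) * heat s (\<lambda>y. \<beta> * (bbm_laplace M \<mu> B T W (t - s) y)\<^sup>2) x \<partial>lborel)"
    using first_branching_heat[OF mu B t, of x] by (simp add: bbm_laplace_0[abs_def])
qed

lemma survival_bbm_laplace_0: "1 - bbm_laplace M \<mu> B T W 0 y = (1 - exp (- \<mu>)) * indicator B y"
  by (simp add: bbm_laplace_0 exp_neg_def indicator_def)

lemma hits_event:
  assumes "B \<in> sets borel"
  shows "{\<omega> \<in> space M. hits T W B t y \<omega> < L} \<in> events"
proof -
  have "(\<lambda>((s, y), \<omega>). hits T W B s y \<omega>) \<in> borel_measurable ((borel \<Otimes>\<^sub>M borel) \<Otimes>\<^sub>M M)"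
    by (rule measurable_hits)
      (use assms motion.continuous_paths lifetime_pos in \<open>auto intro: motion.random_variable measurable_sourcesD[OF lifetime_sources[of _ UNIV]]\<close>)
  from measurable_Pair2[OF this, of "(t, y)"]
  have [measurable]: "(\<lambda>\<omega>. hits T W B t y \<omega>) \<in> borel_measurable M" by (simp add: space_pair_measure)
  show ?thesis by measurable
qed

text \<open>Markov's inequality. With \<open>\<mu> * L = 1\<close> it costs only the factor
  \<open>exp 1\<close>.\<close>

lemma prob_hits_less_le:
  assumes mu: "0 \<le> \<mu>" and B: "B \<in> sets borel"
  shows "prob {\<omega> \<in> space M. hits T W B t y \<omega> < ennreal L} \<le> exp (\<mu> * L) * bbm_laplace M \<mu> B T W t y"
proof -
  let ?E = "{\<omega> \<in> space M. hits T W B t y \<omega> < ennreal L}"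
  have E: "?E \<in> events" by (rule hits_event[OF B])
  have "prob ?E = expectation (indicator ?E)"
    using E by simp
  also have "\<dots> \<le> expectation (\<lambda>\<omega>. exp (\<mu> * L) * exp_neg \<mu> (hits T W B t y \<omega>))"
  proof (rule integral_mono)
    show "integrable M (indicator ?E :: _ \<Rightarrow> real)"
      by (rule integrable_const_bound[where B = 1]) (use E in auto)
    show "integrable M (\<lambda>\<omega>. exp (\<mu> * L) * exp_neg \<mu> (hits T W B t y \<omega>))"
      by (intro integrable_mult_right integrable_const_bound[where B = 1] measurable_exp_neg_hits_event B)
        (auto simp: exp_neg_nonneg exp_neg_le_1 mu)
    fix \<omega>
    show "indicator ?E \<omega> \<le> exp (\<mu> * L) * exp_neg \<mu> (hits T W B t y \<omega>)"
    proof (cases "\<omega> \<in> ?E")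
      case True
      then have lt: "hits T W B t y \<omega> < ennreal L" by simp
      then have fin: "hits T W B t y \<omega> \<noteq> \<top>" by auto
      then have "enn2real (hits T W B t y \<omega>) \<le> L"
        using lt by (metis enn2real_leI less_imp_le not_less_zero ennreal_neg linorder_linear)
      then have "\<mu> * enn2real (hits T W B t y \<omega>) \<le> \<mu> * L" using mu by (rule mult_left_mono)
      then have "1 \<le> exp (\<mu> * L) * exp_neg \<mu> (hits T W B t y \<omega>)"
        using fin by (simp add: exp_neg_def exp_add[symmetric])
      then show ?thesis using True by simp
    qed (simp add: exp_neg_nonneg)
  qed
  also have "\<dots> = exp (\<mu> * L) * bbm_laplace M \<mu> B T W t y" by (simp add: bbm_laplace_def)
  finally show ?thesis .
qed

text \<open>Off the event the integrand is at most \<open>exp (- \<mu> * L)\<close>. The loss is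
  additive, so \<mu> will be taken exponentially larger than \<open>1 / L\<close>, making it doubly
  exponentially small.\<close>

lemma prob_hits_less_ge:
  assumes mu: "0 \<le> \<mu>" and B: "B \<in> sets borel" and L: "0 \<le> L"
  shows "bbm_laplace M \<mu> B T W t y - exp (- \<mu> * L) \<le> prob {\<omega> \<in> space M. hits T W B t y \<omega> < ennreal L}"
proof -
  let ?E = "{\<omega> \<in> space M. hits T W B t y \<omega> < ennreal L}"
  have E: "?E \<in> events" by (rule hits_event[OF B])
  have I: "integrable M (indicator ?E :: _ \<Rightarrow> real)"
    by (rule integrable_const_bound[where B = 1]) (use E in auto)
  have "bbm_laplace M \<mu> B T W t y \<le> expectation (\<lambda>\<omega>. indicator ?E \<omega> + exp (- \<mu> * L))"
    unfolding bbm_laplace_def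
  proof (rule integral_mono)
    show "integrable M (\<lambda>\<omega>. exp_neg \<mu> (hits T W B t y \<omega>))"
      by (intro integrable_const_bound[where B = 1] measurable_exp_neg_hits_event B)
        (auto simp: exp_neg_nonneg exp_neg_le_1 mu)
    show "integrable M (\<lambda>\<omega>. indicator ?E \<omega> + exp (- \<mu> * L))"
      by (intro Bochner_Integration.integrable_add I integrable_const)
    fix \<omega> assume \<omega>: "\<omega> \<in> space M"
    show "exp_neg \<mu> (hits T W B t y \<omega>) \<le> indicator ?E \<omega> + exp (- \<mu> * L)"
    proof (cases "\<omega> \<in> ?E")
      case True
      then show ?thesis using exp_neg_le_1[OF mu, of "hits T W B t y \<omega>"] by (simp add: add_increasing2)
    next
      case False
      then have ge: "ennreal L \<le> hits T W B t y \<omega>" using \<omega> by (simp add: not_less)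
      show ?thesis
      proof (cases "hits T W B t y \<omega> = \<top>")
        case False
        then have "L \<le> enn2real (hits T W B t y \<omega>)"
          using ge L by (metis enn2real_ennreal enn2real_mono top.not_eq_extremum)
        then have "\<mu> * L \<le> \<mu> * enn2real (hits T W B t y \<omega>)" using mu by (rule mult_left_mono)
        then show ?thesis using False by (simp add: exp_neg_def add_increasing)
      qed (simp add: exp_neg_def add_increasing)
    qed
  qed
  also have "\<dots> = prob ?E + exp (- \<mu> * L)"
    using E by (subst Bochner_Integration.integral_add[OF I integrable_const]) (simp_all add: prob_space)
  finally show ?thesis by simp
qed

end

section \<open>Gaussian bounds\<close>

lemma gauss_density_eq:
  fixes z :: "'a::euclidean_space"
  assumes "0 < s"
  shows "gauss_density s z = (1 / sqrt (2 * pi * s)) ^ DIM('a) * exp (- (norm z)\<^sup>2 / (2 * s))"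
proof -
  have "gauss_density s z = (\<Prod>b\<in>Basis. 1 / sqrt (2 * pi * s) * exp (- (z \<bullet> b)\<^sup>2 / (2 * s)))"
    using assms by (simp add: gauss_density_def normal_density_def)
  also have "\<dots> = (1 / sqrt (2 * pi * s)) ^ DIM('a) * exp (\<Sum>b\<in>Basis. - (z \<bullet> b)\<^sup>2 / (2 * s))"
    by (simp only: prod.distrib prod_constant exp_sum[OF finite_Basis])
  also have "(\<Sum>b\<in>Basis. - (z \<bullet> b)\<^sup>2 / (2 * s)) = - (norm z)\<^sup>2 / (2 * s)"
    by (simp add: norm_eq_sqrt_inner euclidean_inner[of z z] power2_eq_square sum_nonneg
        sum_negf flip: sum_divide_distrib)
  finally show ?thesis .
qed

lemma gauss_density_nonneg: "0 \<le> gauss_density s z"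
  by (auto simp: gauss_density_def intro!: prod_nonneg)

context brownian_motion
begin

lemma gauss_density_integral:
  assumes "0 < s"
  shows "integrable lborel (gauss_density s :: 'a \<Rightarrow> real)" "(\<integral>z. gauss_density s (z :: 'a) \<partial>lborel) = 1"
proof -
  show 1: "(\<integral>z. gauss_density s (z :: 'a) \<partial>lborel) = 1"
    using distributed_integral[OF distributed_motion[OF assms], of "\<lambda>_. 1"]
    by (auto simp: prob_space gauss_density_nonneg)
  show "integrable lborel (gauss_density s :: 'a \<Rightarrow> real)"
    using 1 by (metis not_integrable_integral_eq zero_neq_one)
qed

lemma heat_indicator_eq:
  assumes "0 < s"
  shows "heat s (indicator A) (x :: 'a) = (\<integral>z. gauss_density s z * indicator A (x + z) \<partial>lborel)"
  using assms by (simp add: heat_def)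

lemma integrable_gauss_indicator:
  assumes "0 < s" "A \<in> sets borel"
  shows "integrable lborel (\<lambda>z. gauss_density s z * indicator A (x + z :: 'a))"
proof (rule Bochner_Integration.integrable_bound[OF gauss_density_integral(1)[OF assms(1)]])
  have [measurable]: "(gauss_density s :: 'a \<Rightarrow> real) \<in> borel_measurable borel"
    using gauss_density_integral(1)[OF assms(1)] by auto
  have [measurable]: "A \<in> sets borel" by fact
  show "(\<lambda>z. gauss_density s z * indicator A (x + z)) \<in> borel_measurable lborel" by measurable
qed (auto simp: indicator_def gauss_density_nonneg)

lemma integrable_ball_indicator: "integrable lborel (\<lambda>z. c * indicator (ball y R) (x + z :: 'a) :: real)"
  and integral_ball_indicator: "0 \<le> R \<Longrightarrow>
    (\<integral>z. c * indicator (ball y R) (x + z :: 'a) \<partial>lborel) = c * (unit_ball_vol DIM('a) * R ^ DIM('a))"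
proof -
  have eq: "(\<lambda>z. c * indicator (ball y R) (x + z) :: real) = (\<lambda>z. c * indicator (ball (y - x) R) z)"
    by (auto simp: fun_eq_iff indicator_def dist_norm algebra_simps)
  have fin: "emeasure lborel (ball (y - x) R) < \<infinity>"
    using emeasure_lborel_ball_finite by blast
  show "integrable lborel (\<lambda>z. c * indicator (ball y R) (x + z) :: real)"
    unfolding eq using fin by (intro integrable_mult_right integrable_real_indicator) auto
  show "(\<integral>z. c * indicator (ball y R) (x + z) \<partial>lborel) = c * (unit_ball_vol DIM('a) * R ^ DIM('a))" if "0 \<le> R"
    unfolding eq using content_ball[OF that, of "y - x"] by simp
qed

text \<open>The volume of the ball times a lower bound for the density on it, taken at the largest
  possible displacement \<open>dist x y + R\<close>.\<close>

lemma heat_ball_ge: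
  fixes x y :: 'a
  assumes s: "0 < s" and R: "0 \<le> R"
  shows "unit_ball_vol DIM('a) * R ^ DIM('a) * (1 / sqrt (2 * pi * s)) ^ DIM('a) * exp (- (dist x y + R)\<^sup>2 / (2 * s))
    \<le> heat s (indicator (ball y R)) x"
proof -
  define c where "c = (1 / sqrt (2 * pi * s)) ^ DIM('a) * exp (- (dist x y + R)\<^sup>2 / (2 * s))"
  have "(\<integral>z. c * indicator (ball y R) (x + z) \<partial>lborel) \<le> (\<integral>z. gauss_density s z * indicator (ball y R) (x + z) \<partial>lborel)"
  proof (rule integral_mono[OF integrable_ball_indicator integrable_gauss_indicator[OF s]])
    fix z
    show "c * indicator (ball y R) (x + z) \<le> gauss_density s z * indicator (ball y R) (x + z)"
    proof (cases "x + z \<in> ball y R")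
      case True
      have "norm z = norm ((x + z - y) + (y - x))" by simp
      also have "\<dots> \<le> norm (x + z - y) + norm (y - x)" by (rule norm_triangle_ineq)
      also have "\<dots> \<le> dist x y + R" using True by (simp add: dist_norm norm_minus_commute)
      finally have "(norm z)\<^sup>2 \<le> (dist x y + R)\<^sup>2" by (intro power_mono) auto
      then have "exp (- (dist x y + R)\<^sup>2 / (2 * s)) \<le> exp (- (norm z)\<^sup>2 / (2 * s))"
        using s by (simp add: divide_right_mono)
      then have "c \<le> gauss_density s z"
        unfolding c_def gauss_density_eq[OF s] using s by (intro mult_left_mono) auto
      then show ?thesis by (simp add: mult_right_mono)
    qed simp
  qed auto
  then show ?thesis
    unfolding heat_indicator_eq[OF s] integral_ball_indicator[OF R] by (simp only: c_def mult_ac)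
qed

lemma heat_ball_le:
  fixes x y :: 'a
  assumes s: "0 < s" and R: "0 \<le> R" "R \<le> dist x y"
  shows "heat s (indicator (ball y R)) x \<le>
    unit_ball_vol DIM('a) * R ^ DIM('a) * (1 / sqrt (2 * pi * s)) ^ DIM('a) * exp (- (dist x y - R)\<^sup>2 / (2 * s))"
proof -
  define c where "c = (1 / sqrt (2 * pi * s)) ^ DIM('a) * exp (- (dist x y - R)\<^sup>2 / (2 * s))"
  have "(\<integral>z. gauss_density s z * indicator (ball y R) (x + z) \<partial>lborel) \<le> (\<integral>z. c * indicator (ball y R) (x + z) \<partial>lborel)"
  proof (rule integral_mono[OF integrable_gauss_indicator[OF s] integrable_ball_indicator])
    fix z
    show "gauss_density s z * indicator (ball y R) (x + z) \<le> c * indicator (ball y R) (x + z)"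
    proof (cases "x + z \<in> ball y R")
      case True
      have "dist x y = norm ((x + z - y) - z)" by (simp add: dist_norm)
      also have "\<dots> \<le> norm (x + z - y) + norm z" by (rule norm_triangle_ineq4)
      also have "\<dots> \<le> R + norm z" using True by (simp add: dist_norm norm_minus_commute)
      finally have "(dist x y - R)\<^sup>2 \<le> (norm z)\<^sup>2" using R by (intro power_mono) auto
      then have "exp (- (norm z)\<^sup>2 / (2 * s)) \<le> exp (- (dist x y - R)\<^sup>2 / (2 * s))"
        using s by (simp add: divide_right_mono)
      then have "gauss_density s z \<le> c"
        unfolding c_def gauss_density_eq[OF s] using s by (intro mult_left_mono) auto
      then show ?thesis by (simp add: mult_right_mono)
    qed simp
  qed auto
  then show ?thesis
    unfolding heat_indicator_eq[OF s] integral_ball_indicator[OF R(1)] by (simp only: c_def mult_ac)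
qed

text \<open>On the set considered, the density with variance \<open>s\<close> is at most the stated constant times the
  density with variance \<open>s / \<epsilon>\<close>.\<close>

lemma heat_far_le:
  fixes x :: 'a
  assumes s: "0 < s" and \<epsilon>: "0 < \<epsilon>" "\<epsilon> \<le> 1" and R: "0 \<le> R"
    and A: "A \<in> sets borel" "\<And>y. y \<in> A \<Longrightarrow> R \<le> dist x y"
  shows "heat s (indicator A) x \<le> (1 / sqrt \<epsilon>) ^ DIM('a) * exp (- (1 - \<epsilon>) * R\<^sup>2 / (2 * s))"
proof -
  define c where "c = (1 / sqrt \<epsilon>) ^ DIM('a) * exp (- (1 - \<epsilon>) * R\<^sup>2 / (2 * s))"
  have s\<epsilon>: "0 < s / \<epsilon>" using s \<epsilon> by simp
  have "(\<integral>z. gauss_density s z * indicator A (x + z) \<partial>lborel) \<le> (\<integral>z. c * gauss_density (s / \<epsilon>) (z :: 'a) \<partial>lborel)"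
  proof (rule integral_mono[OF integrable_gauss_indicator[OF s A(1)] integrable_mult_right[OF gauss_density_integral(1)[OF s\<epsilon>]]])
    fix z
    show "gauss_density s z * indicator A (x + z) \<le> c * gauss_density (s / \<epsilon>) z"
    proof (cases "x + z \<in> A")
      case True
      then have "R\<^sup>2 \<le> (norm z)\<^sup>2" using A(2)[of "x + z"] R by (intro power_mono) (auto simp: dist_norm)
      then have "(1 - \<epsilon>) * R\<^sup>2 \<le> (1 - \<epsilon>) * (norm z)\<^sup>2" using \<epsilon> by (intro mult_left_mono) auto
      then have "- (1 - \<epsilon>) * (norm z)\<^sup>2 / (2 * s) \<le> - (1 - \<epsilon>) * R\<^sup>2 / (2 * s)"
        using s by (intro divide_right_mono) linarith+
      then have e: "exp (- (1 - \<epsilon>) * (norm z)\<^sup>2 / (2 * s)) \<le> exp (- (1 - \<epsilon>) * R\<^sup>2 / (2 * s))" by simp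
      have "gauss_density s z = (1 / sqrt (2 * pi * s)) ^ DIM('a) * exp (- (norm z)\<^sup>2 / (2 * s))"
        by (rule gauss_density_eq[OF s])
      also have "- (norm z)\<^sup>2 / (2 * s) = - (1 - \<epsilon>) * (norm z)\<^sup>2 / (2 * s) + - (norm z)\<^sup>2 / (2 * (s / \<epsilon>))"
        using s \<epsilon> by (simp add: field_simps)
      also have "1 / sqrt (2 * pi * s) = 1 / sqrt \<epsilon> * (1 / sqrt (2 * pi * (s / \<epsilon>)))"
        using s \<epsilon> by (simp add: real_sqrt_mult real_sqrt_divide field_simps)
      finally have "gauss_density s z = (1 / sqrt \<epsilon>) ^ DIM('a) * exp (- (1 - \<epsilon>) * (norm z)\<^sup>2 / (2 * s)) * gauss_density (s / \<epsilon>) z"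
        unfolding gauss_density_eq[OF s\<epsilon>] power_mult_distrib exp_add by (simp only: mult_ac)
      also have "\<dots> \<le> c * gauss_density (s / \<epsilon>) z"
        unfolding c_def using e \<epsilon> by (intro mult_right_mono mult_left_mono gauss_density_nonneg) auto
      finally show ?thesis using True by simp
    next
      case False
      then show ?thesis using \<epsilon> by (simp add: c_def gauss_density_nonneg)
    qed
  qed
  then show ?thesis
    using gauss_density_integral(2)[OF s\<epsilon>] by (simp add: heat_indicator_eq[OF s] c_def)
qed

end

section \<open>Spreading of FKPP solutions\<close>

text \<open>All subexponential factors of a unit-ball Gaussian estimate together: volume,
  normalisation, and the terms left over from \<open>(\<kappa> * \<tau> + 2)\<^sup>2 / (2 * \<tau>)
  = \<kappa>\<^sup>2 * \<tau> / 2 + 2 * \<kappa> + 2 / \<tau>\<close>. An arbitrarily small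
  exponential rate absorbs them.\<close>

lemma eventually_overhead:
  fixes V K c :: real and d :: nat
  assumes V: "0 < V" and c: "0 < c"
  shows "\<forall>\<^sub>F \<tau> in at_top. exp (- c * \<tau>) \<le> V * (1 / sqrt (2 * pi * \<tau>)) ^ d * exp (- (2 * K + 2 / \<tau>))"
proof -
  define D where "D = real d / 2"
  have "filterlim (\<lambda>\<tau>. c * \<tau> + ln V - D * ln (2 * pi * \<tau>) - (2 * K + 2 / \<tau>)) at_top at_top"
    using c by real_asymp
  then have "\<forall>\<^sub>F \<tau> in at_top. 0 \<le> c * \<tau> + ln V - D * ln (2 * pi * \<tau>) - (2 * K + 2 / \<tau>)"
    by (rule filterlim_at_top[THEN iffD1, rule_format])
  then show ?thesis
    using eventually_gt_at_top[of 0]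
  proof eventually_elim
    case (elim \<tau>)
    have "exp (- c * \<tau>) \<le> exp (ln V + (- D * ln (2 * pi * \<tau>)) + (- (2 * K + 2 / \<tau>)))"
      using elim by simp
    also have "\<dots> = V * exp (- D * ln (2 * pi * \<tau>)) * exp (- (2 * K + 2 / \<tau>))"
      unfolding exp_add using V by simp
    also have "exp (- D * ln (2 * pi * \<tau>)) = (1 / sqrt (2 * pi * \<tau>)) ^ d"
    proof -
      have "1 / sqrt (2 * pi * \<tau>) = exp (- (ln (2 * pi * \<tau>) / 2))"
      proof -
        have "sqrt (2 * pi * \<tau>) = exp (ln (2 * pi * \<tau>) / 2)"
          using elim by (subst ln_sqrt[symmetric]) auto
        then show ?thesis by (simp only: exp_minus inverse_eq_divide)
      qed
      then show ?thesis by (simp add: exp_of_nat_mult[symmetric] D_def mult_ac)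
    qed
    finally show ?case .
  qed
qed

section \<open>One block of growth and chains of blocks\<close>

context mild_solution
begin

text \<open>\<open>growth\<close> is applied to the largest multiple of the indicator of
  \<open>ball p 1\<close> that its hypotheses allow, hence the \<open>min\<close>. In
  \<open>D + 2\<close> the two unit radii around \<open>p\<close> and \<open>p'\<close> are added to
  the step.\<close>

lemma block_growth:
  assumes \<delta>: "0 < \<delta>" "\<delta> \<le> 1" and \<tau>: "0 < \<tau>" and s: "0 \<le> s" and m: "0 \<le> m"
    and near: "\<And>z. z \<in> ball p 1 \<Longrightarrow> m \<le> 1 - w s z"
    and D: "dist p p' \<le> D" and z: "z \<in> ball p' 1"
  shows "exp (\<beta> * (1 - \<delta>) * \<tau>) * (unit_ball_vol DIM('a) * (1 / sqrt (2 * pi * \<tau>)) ^ DIM('a) * exp (- (D + 2)\<^sup>2 / (2 * \<tau>)))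
    * min m (\<delta> * exp (- \<beta> * \<tau>)) \<le> 1 - w (s + \<tau>) z"
proof -
  define m' where "m' = min m (\<delta> * exp (- \<beta> * \<tau>))"
  have m': "0 \<le> m'" using m \<delta> by (simp add: m'_def)
  have bm: "bounded_measurable borel (indicator (ball p 1) :: 'a \<Rightarrow> real)"
    by (rule bounded_measurable_indicator) simp
  have "exp (\<beta> * (1 - \<delta>) * \<tau>) * heat \<tau> (\<lambda>y. m' * indicator (ball p 1) y) z \<le> 1 - w (s + \<tau>) z"
  proof (rule growth[OF _ _ \<delta>])
    show "(\<lambda>y. m' * indicator (ball p 1) y) \<in> borel_measurable borel"
      by (rule bounded_measurableD[OF bounded_measurable_mult[OF bounded_measurable_const bm]])
    show "m' * indicator (ball p 1) y \<le> \<delta> * exp (- \<beta> * \<tau>)" for y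
      using \<delta> by (auto simp: m'_def indicator_def)
    show "m' * indicator (ball p 1) y \<le> 1 - w (s + \<tau> - \<tau>) y" for y
      using near[of y] w_le_1[of s y] by (auto simp: m'_def indicator_def)
  qed (use \<tau> s m' in auto)
  moreover have "unit_ball_vol DIM('a) * (1 / sqrt (2 * pi * \<tau>)) ^ DIM('a) * exp (- (D + 2)\<^sup>2 / (2 * \<tau>)) \<le> heat \<tau> (indicator (ball p 1)) z"
  proof -
    have "dist z p \<le> D + 1"
      using z D dist_triangle[of z p p'] by (simp add: dist_commute)
    then have "(dist z p + 1)\<^sup>2 \<le> (D + 2)\<^sup>2" by (intro power_mono) auto
    then have "exp (- (D + 2)\<^sup>2 / (2 * \<tau>)) \<le> exp (- (dist z p + 1)\<^sup>2 / (2 * \<tau>))"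
      using \<tau> by (simp add: divide_right_mono)
    then have "unit_ball_vol DIM('a) * (1 / sqrt (2 * pi * \<tau>)) ^ DIM('a) * exp (- (D + 2)\<^sup>2 / (2 * \<tau>))
      \<le> unit_ball_vol DIM('a) * 1 ^ DIM('a) * (1 / sqrt (2 * pi * \<tau>)) ^ DIM('a) * exp (- (dist z p + 1)\<^sup>2 / (2 * \<tau>))"
      using \<tau> by (simp add: mult_left_mono)
    also have "\<dots> \<le> heat \<tau> (indicator (ball p 1)) z"
      by (rule heat_ball_ge[OF \<tau>]) simp
    finally show ?thesis .
  qed
  then have "exp (\<beta> * (1 - \<delta>) * \<tau>) * (m' * (unit_ball_vol DIM('a) * (1 / sqrt (2 * pi * \<tau>)) ^ DIM('a) * exp (- (D + 2)\<^sup>2 / (2 * \<tau>))))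
    \<le> exp (\<beta> * (1 - \<delta>) * \<tau>) * (m' * heat \<tau> (indicator (ball p 1)) z)"
    using m' by (intro mult_left_mono) auto
  ultimately show ?thesis
    unfolding heat_cmult[OF bm] m'_def[symmetric] by (simp add: mult_ac)
qed

text \<open>Each block multiplies the lower bound by \<open>G\<close> until it reaches the cap of
  the linear regime; since \<open>1 \<le> G\<close>, it never falls below the cap again.\<close>

lemma chain_growth:
  fixes p :: "nat \<Rightarrow> 'a"
  assumes \<delta>: "0 < \<delta>" "\<delta> \<le> 1" and \<tau>: "0 < \<tau>" and s: "0 \<le> s" and m: "0 \<le> m"
    and D: "\<And>j. dist (p j) (p (Suc j)) \<le> D"
    and near: "\<And>z. z \<in> ball (p 0) 1 \<Longrightarrow> m \<le> 1 - w s z"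
    and G_def: "G = exp (\<beta> * (1 - \<delta>) * \<tau>) * (unit_ball_vol DIM('a) * (1 / sqrt (2 * pi * \<tau>)) ^ DIM('a) * exp (- (D + 2)\<^sup>2 / (2 * \<tau>)))"
    and G: "1 \<le> G"
    and z: "z \<in> ball (p n) 1"
  shows "min (m * G ^ n) (\<delta> * exp (- \<beta> * \<tau>)) \<le> 1 - w (s + real n * \<tau>) z"
  using z
proof (induction n arbitrary: z)
  case 0
  then show ?case using near[of z] by simp
next
  case (Suc n)
  let ?e = "\<delta> * exp (- \<beta> * \<tau>)"
  let ?m = "min (m * G ^ n) ?e"
  have m0: "0 \<le> ?m" using m G \<delta> by simp
  have "min (m * G ^ Suc n) ?e \<le> G * ?m"
  proof (cases "m * G ^ n \<le> ?e")
    case True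
    then show ?thesis by (simp add: mult_ac)
  next
    case False
    have "?e * 1 \<le> ?e * G" using G \<delta> by (intro mult_left_mono) auto
    with False show ?thesis by (simp add: min_def mult_ac)
  qed
  also have "\<dots> = G * min ?m ?e" by simp
  also have "\<dots> \<le> 1 - w (s + real n * \<tau> + \<tau>) z"
  proof -
    have "0 \<le> s + real n * \<tau>" using s \<tau> by simp
    from block_growth[OF \<delta> \<tau> this m0 Suc.IH D Suc.prems] show ?thesis
      unfolding G_def[symmetric] .
  qed
  finally show ?case by (simp add: algebra_simps)
qed

end

section \<open>Uniform spreading up to the typical radius\<close>

context brownian_motion
begin

text \<open>The radius \<gamma> solves \<open>\<sigma> - \<gamma>\<^sup>2 / \<sigma> = c\<close>:
  branching at rate \<beta> for time \<open>\<sigma> * t\<close>, against the Gaussian cost of the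
  distance \<open>\<gamma> * sqrt (2 * \<beta>) * t\<close>, gains exactly
  \<open>exp (\<beta> * c * t)\<close>. The margin \<eta> yields a further factor exponential in
  \<open>t\<close> that pays for all losses along a chain of blocks of bounded length. The
  thresholds come before \<open>w\<close> in the quantifiers because \<open>w\<close> will vary with
  \<open>t\<close>.\<close>

lemma spread:
  fixes \<beta> c \<eta> m :: real
  assumes \<beta>: "0 < \<beta>" and c: "0 \<le> c" and \<eta>: "0 < \<eta>" "\<eta> \<le> 1" and m: "0 < m"
  obtains \<eta>\<^sub>0 t\<^sub>0 where "0 < \<eta>\<^sub>0" "\<eta>\<^sub>0 \<le> 1" "1 \<le> t\<^sub>0"
    "\<And>w t \<sigma> \<gamma> x y. mild_solution M W \<beta> w \<Longrightarrow> t\<^sub>0 \<le> t \<Longrightarrow>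
      (\<And>z. z \<in> ball x 1 \<Longrightarrow> m * exp (- \<beta> * c * t) \<le> 1 - w 1 z) \<Longrightarrow>
      0 \<le> \<sigma> \<Longrightarrow> \<sigma> \<le> 1 \<Longrightarrow> \<eta> \<le> \<gamma> \<Longrightarrow> \<gamma>\<^sup>2 = \<sigma>\<^sup>2 - c * \<sigma> \<Longrightarrow>
      dist x y \<le> (\<gamma> - \<eta>) * sqrt (2 * \<beta>) * t \<Longrightarrow> \<eta>\<^sub>0 \<le> 1 - w (\<sigma> * t) y"
proof -
  \<comment> \<open>The margin gains \<open>\<eta>\<^sup>2 * t\<close>. Capping the growth and the
    overhead of the blocks each cost the fraction \<delta> of the rate, in total at most
    \<open>\<eta>\<^sup>2 / 2 * t\<close>, leaving half of the gain.\<close>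
  define \<delta> where "\<delta> = \<eta>\<^sup>2 / 4"
  have \<eta>2: "\<eta>\<^sup>2 \<le> 1" using \<eta> by (simp add: power_le_one)
  have \<delta>: "0 < \<delta>" "\<delta> \<le> 1" using \<eta> \<eta>2 by (auto simp: \<delta>_def)
  define K where "K = 2 * sqrt (2 * \<beta>)"
  define V where "V = unit_ball_vol (real DIM('a))"
  have V: "0 < V" by (simp add: V_def)
  have "0 < \<delta> * \<beta>" using \<delta> \<beta> by simp
  from eventually_overhead[OF V this, of "DIM('a)" K] obtain \<tau>\<^sub>1 where
    \<tau>\<^sub>1: "\<And>\<tau>. \<tau>\<^sub>1 \<le> \<tau> \<Longrightarrow> exp (- (\<delta> * \<beta>) * \<tau>) \<le> V * (1 / sqrt (2 * pi * \<tau>)) ^ DIM('a) * exp (- (2 * K + 2 / \<tau>))"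
    by (auto simp: eventually_at_top_linorder)
  define \<tau>\<^sub>0 where "\<tau>\<^sub>0 = max 1 \<tau>\<^sub>1"
  have \<tau>\<^sub>0: "1 \<le> \<tau>\<^sub>0" "\<tau>\<^sub>1 \<le> \<tau>\<^sub>0" by (auto simp: \<tau>\<^sub>0_def)
  define l where "l = max 0 (- ln m) / \<beta>"
  have l: "0 \<le> l" "- ln m \<le> \<beta> * l" using \<beta> by (auto simp: l_def field_simps)
  \<comment> \<open>Large enough for \<open>\<eta> * t \<ge> 2\<close>, for at least one block to
    fit, and for the spare gain \<open>\<eta>\<^sup>2 / 2 * t\<close> to cover the additive loss 3
    and, via \<open>l\<close>, the factor \<open>m\<close>.\<close>
  define t\<^sub>0 where "t\<^sub>0 = max (max 1 (2 / \<eta>)) (max ((\<tau>\<^sub>0 + 1) / \<eta>) (2 / \<eta>\<^sup>2 * (3 + l)))"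
  \<comment> \<open>The cap reached by the chain, at the largest block length
    \<open>2 * \<tau>\<^sub>0\<close> that can occur.\<close>
  define \<eta>\<^sub>0 where "\<eta>\<^sub>0 = min 1 (\<delta> * exp (- (2 * \<beta> * \<tau>\<^sub>0)))"
  show ?thesis
  proof (rule that[of \<eta>\<^sub>0 t\<^sub>0])
    show "0 < \<eta>\<^sub>0" "\<eta>\<^sub>0 \<le> 1" using \<delta> by (auto simp: \<eta>\<^sub>0_def)
    show "1 \<le> t\<^sub>0" by (simp add: t\<^sub>0_def)
    fix w t \<sigma> \<gamma> and x y :: 'a
    assume "mild_solution M W \<beta> w" and t: "t\<^sub>0 \<le> t"
      and near: "\<And>z. z \<in> ball x 1 \<Longrightarrow> m * exp (- \<beta> * c * t) \<le> 1 - w 1 z"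
      and \<sigma>: "0 \<le> \<sigma>" "\<sigma> \<le> 1" and \<gamma>: "\<eta> \<le> \<gamma>" "\<gamma>\<^sup>2 = \<sigma>\<^sup>2 - c * \<sigma>"
      and dist: "dist x y \<le> (\<gamma> - \<eta>) * sqrt (2 * \<beta>) * t"
    interpret w: mild_solution M W \<beta> w by fact
    have t1: "1 \<le> t" "2 / \<eta> \<le> t" "(\<tau>\<^sub>0 + 1) / \<eta> \<le> t" "2 / \<eta>\<^sup>2 * (3 + l) \<le> t"
      using t by (auto simp: t\<^sub>0_def)
    have \<eta>t: "2 \<le> \<eta> * t" "\<tau>\<^sub>0 + 1 \<le> \<eta> * t" "3 + l \<le> \<eta>\<^sup>2 / 2 * t"
      using t1 \<eta> by (auto simp: field_simps)
    have "0 \<le> c * \<sigma>" using c \<sigma> by simp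
    then have \<gamma>\<sigma>: "\<gamma> \<le> \<sigma>" using \<gamma>(2) \<sigma> by - (rule power2_le_imp_le, auto)
    \<comment> \<open>The time left after the initial unit of time, at which the lower bound for
      survival is given.\<close>
    define S where "S = \<sigma> * t - 1"
    have "\<eta> * t \<le> \<sigma> * t" using \<gamma>\<sigma> \<gamma>(1) t1 by (intro mult_right_mono) auto
    then have S: "\<tau>\<^sub>0 \<le> S" "\<sigma> * t / 2 \<le> S" "2 \<le> \<sigma> * t" using \<eta>t by (auto simp: S_def)
    have S0: "0 < S" using S \<tau>\<^sub>0 by simp
    define n where "n = nat \<lfloor>S / \<tau>\<^sub>0\<rfloor>"
    have "1 \<le> S / \<tau>\<^sub>0" using S \<tau>\<^sub>0 by simp
    then have n: "1 \<le> n" "real n \<le> S / \<tau>\<^sub>0" "S / \<tau>\<^sub>0 < real n + 1"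
    proof -
      have "real n = of_int \<lfloor>S / \<tau>\<^sub>0\<rfloor>" using \<open>1 \<le> S / \<tau>\<^sub>0\<close> by (simp add: n_def)
      moreover have "1 \<le> \<lfloor>S / \<tau>\<^sub>0\<rfloor>" using \<open>1 \<le> S / \<tau>\<^sub>0\<close> by (simp add: le_floor_iff)
      ultimately show "1 \<le> n" "real n \<le> S / \<tau>\<^sub>0" "S / \<tau>\<^sub>0 < real n + 1"
        by linarith+
    qed
    \<comment> \<open>Rounding the number of blocks down and stretching them makes \<open>n\<close>
      blocks fill \<open>S\<close> exactly, at lengths between \<open>\<tau>\<^sub>0\<close> and
      \<open>2 * \<tau>\<^sub>0\<close>.\<close>
    define \<tau> where "\<tau> = S / real n"
    have \<tau>: "\<tau>\<^sub>0 \<le> \<tau>" "\<tau> \<le> 2 * \<tau>\<^sub>0" "real n * \<tau> = S"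
    proof -
      have t0: "0 < \<tau>\<^sub>0" and n0: "0 < real n" using \<tau>\<^sub>0(1) n(1) by linarith+
      have "real n * \<tau>\<^sub>0 \<le> S" using n(2) pos_le_divide_eq[OF t0] by blast
      then show "\<tau>\<^sub>0 \<le> \<tau>" unfolding \<tau>_def pos_le_divide_eq[OF n0] by (simp only: mult.commute)
      have "S \<le> (real n + 1) * \<tau>\<^sub>0" using n(3) pos_divide_less_eq[OF t0] less_imp_le by blast
      also have "\<dots> \<le> (2 * real n) * \<tau>\<^sub>0" using n(1) t0 by (intro mult_right_mono) auto
      finally show "\<tau> \<le> 2 * \<tau>\<^sub>0" unfolding \<tau>_def pos_divide_le_eq[OF n0] by (simp only: mult_ac)
      show "real n * \<tau> = S" using n by (simp add: \<tau>_def)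
    qed
    have \<tau>pos: "0 < \<tau>" using \<tau> \<tau>\<^sub>0 by simp
    define \<kappa> where "\<kappa> = dist x y / S"
    have \<kappa>0: "0 \<le> \<kappa>" using S0 by (simp add: \<kappa>_def)
    have \<kappa>K: "\<kappa> \<le> K"
    proof -
      have "dist x y \<le> \<sigma> * sqrt (2 * \<beta>) * t"
        using dist \<gamma>\<sigma> \<eta> \<beta> t1 by (elim order_trans) (intro mult_right_mono, auto)
      also have "\<dots> = K * (\<sigma> * t / 2)" by (simp add: K_def)
      also have "\<dots> \<le> K * S" using S \<beta> by (intro mult_left_mono) (auto simp: K_def)
      finally show ?thesis using S0 by (simp add: \<kappa>_def field_simps)
    qed
    define p where "p j = x + (real j / real n) *\<^sub>R (y - x)" for j
    have p: "p 0 = x" "p n = y" using n by (auto simp: p_def)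
    have D: "dist (p j) (p (Suc j)) \<le> \<kappa> * \<tau>" for j
    proof -
      have "p (Suc j) - p j = (1 / real n) *\<^sub>R (y - x)"
      proof -
        have "p (Suc j) - p j = (real (Suc j) / real n - real j / real n) *\<^sub>R (y - x)"
          by (simp add: p_def scaleR_left_diff_distrib)
        also have "real (Suc j) / real n - real j / real n = 1 / real n"
          by (simp add: add_divide_distrib)
        finally show ?thesis .
      qed
      then have "dist (p j) (p (Suc j)) = dist x y / real n"
        by (simp add: dist_norm norm_minus_commute[of "p j"] norm_minus_commute[of x])
      also have "\<dots> = \<kappa> * \<tau>" using S0 by (simp add: \<kappa>_def \<tau>_def)
      finally show ?thesis by simp
    qed
    \<comment> \<open>The net exponential rate of moving at speed \<kappa> along the segment from
      \<open>x\<close> to \<open>y\<close>.\<close>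
    define g where "g = \<beta> * (1 - 2 * \<delta>) - \<kappa>\<^sup>2 / 2"
    define G where "G = exp (\<beta> * (1 - \<delta>) * \<tau>) * (unit_ball_vol DIM('a) * (1 / sqrt (2 * pi * \<tau>)) ^ DIM('a) * exp (- (\<kappa> * \<tau> + 2)\<^sup>2 / (2 * \<tau>)))"
    have gG: "exp (g * \<tau>) \<le> G"
    proof -
      have "exp (g * \<tau>) = exp (\<beta> * (1 - \<delta>) * \<tau> - \<kappa>\<^sup>2 * \<tau> / 2) * exp (- (\<delta> * \<beta>) * \<tau>)"
        by (simp add: g_def exp_add[symmetric] algebra_simps)
      also have "\<dots> \<le> exp (\<beta> * (1 - \<delta>) * \<tau> - \<kappa>\<^sup>2 * \<tau> / 2) * (V * (1 / sqrt (2 * pi * \<tau>)) ^ DIM('a) * exp (- (2 * K + 2 / \<tau>)))"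
        using \<tau>\<^sub>1[of \<tau>] \<tau> \<tau>\<^sub>0 by (intro mult_left_mono) auto
      also have "\<dots> \<le> exp (\<beta> * (1 - \<delta>) * \<tau> - \<kappa>\<^sup>2 * \<tau> / 2) * (V * (1 / sqrt (2 * pi * \<tau>)) ^ DIM('a) * exp (- (2 * \<kappa> + 2 / \<tau>)))"
        using V \<tau>pos \<kappa>K by (intro mult_left_mono) auto
      also have "\<dots> = V * (1 / sqrt (2 * pi * \<tau>)) ^ DIM('a) * exp (\<beta> * (1 - \<delta>) * \<tau> - \<kappa>\<^sup>2 * \<tau> / 2 + - (2 * \<kappa> + 2 / \<tau>))"
        unfolding exp_add by (simp only: mult_ac)
      also have "\<beta> * (1 - \<delta>) * \<tau> - \<kappa>\<^sup>2 * \<tau> / 2 + - (2 * \<kappa> + 2 / \<tau>) = \<beta> * (1 - \<delta>) * \<tau> + - (\<kappa> * \<tau> + 2)\<^sup>2 / (2 * \<tau>)"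
        using \<tau>pos by (simp add: field_simps power2_eq_square)
      also have "V * (1 / sqrt (2 * pi * \<tau>)) ^ DIM('a) * exp (\<beta> * (1 - \<delta>) * \<tau> + - (\<kappa> * \<tau> + 2)\<^sup>2 / (2 * \<tau>)) = G"
        unfolding exp_add G_def V_def by (simp only: mult_ac)
      finally show ?thesis .
    qed
    \<comment> \<open>In units of \<beta>: growth contributes at least
      \<open>\<sigma> * t - 1 - \<eta>\<^sup>2 / 2 * t\<close>, and the displacement costs at most
      \<open>(\<sigma> - c - \<eta>\<^sup>2) * t + 2\<close>.\<close>
    have E: "\<beta> * (c * t + \<eta>\<^sup>2 / 2 * t - 3) \<le> g * S"
    proof -
      have "(dist x y)\<^sup>2 \<le> ((\<gamma> - \<eta>) * sqrt (2 * \<beta>) * t)\<^sup>2" using dist by (intro power_mono) auto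
      also have "\<dots> = 2 * \<beta> * ((\<gamma> - \<eta>) * t)\<^sup>2" using \<beta> by (simp add: power_mult_distrib)
      finally have d2: "(dist x y)\<^sup>2 / (2 * S) \<le> \<beta> * (((\<gamma> - \<eta>) * t)\<^sup>2 / S)"
        using S0 by (simp add: field_simps)
      have \<sigma>0: "0 < \<sigma>" using \<gamma>\<sigma> \<gamma>(1) \<eta> by linarith
      \<comment> \<open>Replacing \<open>S\<close> by \<open>S + 1 = \<sigma> * t\<close> in the
        denominator costs a bounded amount, since \<open>\<sigma> * t \<ge> 2\<close>.\<close>
      have "((\<gamma> - \<eta>) * t)\<^sup>2 / S \<le> ((\<gamma> - \<eta>) * t)\<^sup>2 * (1 / (\<sigma> * t) + 2 / (\<sigma> * t)\<^sup>2)"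
      proof -
        have "(\<sigma> * t)\<^sup>2 \<le> (\<sigma> * t + 2) * S" using S(3) by (simp add: S_def power2_eq_square algebra_simps)
        moreover have "0 < (\<sigma> * t)\<^sup>2" using S(3) by (intro zero_less_power) linarith
        ultimately have "1 \<le> (\<sigma> * t + 2) * S / (\<sigma> * t)\<^sup>2" by (subst le_divide_eq_1_pos)
        then have "1 / S \<le> (\<sigma> * t + 2) / (\<sigma> * t)\<^sup>2" unfolding pos_divide_le_eq[OF S0] by simp
        also have "\<dots> = 1 / (\<sigma> * t) + 2 / (\<sigma> * t)\<^sup>2"
          using \<sigma>0 t1 by (simp add: add_divide_distrib power2_eq_square)
        finally show ?thesis by (metis mult_left_mono times_divide_eq_right mult.right_neutral zero_le_power2)
      qed
      also have "\<dots> = (\<gamma> - \<eta>)\<^sup>2 / \<sigma> * t + 2 * ((\<gamma> - \<eta>) / \<sigma>)\<^sup>2"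
        using \<sigma>0 t1 by (simp add: field_simps power2_eq_square)
      also have "\<dots> \<le> (\<sigma> - c - \<eta>\<^sup>2) * t + 2 * 1"
      proof (rule add_mono)
        have "\<eta> * \<eta> \<le> \<gamma> * \<eta>" using \<gamma>(1) \<eta> by (intro mult_right_mono) auto
        then have "(\<gamma> - \<eta>)\<^sup>2 \<le> \<gamma>\<^sup>2 - \<eta>\<^sup>2" by (simp add: power2_eq_square algebra_simps)
        also have "\<dots> \<le> \<sigma>\<^sup>2 - c * \<sigma> - \<eta>\<^sup>2 * \<sigma>" using \<gamma>(2) \<sigma> by (simp add: mult_left_le)
        finally have "(\<gamma> - \<eta>)\<^sup>2 / \<sigma> \<le> \<sigma> - c - \<eta>\<^sup>2" using \<sigma>0 by (simp add: field_simps power2_eq_square)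
        then show "(\<gamma> - \<eta>)\<^sup>2 / \<sigma> * t \<le> (\<sigma> - c - \<eta>\<^sup>2) * t" using t1 by (intro mult_right_mono) auto
        have "(\<gamma> - \<eta>) / \<sigma> \<le> 1" "0 \<le> (\<gamma> - \<eta>) / \<sigma>" using \<gamma>\<sigma> \<gamma>(1) \<eta> \<sigma>0 by auto
        then show "2 * ((\<gamma> - \<eta>) / \<sigma>)\<^sup>2 \<le> 2 * 1" by (simp add: power_le_one)
      qed
      finally have q: "((\<gamma> - \<eta>) * t)\<^sup>2 / S \<le> (\<sigma> - c - \<eta>\<^sup>2) * t + 2" by simp
      have "\<eta>\<^sup>2 * (\<sigma> * t) \<le> \<eta>\<^sup>2 * t" using \<sigma> t1 by (intro mult_left_mono) (auto simp: mult_left_le_one_le)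
      moreover have "(1 - 2 * \<delta>) * S = \<sigma> * t - 1 - \<eta>\<^sup>2 * (\<sigma> * t) / 2 + \<eta>\<^sup>2 / 2"
        by (simp add: S_def \<delta>_def field_simps)
      moreover have "(\<sigma> - c - \<eta>\<^sup>2) * t = \<sigma> * t - c * t - \<eta>\<^sup>2 * t" by (simp add: algebra_simps)
      moreover have "0 \<le> \<eta>\<^sup>2" by simp
      ultimately have "c * t + \<eta>\<^sup>2 / 2 * t - 3 \<le> (1 - 2 * \<delta>) * S - ((\<sigma> - c - \<eta>\<^sup>2) * t + 2)"
        by linarith
      also have "\<dots> \<le> (1 - 2 * \<delta>) * S - ((\<gamma> - \<eta>) * t)\<^sup>2 / S" using q by simp
      finally have "\<beta> * (c * t + \<eta>\<^sup>2 / 2 * t - 3) \<le> \<beta> * ((1 - 2 * \<delta>) * S - ((\<gamma> - \<eta>) * t)\<^sup>2 / S)"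
        using \<beta> by (intro mult_left_mono) auto
      also have "\<dots> = \<beta> * (1 - 2 * \<delta>) * S - \<beta> * (((\<gamma> - \<eta>) * t)\<^sup>2 / S)" by (simp only: right_diff_distrib[of \<beta> "(1 - 2 * \<delta>) * S"] mult.assoc)
      also have "\<dots> \<le> \<beta> * (1 - 2 * \<delta>) * S - (dist x y)\<^sup>2 / (2 * S)" using d2 by simp
      also have "(dist x y)\<^sup>2 / (2 * S) = \<kappa>\<^sup>2 / 2 * S" using S0 by (simp add: \<kappa>_def power2_eq_square)
      also have "\<beta> * (1 - 2 * \<delta>) * S - \<kappa>\<^sup>2 / 2 * S = g * S" by (simp add: g_def left_diff_distrib)
      finally show ?thesis .
    qed
    have E': "\<beta> * c * t - ln m \<le> g * S"
    proof -
      have "\<beta> * c * t - ln m \<le> \<beta> * (c * t + l)" using l by (simp add: algebra_simps)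
      also have "\<dots> \<le> \<beta> * (c * t + \<eta>\<^sup>2 / 2 * t - 3)" using \<eta>t \<beta> by (intro mult_left_mono) auto
      finally show ?thesis using E by simp
    qed
    have "0 \<le> \<beta> * (c * t + \<eta>\<^sup>2 / 2 * t - 3)"
    proof -
      have "0 \<le> c * t" using c t1 by simp
      then have "0 \<le> c * t + \<eta>\<^sup>2 / 2 * t - 3" using \<eta>t(3) l(1) by linarith
      then show ?thesis using \<beta> by simp
    qed
    then have "0 \<le> g * S" using E by linarith
    then have g0: "0 \<le> g" using S0 by (simp add: zero_le_mult_iff)
    have G1: "1 \<le> G"
    proof -
      have "1 \<le> exp (g * \<tau>)" using g0 \<tau>pos by simp
      with gG show ?thesis by linarith
    qed
    have big: "1 \<le> (m * exp (- \<beta> * c * t)) * G ^ n"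
    proof -
      have "1 = exp (ln m + - \<beta> * c * t + (\<beta> * c * t - ln m))" by simp
      also have "\<dots> \<le> exp (ln m + - \<beta> * c * t + g * S)" using E' by simp
      also have "\<dots> = m * exp (- \<beta> * c * t) * exp (real n * (g * \<tau>))"
        unfolding exp_add using m \<tau>(3) by (simp add: mult_ac)
      also have "exp (real n * (g * \<tau>)) = exp (g * \<tau>) ^ n" by (rule exp_of_nat_mult)
      also have "m * exp (- \<beta> * c * t) * exp (g * \<tau>) ^ n \<le> m * exp (- \<beta> * c * t) * G ^ n"
        using gG m by (intro mult_left_mono power_mono) auto
      finally show ?thesis .
    qed
    have "min ((m * exp (- \<beta> * c * t)) * G ^ n) (\<delta> * exp (- \<beta> * \<tau>)) \<le> 1 - w (1 + real n * \<tau>) y"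
      by (rule w.chain_growth[where p = p, OF \<delta> \<tau>pos _ _ D _ G_def G1]) (use m near p in auto)
    moreover have "\<eta>\<^sub>0 \<le> min ((m * exp (- \<beta> * c * t)) * G ^ n) (\<delta> * exp (- \<beta> * \<tau>))"
    proof -
      have "\<delta> * exp (- (2 * \<beta> * \<tau>\<^sub>0)) \<le> \<delta> * exp (- \<beta> * \<tau>)"
        using \<delta> \<tau> \<beta> by (intro mult_left_mono) (auto simp: mult_left_mono)
      then show ?thesis using big by (auto simp: \<eta>\<^sub>0_def)
    qed
    ultimately have "\<eta>\<^sub>0 \<le> 1 - w (1 + real n * \<tau>) y" by linarith
    then show "\<eta>\<^sub>0 \<le> 1 - w (\<sigma> * t) y" using \<tau>(3) by (simp add: S_def)
  qed
qed

text \<open>For times in the last stretch of length \<open>\<kappa> * t\<close>,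
  \<open>spread\<close> gives \<open>w \<le> 1 - \<eta>\<^sub>0\<close> on a region slightly larger
  than the one claimed. Decay over this stretch makes \<open>w\<close> exponentially small, because
  leaving the larger region in so short a time is very unlikely.\<close>

lemma penetration:
  fixes \<beta> c \<eta> m \<epsilon> :: real
  assumes \<beta>: "0 < \<beta>" and c: "0 \<le> c" and \<eta>: "0 < \<eta>" "\<eta> \<le> 1" and m: "0 < m" and \<epsilon>: "0 < \<epsilon>"
  obtains t\<^sub>0 where "1 \<le> t\<^sub>0"
    "\<And>w t \<sigma> \<gamma> x y. mild_solution M W \<beta> w \<Longrightarrow> t\<^sub>0 \<le> t \<Longrightarrow>
      (\<And>z. z \<in> ball x 1 \<Longrightarrow> m * exp (- \<beta> * c * t) \<le> 1 - w 1 z) \<Longrightarrow>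
      0 \<le> \<sigma> \<Longrightarrow> \<sigma> \<le> 1 \<Longrightarrow> 2 * \<eta> \<le> \<gamma> \<Longrightarrow> \<gamma>\<^sup>2 = \<sigma>\<^sup>2 - c * \<sigma> \<Longrightarrow>
      dist x y \<le> (\<gamma> - 2 * \<eta>) * sqrt (2 * \<beta>) * t \<Longrightarrow> w (\<sigma> * t) y \<le> \<epsilon>"
proof -
  obtain \<eta>\<^sub>0 t\<^sub>1 where \<eta>\<^sub>0: "0 < \<eta>\<^sub>0" "\<eta>\<^sub>0 \<le> 1" and t\<^sub>1: "1 \<le> t\<^sub>1"
    and spread: "\<And>w t \<sigma> \<gamma> x y. mild_solution M W \<beta> w \<Longrightarrow> t\<^sub>1 \<le> t \<Longrightarrow>
      (\<And>z. z \<in> ball x 1 \<Longrightarrow> m * exp (- \<beta> * c * t) \<le> 1 - w 1 z) \<Longrightarrow>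
      0 \<le> \<sigma> \<Longrightarrow> \<sigma> \<le> 1 \<Longrightarrow> \<eta> \<le> \<gamma> \<Longrightarrow> \<gamma>\<^sup>2 = \<sigma>\<^sup>2 - c * \<sigma> \<Longrightarrow>
      dist x y \<le> (\<gamma> - \<eta>) * sqrt (2 * \<beta>) * t \<Longrightarrow> \<eta>\<^sub>0 \<le> 1 - w (\<sigma> * t) y"
    using spread[OF \<beta> c \<eta> m] by metis
  \<comment> \<open>Two purposes: giving up time \<open>\<kappa> * t\<close> lowers
    \<open>\<gamma>\<^sup>2\<close> by at most \<open>\<eta>\<^sup>2 / 4\<close>, hence \<gamma> by
    at most \<open>\<eta> / 2\<close>; and a displacement of
    \<open>\<eta> / 2 * sqrt (2 * \<beta>) * t\<close> within that time costs a factor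
    \<open>exp (- \<beta> * t)\<close>.\<close>
  define \<kappa> where "\<kappa> = \<eta>\<^sup>2 / 8"
  have \<kappa>: "0 < \<kappa>" using \<eta> by (simp add: \<kappa>_def)
  have \<eta>2: "\<eta>\<^sup>2 \<le> \<eta>" using \<eta> by (simp add: power2_eq_square mult_left_le)
  define A where "A = (1 / sqrt (1/2 :: real)) ^ DIM('a)"
  have A: "0 < A" by (simp add: A_def)
  define b where "b = \<beta> * \<eta>\<^sub>0 * \<kappa>"
  have b: "0 < b" using \<beta> \<eta>\<^sub>0 \<kappa> by (simp add: b_def)
  have "((\<lambda>t. exp (- b * t) + \<beta> * (A * exp (- \<beta> * t)) * (\<kappa> * t)) \<longlongrightarrow> 0) at_top"
  proof -
    have "((\<lambda>t. exp (- b * t)) \<longlongrightarrow> 0) at_top" using b by real_asymp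
    moreover have "((\<lambda>t. \<beta> * (A * exp (- \<beta> * t)) * (\<kappa> * t)) \<longlongrightarrow> 0) at_top" using \<beta> by real_asymp
    ultimately show ?thesis using tendsto_add by fastforce
  qed
  from order_tendstoD(2)[OF this \<epsilon>] obtain t\<^sub>2 where
    t\<^sub>2: "\<And>t. t\<^sub>2 \<le> t \<Longrightarrow> exp (- b * t) + \<beta> * (A * exp (- \<beta> * t)) * (\<kappa> * t) < \<epsilon>"
    by (auto simp: eventually_at_top_linorder)
  show ?thesis
  proof (rule that[of "max t\<^sub>1 t\<^sub>2"])
    show "1 \<le> max t\<^sub>1 t\<^sub>2" using t\<^sub>1 by simp
    fix w t \<sigma> \<gamma> and x y :: 'a
    assume mild: "mild_solution M W \<beta> w" and t: "max t\<^sub>1 t\<^sub>2 \<le> t"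
      and near: "\<And>z. z \<in> ball x 1 \<Longrightarrow> m * exp (- \<beta> * c * t) \<le> 1 - w 1 z"
      and \<sigma>: "0 \<le> \<sigma>" "\<sigma> \<le> 1" and \<gamma>: "2 * \<eta> \<le> \<gamma>" "\<gamma>\<^sup>2 = \<sigma>\<^sup>2 - c * \<sigma>"
      and dist: "dist x y \<le> (\<gamma> - 2 * \<eta>) * sqrt (2 * \<beta>) * t"
    interpret w: mild_solution M W \<beta> w by fact
    have t0: "1 \<le> t" "t\<^sub>1 \<le> t" "t\<^sub>2 \<le> t" using t t\<^sub>1 by auto
    have "0 \<le> c * \<sigma>" using c \<sigma> by simp
    then have \<gamma>\<sigma>: "\<gamma> \<le> \<sigma>" using \<gamma>(2) \<sigma> by - (rule power2_le_imp_le, auto)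
    \<comment> \<open>Halfway between \<open>\<gamma> - 2 * \<eta>\<close>, where \<open>y\<close>
      lies, and \<open>\<gamma> - \<eta>\<close>: half of the gap absorbs the shrinking of \<gamma>,
      the other half keeps \<open>y\<close> away from the bad set.\<close>
    define Bad where "Bad = {z. (\<gamma> - 3 / 2 * \<eta>) * sqrt (2 * \<beta>) * t < dist x z}"
    have Bad: "Bad \<in> sets borel" unfolding Bad_def by measurable
    have "\<kappa> \<le> \<sigma>" using \<kappa>_def \<eta>2 \<gamma> \<gamma>\<sigma> \<eta> by linarith
    then have \<kappa>t: "\<kappa> * t \<le> \<sigma> * t" using t0 by (intro mult_right_mono) auto
    have "w (\<sigma> * t) y \<le> exp (- \<beta> * (1 - (1 - \<eta>\<^sub>0)) * (\<kappa> * t)) + \<beta> * (A * exp (- \<beta> * t)) * (\<kappa> * t)"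
    proof (rule w.decay[OF _ \<kappa>t, where Bad = "\<lambda>_. Bad"])
      show "0 \<le> \<kappa> * t" "0 \<le> 1 - \<eta>\<^sub>0" using \<kappa> t0 \<eta>\<^sub>0 by auto
      have "{(s :: real, z). z \<in> Bad} = UNIV \<times> Bad" by auto
      then show "{(s :: real, z). z \<in> Bad} \<in> sets (borel \<Otimes>\<^sub>M borel)" using Bad by simp
    next
      fix s z assume s: "0 < s" "s \<le> \<kappa> * t" and z: "z \<notin> Bad"
      define \<sigma>' where "\<sigma>' = \<sigma> - s / t"
      have st: "0 < s / t" "s / t \<le> \<kappa>" using s t0 by (auto simp: field_simps)
      have \<sigma>': "0 \<le> \<sigma>'" "\<sigma>' \<le> 1" using st \<sigma> \<open>\<kappa> \<le> \<sigma>\<close> by (auto simp: \<sigma>'_def)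
      have "(s / t) * (\<sigma> + \<sigma>' - c) \<le> (s / t) * 2"
        using st \<sigma> \<sigma>' c by (intro mult_left_mono) auto
      also have "\<dots> \<le> \<kappa> * 2" by (rule mult_right_mono[OF st(2)]) simp
      finally have "\<sigma>\<^sup>2 - c * \<sigma> - (\<sigma>'\<^sup>2 - c * \<sigma>') \<le> 2 * \<kappa>"
        by (simp add: \<sigma>'_def power2_eq_square algebra_simps)
      then have g1: "\<gamma>\<^sup>2 - \<eta>\<^sup>2 / 4 \<le> \<sigma>'\<^sup>2 - c * \<sigma>'" using \<gamma>(2) by (simp add: \<kappa>_def)
      have "2 * \<eta> * \<eta> \<le> \<gamma> * \<eta>" using \<gamma>(1) \<eta> by (intro mult_right_mono) auto
      then have g2: "(\<gamma> - \<eta> / 2)\<^sup>2 \<le> \<gamma>\<^sup>2 - \<eta>\<^sup>2 / 4"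
      proof -
        have "(\<gamma> - \<eta> / 2)\<^sup>2 = \<gamma>\<^sup>2 - \<gamma> * \<eta> + \<eta> * \<eta> / 4" by (simp add: power2_eq_square field_simps)
        moreover have "\<eta>\<^sup>2 = \<eta> * \<eta>" by (simp add: power2_eq_square)
        ultimately show ?thesis using \<open>2 * \<eta> * \<eta> \<le> \<gamma> * \<eta>\<close> zero_le_square[of \<eta>] by linarith
      qed
      define \<gamma>' where "\<gamma>' = sqrt (\<sigma>'\<^sup>2 - c * \<sigma>')"
      have \<gamma>': "\<gamma> - \<eta> / 2 \<le> \<gamma>'"
        unfolding \<gamma>'_def using g1 g2 by (intro real_le_rsqrt) auto
      have "0 \<le> \<sigma>'\<^sup>2 - c * \<sigma>'" using g1 g2 zero_le_power2[of "\<gamma> - \<eta> / 2"] by linarith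
      then have \<gamma>'2: "\<gamma>'\<^sup>2 = \<sigma>'\<^sup>2 - c * \<sigma>'" by (simp add: \<gamma>'_def)
      have "dist x z \<le> (\<gamma> - 3 / 2 * \<eta>) * sqrt (2 * \<beta>) * t" using z by (simp add: Bad_def)
      also have "\<dots> \<le> (\<gamma>' - \<eta>) * sqrt (2 * \<beta>) * t"
        using \<gamma>' t0 \<beta> by (intro mult_right_mono) auto
      finally have "\<eta>\<^sub>0 \<le> 1 - w (\<sigma>' * t) z"
        using \<gamma>' \<gamma> \<eta> by (intro spread[OF mild t0(2) near \<sigma>' _ \<gamma>'2]) auto
      moreover have "\<sigma>' * t = \<sigma> * t - s" using t0 by (simp add: \<sigma>'_def field_simps)
      ultimately show "w (\<sigma> * t - s) z \<le> 1 - \<eta>\<^sub>0" by simp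
    next
      fix s assume s: "0 < s" "s \<le> \<kappa> * t"
      define R where "R = \<eta> / 2 * sqrt (2 * \<beta>) * t"
      have R: "0 \<le> R" using \<eta> \<beta> t0 by (simp add: R_def)
      have far: "R \<le> dist y z" if "z \<in> Bad" for z
      proof -
        have "(\<gamma> - 3 / 2 * \<eta>) * sqrt (2 * \<beta>) * t \<le> dist x y + dist y z"
          using that dist_triangle[of x z y] by (simp add: Bad_def)
        moreover have "(\<gamma> - 3 / 2 * \<eta>) * sqrt (2 * \<beta>) * t = (\<gamma> - 2 * \<eta>) * sqrt (2 * \<beta>) * t + R"
          by (simp add: R_def algebra_simps)
        ultimately show ?thesis using dist by linarith
      qed
      have "heat s (indicator Bad) y \<le> A * exp (- (1 - 1 / 2) * R\<^sup>2 / (2 * s))"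
        unfolding A_def by (rule heat_far_le[OF s(1) _ _ R Bad far]) auto
      also have "\<dots> \<le> A * exp (- \<beta> * t)"
      proof -
        have "R\<^sup>2 = 4 * \<beta> * (\<kappa> * t) * t" using \<beta> by (simp add: R_def \<kappa>_def power2_eq_square)
        also have "\<dots> \<ge> 4 * \<beta> * s * t" using s \<beta> t0 by (intro mult_right_mono mult_left_mono) auto
        finally have "\<beta> * t \<le> R\<^sup>2 / (4 * s)" using s by (simp add: field_simps)
        moreover have "- (1 - 1 / 2) * R\<^sup>2 / (2 * s) = - (R\<^sup>2 / (4 * s))" by simp
        ultimately show ?thesis using A by (intro mult_left_mono) auto
      qed
      finally have h: "heat s (indicator Bad) y \<le> A * exp (- \<beta> * t)" .
      have "exp (- \<beta> * (1 - (1 - \<eta>\<^sub>0)) * s) * heat s (indicator Bad) y \<le> 1 * heat s (indicator Bad) y"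
        using \<beta> \<eta>\<^sub>0 s Bad by (intro mult_right_mono heat_nonneg) auto
      with h show "exp (- \<beta> * (1 - (1 - \<eta>\<^sub>0)) * s) * heat s (indicator Bad) y \<le> A * exp (- \<beta> * t)"
        by linarith
    qed
    also have "exp (- \<beta> * (1 - (1 - \<eta>\<^sub>0)) * (\<kappa> * t)) = exp (- b * t)" by (simp add: b_def)
    finally show "w (\<sigma> * t) y \<le> \<epsilon>" using t\<^sub>2[OF t0(3)] by linarith
  qed
qed

end

section \<open>The rate function\<close>

text \<open>In units of \<open>sqrt (2 * \<beta>) * t\<close>, the distance from the target at which
  a particle with remaining time \<open>(1 - \<rho>) * t\<close> has about
  \<open>exp (\<beta> * a * t)\<close> expected hits: the solution \<gamma> of
  \<open>(1 - \<rho>) - \<gamma>\<^sup>2 / (1 - \<rho>) = a + k * d\<close>, where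
  \<open>k * d\<close> is due to the volume of the target.\<close>

definition typical_radius :: "nat \<Rightarrow> real \<Rightarrow> real \<Rightarrow> real \<Rightarrow> real" where
  "typical_radius d k a \<rho> = sqrt ((1 - \<rho>)\<^sup>2 - (a + k * d) * (1 - \<rho>))"

text \<open>In units of \<open>\<beta> * t\<close>: the first term pays for not branching until
  \<open>\<rho> * t\<close>, the second for being displaced within that time to the typical radius
  from the target, starting at distance \<theta>.\<close>

definition cost :: "nat \<Rightarrow> real \<Rightarrow> real \<Rightarrow> real \<Rightarrow> real \<Rightarrow> real" where
  "cost d \<theta> k a \<rho> = \<rho> + (typical_radius d k a \<rho> - \<theta>)\<^sup>2 / \<rho>"

context
  fixes d :: nat and \<theta> k a :: real
  assumes \<theta>: "0 \<le> \<theta>" "\<theta> < 1" and c: "0 \<le> a + k * d" "a + k * d < 1 - \<theta>\<^sup>2"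
begin

lemma rate_function_eq: "rate_function d \<theta> k a = (INF \<rho>\<in>{0<..rho_bar d \<theta> k a}. cost d \<theta> k a \<rho>)"
  by (simp add: rate_function_def cost_def typical_radius_def)

lemma rho_bar_bounds: "0 < rho_bar d \<theta> k a" "rho_bar d \<theta> k a \<le> 1"
proof -
  define c' where "c' = a + k * d"
  have c': "0 \<le> c'" "c' < 1 - \<theta>\<^sup>2" using c by (simp_all add: c'_def)
  have "sqrt ((c' / 2)\<^sup>2 + \<theta>\<^sup>2) < 1 - c' / 2"
  proof (rule real_less_lsqrt)
    show "0 \<le> 1 - c' / 2" using c' zero_le_power2[of \<theta>] by linarith
    show "(c' / 2)\<^sup>2 + \<theta>\<^sup>2 < (1 - c' / 2)\<^sup>2" using c' by (simp add: power2_eq_square field_simps)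
  qed
  then show "0 < rho_bar d \<theta> k a" by (simp add: rho_bar_def c'_def)
  have "0 \<le> sqrt ((c' / 2)\<^sup>2 + \<theta>\<^sup>2)" by simp
  then show "rho_bar d \<theta> k a \<le> 1" unfolding rho_bar_def c'_def[symmetric] using c' by linarith
qed

text \<open>\<open>1 - rho_bar\<close> is the larger root of
  \<open>\<sigma>\<^sup>2 - c * \<sigma> = \<theta>\<^sup>2\<close>, and factoring this quadratic
  gives the last two claims. The linear bound says that a typical radius close to \<theta> forces
  \<rho> to be close to \<open>rho_bar\<close>.\<close>

lemma typical_radius:
  assumes \<rho>: "0 \<le> \<rho>" "\<rho> \<le> rho_bar d \<theta> k a"
  shows "(typical_radius d k a \<rho>)\<^sup>2 = (1 - \<rho>)\<^sup>2 - (a + k * d) * (1 - \<rho>)"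
    and "\<theta> \<le> typical_radius d k a \<rho>"
    and "rho_bar d \<theta> k a - \<rho> \<le> 2 * (typical_radius d k a \<rho> - \<theta>)"
proof -
  define c' q \<sigma> where "c' = a + k * d" and "q = sqrt ((c' / 2)\<^sup>2 + \<theta>\<^sup>2)" and "\<sigma> = 1 - \<rho>"
  let ?g = "typical_radius d k a \<rho>"
  have c': "0 \<le> c'" using c by (simp add: c'_def)
  have q2: "q\<^sup>2 = (c' / 2)\<^sup>2 + \<theta>\<^sup>2" by (simp add: q_def)
  have q: "c' / 2 \<le> q" unfolding q_def by (rule real_le_rsqrt) simp
  have rb: "rho_bar d \<theta> k a = 1 - c' / 2 - q" by (simp add: rho_bar_def c'_def q_def)
  have \<sigma>: "c' / 2 + q \<le> \<sigma>" using \<rho> rb by (simp add: \<sigma>_def)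
  have \<sigma>0: "0 \<le> \<sigma>" using \<sigma> q c' by linarith
  have fac: "\<sigma>\<^sup>2 - c' * \<sigma> - \<theta>\<^sup>2 = (\<sigma> - (c' / 2 + q)) * (\<sigma> - (c' / 2 - q))"
    using q2 by (simp add: power2_eq_square field_simps)
  have "0 \<le> (\<sigma> - (c' / 2 + q)) * (\<sigma> - (c' / 2 - q))"
    using \<sigma> q c' by (intro mult_nonneg_nonneg) linarith+
  then have ge: "\<theta>\<^sup>2 \<le> \<sigma>\<^sup>2 - c' * \<sigma>" using fac by linarith
  have g: "?g = sqrt (\<sigma>\<^sup>2 - c' * \<sigma>)" by (simp add: typical_radius_def c'_def \<sigma>_def)
  have "0 \<le> \<sigma>\<^sup>2 - c' * \<sigma>" using ge zero_le_power2[of \<theta>] by linarith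
  then have g2: "?g\<^sup>2 = \<sigma>\<^sup>2 - c' * \<sigma>" by (simp add: g)
  then show "?g\<^sup>2 = (1 - \<rho>)\<^sup>2 - (a + k * d) * (1 - \<rho>)" by (simp add: c'_def \<sigma>_def)
  show g\<theta>: "\<theta> \<le> ?g" unfolding g using ge by (rule real_le_rsqrt)
  have "0 \<le> c' * \<sigma>" using c' \<sigma>0 by simp
  then have g\<sigma>: "?g \<le> \<sigma>" using g2 \<sigma>0 by - (rule power2_le_imp_le, auto)
  have "(\<sigma> - (c' / 2 + q)) * \<sigma> \<le> (\<sigma> - (c' / 2 + q)) * (\<sigma> - (c' / 2 - q))"
    using \<sigma> q by (intro mult_left_mono) linarith+
  also have "\<dots> = (?g - \<theta>) * (?g + \<theta>)" using fac g2 by (simp add: power2_eq_square algebra_simps)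
  also have "\<dots> \<le> (?g - \<theta>) * (2 * \<sigma>)" using g\<theta> g\<sigma> by (intro mult_left_mono) linarith+
  finally have le: "(\<sigma> - (c' / 2 + q)) * \<sigma> \<le> (2 * (?g - \<theta>)) * \<sigma>" by (simp add: mult_ac)
  show "rho_bar d \<theta> k a - \<rho> \<le> 2 * (?g - \<theta>)"
  proof (cases "\<sigma> = 0")
    case True
    then show ?thesis using \<sigma> q c' g\<theta> rb by (simp add: \<sigma>_def)
  next
    case False
    then have "\<sigma> - (c' / 2 + q) \<le> 2 * (?g - \<theta>)" using le \<sigma>0 by simp
    then show ?thesis using rb by (simp add: \<sigma>_def)
  qed
qed

lemma cost_nonneg: "0 < \<rho> \<Longrightarrow> 0 \<le> cost d \<theta> k a \<rho>"
  by (simp add: cost_def)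

lemma rate_function_le:
  assumes "0 < \<rho>" "\<rho> \<le> rho_bar d \<theta> k a"
  shows "rate_function d \<theta> k a \<le> cost d \<theta> k a \<rho>"
  unfolding rate_function_eq
proof (rule cINF_lower)
  show "bdd_below (cost d \<theta> k a ` {0<..rho_bar d \<theta> k a})"
    by (rule bdd_belowI2[of _ 0]) (simp add: cost_nonneg)
qed (use assms in auto)

text \<open>At \<open>rho_bar\<close> the typical radius equals \<theta>, so no displacement is
  required and only the cost of not branching is left.\<close>

lemma rate_function_le_rho_bar: "rate_function d \<theta> k a \<le> rho_bar d \<theta> k a"
proof -
  let ?c = "a + k * d"
  let ?\<sigma> = "?c / 2 + sqrt ((?c / 2)\<^sup>2 + \<theta>\<^sup>2)"
  have "?\<sigma>\<^sup>2 - ?c * ?\<sigma> = (sqrt ((?c / 2)\<^sup>2 + \<theta>\<^sup>2))\<^sup>2 - (?c / 2)\<^sup>2"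
    by (simp only: power2_eq_square) (simp add: field_simps)
  also have "\<dots> = \<theta>\<^sup>2" by simp
  finally have "?\<sigma>\<^sup>2 - ?c * ?\<sigma> = \<theta>\<^sup>2" .
  moreover have "1 - rho_bar d \<theta> k a = ?\<sigma>" by (simp add: rho_bar_def)
  ultimately have "typical_radius d k a (rho_bar d \<theta> k a) = \<theta>"
    using \<theta> by (simp only: typical_radius_def) simp
  then have "cost d \<theta> k a (rho_bar d \<theta> k a) = rho_bar d \<theta> k a" by (simp add: cost_def)
  with rate_function_le[of "rho_bar d \<theta> k a"] rho_bar_bounds show ?thesis by simp
qed

text \<open>The lower bound leaves the remaining time \<open>(1 - \<rho>) * t\<close> for a
  first-moment estimate, so \<open>\<rho> < 1\<close> is wanted. The value 1 lies in the range only
  if \<theta> and \<open>a + k * d\<close> both vanish.\<close>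

lemma approximate_minimizer:
  assumes "rate_function d \<theta> k a < u"
  obtains \<rho> where "0 < \<rho>" "\<rho> \<le> rho_bar d \<theta> k a" "\<rho> < 1" "cost d \<theta> k a \<rho> < u"
proof -
  have "\<exists>v\<in>cost d \<theta> k a ` {0<..rho_bar d \<theta> k a}. v < u"
    using assms rho_bar_bounds unfolding rate_function_eq by (intro cInf_lessD) auto
  then obtain \<rho> where \<rho>: "0 < \<rho>" "\<rho> \<le> rho_bar d \<theta> k a" "cost d \<theta> k a \<rho> < u" by auto
  show thesis
  proof (cases "\<rho> < 1")
    case True
    with \<rho> that show thesis by blast
  next
    case False
    then have rb: "rho_bar d \<theta> k a = 1" "\<rho> = 1" using \<rho> rho_bar_bounds by auto
    define c' where "c' = a + k * d"
    have "0 \<le> c'" using c by (simp add: c'_def)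
    moreover have "1 - c' / 2 - sqrt ((c' / 2)\<^sup>2 + \<theta>\<^sup>2) = 1" using rb(1) by (simp add: rho_bar_def c'_def)
    moreover have "0 \<le> sqrt ((c' / 2)\<^sup>2 + \<theta>\<^sup>2)" by simp
    ultimately have c0: "a + k * d = 0" unfolding c'_def[symmetric] by linarith
    then have "\<theta> = 0" using rb(1) \<theta> unfolding rho_bar_def by simp
    \<comment> \<open>In this case the cost is
      \<open>\<rho> + (1 - \<rho>)\<^sup>2 / \<rho>\<close>, and any \<rho> slightly below 1 beats
      the endpoint.\<close>
    then have "cost d \<theta> k a 1 = 1" "cost d \<theta> k a (9 / 10) = 9 / 10 + 1 / 90"
      unfolding cost_def typical_radius_def using c0 by (simp_all add: power2_eq_square)
    then show thesis using that[of "9 / 10"] rb \<rho> by simp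
  qed
qed

text \<open>If \<open>2 * \<epsilon>\<^sup>2\<close> is small compared with the distance \<open>u\<close> between the typical radius and \<open>\<theta>\<close>, shrinking
  \<open>u\<close> by \<open>2 * \<epsilon>\<^sup>2\<close> is harmless; otherwise \<open>\<rho>\<close> is close to \<open>rho_bar\<close>, which is at least the infimum. This makes the estimate
  uniform as \<open>\<rho>\<close> tends to \<open>0\<close>.\<close>

lemma shrunk_cost_ge:
  assumes \<epsilon>: "0 < \<epsilon>" "\<epsilon> < 1" and \<rho>: "0 < \<rho>" "\<rho> \<le> rho_bar d \<theta> k a"
  shows "min ((1 - \<epsilon>)\<^sup>2 * rate_function d \<theta> k a) (rate_function d \<theta> k a - 4 * \<epsilon>)
    \<le> \<rho> + (max 0 (typical_radius d k a \<rho> - \<theta> - 2 * \<epsilon>\<^sup>2))\<^sup>2 / \<rho>"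
proof -
  define u where "u = typical_radius d k a \<rho> - \<theta>"
  have u: "0 \<le> u" "rho_bar d \<theta> k a - \<rho> \<le> 2 * u"
    using typical_radius(2,3)[of \<rho>] \<rho> by (auto simp: u_def)
  show ?thesis
  proof (cases "2 * \<epsilon>\<^sup>2 \<le> \<epsilon> * u")
    case True
    then have "(1 - \<epsilon>) * u \<le> max 0 (u - 2 * \<epsilon>\<^sup>2)" by (simp add: algebra_simps max_def)
    moreover have "0 \<le> (1 - \<epsilon>) * u" using \<epsilon> u by simp
    ultimately have "((1 - \<epsilon>) * u)\<^sup>2 \<le> (max 0 (u - 2 * \<epsilon>\<^sup>2))\<^sup>2" by (intro power_mono)
    then have "((1 - \<epsilon>) * u)\<^sup>2 / \<rho> \<le> (max 0 (u - 2 * \<epsilon>\<^sup>2))\<^sup>2 / \<rho>" using \<rho> by (intro divide_right_mono) auto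
    moreover have "(1 - \<epsilon>)\<^sup>2 * \<rho> \<le> 1 * \<rho>" using \<epsilon> \<rho> by (intro mult_right_mono) (auto simp: power_le_one)
    moreover have "(1 - \<epsilon>)\<^sup>2 * cost d \<theta> k a \<rho> = (1 - \<epsilon>)\<^sup>2 * \<rho> + ((1 - \<epsilon>) * u)\<^sup>2 / \<rho>"
      by (simp add: cost_def u_def[symmetric] power_mult_distrib distrib_left)
    moreover have "(1 - \<epsilon>)\<^sup>2 * rate_function d \<theta> k a \<le> (1 - \<epsilon>)\<^sup>2 * cost d \<theta> k a \<rho>"
      using rate_function_le[OF \<rho>] by (intro mult_left_mono) auto
    ultimately show ?thesis by (simp add: u_def)
  next
    case False
    then have "\<epsilon> * u < \<epsilon> * (2 * \<epsilon>)" by (simp add: power2_eq_square mult_ac)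
    then have "u < 2 * \<epsilon>" using \<epsilon> by simp
    then have "rate_function d \<theta> k a - 4 * \<epsilon> \<le> \<rho>" using u rate_function_le_rho_bar by linarith
    moreover have "0 \<le> (max 0 (typical_radius d k a \<rho> - \<theta> - 2 * \<epsilon>\<^sup>2))\<^sup>2 / \<rho>" using \<rho> by simp
    ultimately show ?thesis by linarith
  qed
qed

end

section \<open>The large deviation estimates\<close>

context dyadic_bbm
begin

lemma measurable_ball_constraint:
  fixes f :: "real \<Rightarrow> real" and x :: 'a
  assumes [measurable]: "f \<in> borel_measurable borel"
  shows "{(s, z). z \<in> {z. f s < dist x z}} \<in> sets (borel \<Otimes>\<^sub>M borel)"
proof -
  have "{p \<in> space (borel \<Otimes>\<^sub>M borel). f (fst p) < dist x (snd p :: 'a)} \<in> sets (borel \<Otimes>\<^sub>M borel)"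
    by measurable
  moreover have "{(s, z). z \<in> {z. f s < dist x z}} = {p \<in> space (borel \<Otimes>\<^sub>M borel). f (fst p) < dist x (snd p :: 'a)}"
    by (auto simp: space_pair_measure)
  ultimately show ?thesis by simp
qed

context
  fixes \<theta> k r\<^sub>0 a :: real and e :: 'a
  assumes \<theta>: "0 \<le> \<theta>" "\<theta> < 1" and k: "0 \<le> k" and r\<^sub>0: "0 < r\<^sub>0" and e: "norm e = 1"
    and a: "0 \<le> a" "a + k * DIM('a) < 1 - \<theta>\<^sup>2"
begin

abbreviation centre :: "real \<Rightarrow> 'a" where "centre t \<equiv> (\<theta> * sqrt (2 * \<beta>) * t) *\<^sub>R e"
abbreviation radius :: "real \<Rightarrow> real" where "radius t \<equiv> r\<^sub>0 * exp (- (\<beta> * k * t))"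
abbreviation target :: "real \<Rightarrow> 'a set" where "target t \<equiv> ball (centre t) (radius t)"
abbreviation few_prob :: "real \<Rightarrow> real" where
  "few_prob t \<equiv> prob {\<omega> \<in> space M. hits T W (target t) t 0 \<omega> < ennreal (exp (\<beta> * a * t))}"

lemma c_nonneg: "0 \<le> a + k * real DIM('a)"
  using a k by simp

text \<open>Starting value for the spreading: with one unit of time left, an unbranched particle
  near the centre hits the target with probability of order \<open>radius t ^ d\<close>, and a hit
  counts \<open>1 - exp (- \<mu>) \<ge> \<mu> / 2\<close>. Neither \<open>m\<close> nor the unit
  ball depends on \<open>t\<close>.\<close>

lemma early_survival:
  obtains m where "0 < m"
    "\<And>t z. 0 \<le> t \<Longrightarrow> z \<in> ball (centre t) 1 \<Longrightarrow>
      m * exp (- \<beta> * (a + k * DIM('a)) * t) \<le> 1 - bbm_laplace M (exp (- \<beta> * a * t)) (target t) T W 1 z"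
proof -
  define C where "C = unit_ball_vol (real DIM('a)) * (1 / sqrt (2 * pi * 1)) ^ DIM('a) * exp (- (1 + r\<^sub>0)\<^sup>2 / (2 * 1))"
  have C: "0 < C" by (simp add: C_def)
  define m where "m = exp (- \<beta>) * (1 / 2 * (C * r\<^sub>0 ^ DIM('a)))"
  show ?thesis
  proof (rule that[of m])
    show "0 < m" using C r\<^sub>0 by (simp add: m_def)
    fix t :: real and z assume t: "0 \<le> t" and z: "z \<in> ball (centre t) 1"
    define \<mu> where "\<mu> = exp (- \<beta> * a * t)"
    have \<mu>: "0 < \<mu>" "\<mu> \<le> 1" using rate_pos a t by (auto simp: \<mu>_def)
    interpret w: mild_solution M "W []" \<beta> "bbm_laplace M \<mu> (target t) T W"
      by (rule mild_solution_bbm_laplace) (use \<mu> in auto)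
    have rad: "0 \<le> radius t" "radius t \<le> r\<^sub>0" using rate_pos k t r\<^sub>0 by auto
    have "\<mu> / 2 \<le> 1 - exp (- \<mu>)"
    proof -
      have "exp (- \<mu>) \<le> 1 / (1 + \<mu>)"
        using exp_ge_add_one_self[of \<mu>] \<mu> by (simp add: exp_minus inverse_eq_divide frac_le)
      moreover have "1 - 1 / (1 + \<mu>) = \<mu> / (1 + \<mu>)" using \<mu> by (simp add: field_simps)
      moreover have "\<mu> / 2 \<le> \<mu> / (1 + \<mu>)" using \<mu> by (intro divide_left_mono) auto
      ultimately show ?thesis by linarith
    qed
    moreover have "C * radius t ^ DIM('a) \<le> heat 1 (indicator (target t)) z"
    proof -
      have "(dist z (centre t) + radius t)\<^sup>2 \<le> (1 + r\<^sub>0)\<^sup>2"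
        using z rad by (intro power_mono add_mono) (auto simp: dist_commute)
      then have "exp (- (1 + r\<^sub>0)\<^sup>2 / (2 * 1)) \<le> exp (- (dist z (centre t) + radius t)\<^sup>2 / (2 * 1))" by simp
      then have "C * radius t ^ DIM('a) \<le> unit_ball_vol (real DIM('a)) * radius t ^ DIM('a) * (1 / sqrt (2 * pi * 1)) ^ DIM('a)
          * exp (- (dist z (centre t) + radius t)\<^sup>2 / (2 * 1))"
      proof -
        assume E: "exp (- (1 + r\<^sub>0)\<^sup>2 / (2 * 1)) \<le> exp (- (dist z (centre t) + radius t)\<^sup>2 / (2 * 1))" (is "?E \<le> ?E'")
        have "C * radius t ^ DIM('a) = unit_ball_vol (real DIM('a)) * radius t ^ DIM('a) * (1 / sqrt (2 * pi * 1)) ^ DIM('a) * ?E"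
          unfolding C_def by (simp only: mult_ac)
        also have "\<dots> \<le> unit_ball_vol (real DIM('a)) * radius t ^ DIM('a) * (1 / sqrt (2 * pi * 1)) ^ DIM('a) * ?E'"
          using E rad(1) by (intro mult_left_mono mult_nonneg_nonneg) auto
        finally show ?thesis .
      qed
      also have "\<dots> \<le> heat 1 (indicator (target t)) z"
        by (rule motion.heat_ball_ge) (use rad in auto)
      finally show ?thesis .
    qed
    ultimately have "\<mu> / 2 * (C * radius t ^ DIM('a)) \<le> (1 - exp (- \<mu>)) * heat 1 (indicator (target t)) z"
      using \<mu> C rad by (intro mult_mono) auto
    also have "\<dots> = heat 1 (\<lambda>y. 1 - bbm_laplace M \<mu> (target t) T W (1 - 1) y) z"
      by (simp add: survival_bbm_laplace_0 motion.heat_cmult bounded_measurable_indicator)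
    finally have "exp (- \<beta>) * (\<mu> / 2 * (C * radius t ^ DIM('a))) \<le> exp (- \<beta>) * heat 1 (\<lambda>y. 1 - bbm_laplace M \<mu> (target t) T W (1 - 1) y) z"
      by simp
    also have "\<dots> \<le> 1 - bbm_laplace M \<mu> (target t) T W 1 z"
      using w.survival_ge_no_branching[of 1 1 z] by simp
    also have "exp (- \<beta>) * (\<mu> / 2 * (C * radius t ^ DIM('a))) = m * exp (- \<beta> * (a + k * DIM('a)) * t)"
    proof -
      have "radius t ^ DIM('a) = r\<^sub>0 ^ DIM('a) * exp (- (\<beta> * (k * DIM('a)) * t))"
        by (simp add: power_mult_distrib exp_of_nat_mult[symmetric] mult_ac)
      moreover have "exp (- \<beta> * (a + k * DIM('a)) * t) = \<mu> * exp (- (\<beta> * (k * DIM('a)) * t))"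
        by (simp add: \<mu>_def exp_add[symmetric] algebra_simps)
      ultimately show ?thesis by (simp only: m_def) simp
    qed
    finally show "m * exp (- \<beta> * (a + k * DIM('a)) * t) \<le> 1 - bbm_laplace M (exp (- \<beta> * a * t)) (target t) T W 1 z"
      by (simp add: \<mu>_def)
  qed
qed

text \<open>Decay with \<open>q = \<epsilon>\<close> on the time interval up to
  \<open>rho_bar * t\<close>, where penetration makes \<open>w\<close> small off the bad set. The
  reduced killing rate and the Gaussian tail bound lose the same factor
  \<open>1 - \<epsilon>\<close>, so it can be taken out of the cost.\<close>

lemma few_prob_le:
  assumes \<epsilon>: "0 < \<epsilon>" "\<epsilon> < 1"
  obtains A where "0 < A"
    "\<forall>\<^sub>F t in at_top. few_prob t \<le>
      exp 1 * (1 + A * t) * exp (- (1 - \<epsilon>) * \<beta> * min ((1 - \<epsilon>)\<^sup>2 * rate_function DIM('a) \<theta> k a) (rate_function DIM('a) \<theta> k a - 4 * \<epsilon>) * t)"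
proof -
  let ?typ = "typical_radius DIM('a) k a" and ?rb = "rho_bar DIM('a) \<theta> k a" and ?rate = "rate_function DIM('a) \<theta> k a"
  define J where "J = min ((1 - \<epsilon>)\<^sup>2 * ?rate) (?rate - 4 * \<epsilon>)"
  \<comment> \<open>Penetration loses \<open>2 * \<eta>\<close> in the radius; this has to match the
    shift \<open>2 * \<epsilon>\<^sup>2\<close> in \<open>shrunk_cost_ge\<close>.\<close>
  define \<eta> where "\<eta> = \<epsilon>\<^sup>2"
  have \<eta>: "0 < \<eta>" "\<eta> \<le> 1" using \<epsilon> by (auto simp: \<eta>_def power_le_one)
  let ?c = "a + k * real DIM('a)"
  note hyps = \<theta> c_nonneg a(2)
  note rb = rho_bar_bounds[OF hyps]
  obtain m where m: "0 < m"
    and near: "\<And>t z. 0 \<le> t \<Longrightarrow> z \<in> ball (centre t) 1 \<Longrightarrow>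
      m * exp (- \<beta> * ?c * t) \<le> 1 - bbm_laplace M (exp (- \<beta> * a * t)) (target t) T W 1 z"
    using early_survival by blast
  obtain t\<^sub>0 where t\<^sub>0: "1 \<le> t\<^sub>0"
    and pen: "\<And>w t \<sigma> \<gamma> x y. mild_solution M (W []) \<beta> w \<Longrightarrow> t\<^sub>0 \<le> t \<Longrightarrow>
      (\<And>z. z \<in> ball x 1 \<Longrightarrow> m * exp (- \<beta> * ?c * t) \<le> 1 - w 1 z) \<Longrightarrow>
      0 \<le> \<sigma> \<Longrightarrow> \<sigma> \<le> 1 \<Longrightarrow> 2 * \<eta> \<le> \<gamma> \<Longrightarrow> \<gamma>\<^sup>2 = \<sigma>\<^sup>2 - ?c * \<sigma> \<Longrightarrow>
      dist x y \<le> (\<gamma> - 2 * \<eta>) * sqrt (2 * \<beta>) * t \<Longrightarrow> w (\<sigma> * t) y \<le> \<epsilon>"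
    using motion.penetration[where u = "[]", OF rate_pos c_nonneg \<eta> m \<epsilon>(1)] by metis
  define A where "A = (1 / sqrt \<epsilon>) ^ DIM('a)"
  have A: "0 < A" using \<epsilon> by (simp add: A_def)
  have "few_prob t \<le> exp 1 * (1 + \<beta> * A * t) * exp (- (1 - \<epsilon>) * \<beta> * J * t)" if t: "t\<^sub>0 \<le> t" for t
  proof -
    have t1: "1 \<le> t" using t t\<^sub>0 by simp
    define \<mu> where "\<mu> = exp (- \<beta> * a * t)"
    have \<mu>: "0 < \<mu>" by (simp add: \<mu>_def)
    let ?w = "bbm_laplace M \<mu> (target t) T W"
    have mild: "mild_solution M (W []) \<beta> ?w"
      by (rule mild_solution_bbm_laplace) (use \<mu> in auto)
    interpret w: mild_solution M "W []" \<beta> ?w by (rule mild)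
    \<comment> \<open>With \<open>\<rho> = s / t\<close> used up, these are the points outside the
      ball on which penetration applies for the remaining time \<open>t - s\<close>.\<close>
    define Bad where "Bad s = {z. (?typ (s / t) - 2 * \<eta>) * sqrt (2 * \<beta>) * t < dist (centre t) z}" for s
    define C where "C = A * exp (- (1 - \<epsilon>) * \<beta> * J * t)"
    have st: "0 < s / t" "s / t \<le> ?rb" "s / t \<le> 1" "s = s / t * t" if "0 < s" "s \<le> ?rb * t" for s
    proof -
      show "0 < s / t" "s = s / t * t" using that t1 by auto
      show "s / t \<le> ?rb" using that t1 by (simp add: field_simps)
      then show "s / t \<le> 1" using rb by simp
    qed
    have "?w t 0 \<le> exp (- \<beta> * (1 - \<epsilon>) * (?rb * t)) + \<beta> * C * (?rb * t)"
    proof (rule w.decay[where Bad = Bad])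
      show "0 \<le> ?rb * t" "?rb * t \<le> t" "0 \<le> \<epsilon>" using rb t1 \<epsilon> by (auto simp: mult_left_le_one_le)
      show "{(s, y). y \<in> Bad s} \<in> sets (borel \<Otimes>\<^sub>M borel)"
        unfolding Bad_def by (rule measurable_ball_constraint, unfold typical_radius_def) measurable
    next
      fix s y assume s: "0 < s" "s \<le> ?rb * t" and y: "y \<notin> Bad s"
      let ?\<rho> = "s / t"
      have d: "dist (centre t) y \<le> (?typ ?\<rho> - 2 * \<eta>) * sqrt (2 * \<beta>) * t" using y by (simp add: Bad_def)
      have pos: "0 < sqrt (2 * \<beta>) * t" using rate_pos t1 by simp
      have "0 \<le> (?typ ?\<rho> - 2 * \<eta>) * (sqrt (2 * \<beta>) * t)"
        using order_trans[OF zero_le_dist d] by (simp only: mult.assoc)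
      \<comment> \<open>A point off the bad set exists only if the radius of the good ball is
        nonnegative, which is just the condition on \<gamma> in \<open>penetration\<close>.\<close>
      then have "2 * \<eta> \<le> ?typ ?\<rho>" using pos by (simp add: zero_le_mult_iff)
      then have "?w ((1 - ?\<rho>) * t) y \<le> \<epsilon>"
        using st[OF s] near[of t] t1 typical_radius(1)[OF hyps, of ?\<rho>] d
        by (intro pen[OF mild t]) (auto simp: \<mu>_def)
      moreover have "(1 - ?\<rho>) * t = t - s" using t1 by (simp add: field_simps)
      ultimately show "?w (t - s) y \<le> \<epsilon>" by simp
    next
      fix s assume s: "0 < s" "s \<le> ?rb * t"
      let ?\<rho> = "s / t"
      \<comment> \<open>Distance from the origin to the bad set in units of
        \<open>sqrt (2 * \<beta>) * t\<close>; it is 0 when the bound is trivial because the origin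
        may itself be bad.\<close>
      define u where "u = max 0 (?typ ?\<rho> - \<theta> - 2 * \<eta>)"
      define R where "R = u * sqrt (2 * \<beta>) * t"
      have R: "0 \<le> R" using rate_pos t1 by (simp add: R_def u_def)
      have "R \<le> dist 0 y" if "y \<in> Bad s" for y
      proof (cases "u = 0")
        case False
        then have u: "u = ?typ ?\<rho> - 2 * \<eta> - \<theta>" by (simp add: u_def max_def split: if_splits)
        have "norm (centre t) = \<theta> * sqrt (2 * \<beta>) * t"
          using e \<theta> rate_pos t1 by simp
        then have "(?typ ?\<rho> - 2 * \<eta>) * sqrt (2 * \<beta>) * t < \<theta> * sqrt (2 * \<beta>) * t + norm y"
          using that norm_triangle_ineq4[of "centre t" y] by (simp add: Bad_def dist_norm)
        then show ?thesis by (simp add: R_def u left_diff_distrib)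
      qed (simp add: R_def)
      then have "heat s (indicator (Bad s)) 0 \<le> A * exp (- (1 - \<epsilon>) * R\<^sup>2 / (2 * s))"
        unfolding A_def by (intro motion.heat_far_le s \<epsilon> R) (use \<epsilon> in \<open>auto simp: Bad_def\<close>)
      then have "exp (- \<beta> * (1 - \<epsilon>) * s) * heat s (indicator (Bad s)) 0 \<le> exp (- \<beta> * (1 - \<epsilon>) * s) * (A * exp (- (1 - \<epsilon>) * R\<^sup>2 / (2 * s)))"
        by (rule mult_left_mono) simp
      also have "\<dots> = A * exp (- (1 - \<epsilon>) * \<beta> * (?\<rho> + u\<^sup>2 / ?\<rho>) * t)"
      proof -
        have "- (1 - \<epsilon>) * R\<^sup>2 / (2 * s) = - (1 - \<epsilon>) * (\<beta> * (u\<^sup>2 / ?\<rho>) * t)"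
          using s t1 rate_pos by (simp add: R_def power_mult_distrib) (simp add: power2_eq_square)
        moreover have "- \<beta> * (1 - \<epsilon>) * s = - (1 - \<epsilon>) * (\<beta> * ?\<rho> * t)"
        proof -
          have "\<beta> * ?\<rho> * t = \<beta> * s" using t1 by simp
          then show ?thesis by (simp add: algebra_simps)
        qed
        ultimately have "- \<beta> * (1 - \<epsilon>) * s + - (1 - \<epsilon>) * R\<^sup>2 / (2 * s) = - (1 - \<epsilon>) * \<beta> * (?\<rho> + u\<^sup>2 / ?\<rho>) * t"
          by (simp only: distrib_left distrib_right mult.assoc)
        then show ?thesis by (metis exp_add mult.left_commute)
      qed
      also have "\<dots> \<le> C"
      proof -
        have "J \<le> ?\<rho> + u\<^sup>2 / ?\<rho>"
          using shrunk_cost_ge[OF hyps \<epsilon>, of ?\<rho>] st[OF s] by (simp add: J_def u_def \<eta>_def)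
        then have "(1 - \<epsilon>) * \<beta> * J * t \<le> (1 - \<epsilon>) * \<beta> * (?\<rho> + u\<^sup>2 / ?\<rho>) * t"
          using \<epsilon> rate_pos t1 by (intro mult_right_mono mult_left_mono) auto
        then have "exp (- (1 - \<epsilon>) * \<beta> * (?\<rho> + u\<^sup>2 / ?\<rho>) * t) \<le> exp (- (1 - \<epsilon>) * \<beta> * J * t)"
          by (simp only: exp_le_cancel_iff mult_minus_left neg_le_iff_le)
        then show ?thesis unfolding C_def using A by (intro mult_left_mono) auto
      qed
      finally show "exp (- \<beta> * (1 - \<epsilon>) * s) * heat s (indicator (Bad s)) 0 \<le> C" .
    qed
    also have "\<dots> \<le> exp (- (1 - \<epsilon>) * \<beta> * J * t) + \<beta> * C * t"
    proof (rule add_mono)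
      \<comment> \<open>Remaining unbranched for the whole interval already costs at least the rate
        function, so the boundary term of the decay estimate is no larger than the integral.\<close>
      have "J \<le> ?rb" using rate_function_le_rho_bar[OF hyps] \<epsilon> by (simp add: J_def min_le_iff_disj)
      then have "(1 - \<epsilon>) * \<beta> * t * J \<le> (1 - \<epsilon>) * \<beta> * t * ?rb"
        using \<epsilon> rate_pos t1 by (intro mult_left_mono) auto
      then have "- ((1 - \<epsilon>) * \<beta> * t * ?rb) \<le> - ((1 - \<epsilon>) * \<beta> * t * J)" by simp
      moreover have "- \<beta> * (1 - \<epsilon>) * (?rb * t) = - ((1 - \<epsilon>) * \<beta> * t * ?rb)"
        "- (1 - \<epsilon>) * \<beta> * J * t = - ((1 - \<epsilon>) * \<beta> * t * J)" by (simp_all add: algebra_simps)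
      ultimately show "exp (- \<beta> * (1 - \<epsilon>) * (?rb * t)) \<le> exp (- (1 - \<epsilon>) * \<beta> * J * t)"
        by (simp only: exp_le_cancel_iff)
      show "\<beta> * C * (?rb * t) \<le> \<beta> * C * t"
        using rb rate_pos A t1 by (intro mult_left_mono) (auto simp: C_def mult_left_le_one_le)
    qed
    also have "\<dots> = (1 + \<beta> * A * t) * exp (- (1 - \<epsilon>) * \<beta> * J * t)"
      by (simp add: C_def distrib_right)
    finally have w: "?w t 0 \<le> (1 + \<beta> * A * t) * exp (- (1 - \<epsilon>) * \<beta> * J * t)" .
    have "few_prob t \<le> exp (\<mu> * exp (\<beta> * a * t)) * ?w t 0"
      by (rule prob_hits_less_le) (use \<mu> in auto)
    also have "\<mu> * exp (\<beta> * a * t) = 1" by (simp add: \<mu>_def exp_add[symmetric])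
    also have "exp 1 * ?w t 0 \<le> exp 1 * ((1 + \<beta> * A * t) * exp (- (1 - \<epsilon>) * \<beta> * J * t))"
      using w by simp
    finally show ?thesis by (simp add: mult.assoc)
  qed
  then have "\<forall>\<^sub>F t in at_top. few_prob t \<le> exp 1 * (1 + \<beta> * A * t) * exp (- (1 - \<epsilon>) * \<beta> * J * t)"
    by (auto simp: eventually_at_top_linorder)
  then show ?thesis
    using A rate_pos by (intro that[of "\<beta> * A"]) (auto simp: J_def)
qed

text \<open>The optimal strategy: no branching until \<open>\<rho> * t\<close>, with the first
  particle then in a unit ball slightly farther from the target than the typical radius. From there
  the mean number of hits, weighted by \<mu>, tends to 0, so \<open>w \<ge> 1 / 2\<close> by the
  first-moment bound.\<close>

lemma few_prob_ge:
  fixes \<rho> \<eta> :: real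
  assumes \<rho>: "0 < \<rho>" "\<rho> \<le> rho_bar DIM('a) \<theta> k a" "\<rho> < 1" and \<eta>: "0 < \<eta>"
  shows "\<forall>\<^sub>F t in at_top.
    exp (- \<beta> * (\<rho> + (typical_radius DIM('a) k a \<rho> - \<theta> + \<eta>)\<^sup>2 / \<rho> + \<eta>) * t) \<le> few_prob t"
proof -
  let ?c = "a + k * real DIM('a)"
  note hyps = \<theta> c_nonneg a(2)
  define \<gamma> where "\<gamma> = typical_radius DIM('a) k a \<rho>"
  have \<gamma>: "\<gamma>\<^sup>2 = (1 - \<rho>)\<^sup>2 - ?c * (1 - \<rho>)" "\<theta> \<le> \<gamma>"
    using typical_radius[OF hyps, of \<rho>] \<rho> by (auto simp: \<gamma>_def)
  \<comment> \<open>The extra distance \<eta> lowers the exponent by at least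
    \<open>\<eta>\<^sup>2 = 2 * \<epsilon>\<close>: one \<epsilon> pays for the larger \<mu>, the
    other makes the weighted mean vanish.\<close>
  define \<epsilon> where "\<epsilon> = \<eta>\<^sup>2 / 2"
  have \<epsilon>: "0 < \<epsilon>" using \<eta> by (simp add: \<epsilon>_def)
  define u where "u = \<gamma> - \<theta> + \<eta>"
  have u: "0 < u" using \<gamma> \<eta> by (simp add: u_def)
  define K\<^sub>1 where "K\<^sub>1 = (\<gamma> + \<eta>) * sqrt (2 * \<beta>)"
  define K\<^sub>2 where "K\<^sub>2 = u * sqrt (2 * \<beta>)"
  have K: "0 < K\<^sub>1" "0 < K\<^sub>2" using \<gamma> \<theta> \<eta> u rate_pos by (auto simp: K\<^sub>1_def K\<^sub>2_def)
  define V where "V = unit_ball_vol (real DIM('a))"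
  have V: "0 < V" by (simp add: V_def)
  \<comment> \<open>The cross term of \<open>(K\<^sub>1 * t - (1 + r\<^sub>0))\<^sup>2 / (2 * (1 -
    \<rho>) * t)\<close>, where \<open>1 + r\<^sub>0\<close> accounts for the unit ball and the
    radius of the target; it does not grow with \<open>t\<close>.\<close>
  define C\<^sub>1 where "C\<^sub>1 = (1 + r\<^sub>0) * K\<^sub>1 / (1 - \<rho>)"
  define X where "X = \<rho> + u\<^sup>2 / \<rho>"
  define \<mu> where "\<mu> t = exp (- \<beta> * (a - \<epsilon>) * t)" for t
  define w where "w t = bbm_laplace M (\<mu> t) (target t) T W" for t
  \<comment> \<open>The particle moves directly away from the target: the distance
    \<open>u * sqrt (2 * \<beta>) * t\<close> from the origin adds to that of the centre to give
    \<open>K\<^sub>1 * t\<close>.\<close>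
  define z where "z t = (- (K\<^sub>2 * t)) *\<^sub>R e" for t
  have mild: "mild_solution M (W []) \<beta> (w t)" for t
    unfolding w_def by (rule mild_solution_bbm_laplace) (auto simp: \<mu>_def)
  have ev1: "\<forall>\<^sub>F t in at_top. 1 + r\<^sub>0 \<le> K\<^sub>1 * t"
    using K by real_asymp
  have ev2: "\<forall>\<^sub>F t in at_top. 1 \<le> (1 - \<rho>) * t"
    using \<rho> by real_asymp
  have ev3: "\<forall>\<^sub>F t in at_top. V * r\<^sub>0 ^ DIM('a) * exp (C\<^sub>1 - \<beta> * \<epsilon> * t) \<le> 1 / 2"
  proof -
    define b where "b = \<beta> * \<epsilon>"
    have "0 < b" using rate_pos \<epsilon> by (simp add: b_def)
    then have "((\<lambda>t. exp (C\<^sub>1 - b * t)) \<longlongrightarrow> 0) at_top" by real_asymp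
    then have "((\<lambda>t. V * r\<^sub>0 ^ DIM('a) * exp (C\<^sub>1 - b * t)) \<longlongrightarrow> V * r\<^sub>0 ^ DIM('a) * 0) at_top"
      by (rule tendsto_mult_left)
    then have "\<forall>\<^sub>F t in at_top. V * r\<^sub>0 ^ DIM('a) * exp (C\<^sub>1 - b * t) < 1 / 2"
      by (rule order_tendstoD) simp
    then show ?thesis unfolding b_def by eventually_elim simp
  qed
  have typical: "\<forall>\<^sub>F t in at_top. \<forall>y\<in>ball (z t) 1. 1 / 2 \<le> w t ((1 - \<rho>) * t) y"
    using ev1 ev2 ev3 eventually_ge_at_top[of 1]
  proof eventually_elim
    case (elim t)
    interpret w: mild_solution M "W []" \<beta> "w t" by (rule mild)
    define s where "s = (1 - \<rho>) * t"
    have s: "1 \<le> s" using elim by (simp add: s_def)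
    have rad: "0 \<le> radius t" "radius t \<le> r\<^sub>0" using rate_pos k elim r\<^sub>0 by auto
    show ?case
    proof
      fix y assume y: "y \<in> ball (z t) 1"
      define Q where "Q = K\<^sub>1 * t - (1 + r\<^sub>0)"
      have dz: "dist (z t) (centre t) = K\<^sub>1 * t"
      proof -
        have "z t - centre t = (- (K\<^sub>1 * t)) *\<^sub>R e"
          by (simp add: z_def K\<^sub>1_def K\<^sub>2_def u_def algebra_simps)
        then show ?thesis using K elim e by (simp add: dist_norm)
      qed
      have Q: "0 \<le> Q" "Q \<le> dist y (centre t) - radius t"
        using elim y rad dist_triangle[of "z t" "centre t" y] by (auto simp: Q_def dz)
      have \<mu>1: "1 - exp (- \<mu> t) \<le> \<mu> t" using exp_ge_add_one_self[of "- \<mu> t"] by simp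
      have "1 - w t s y \<le> exp (\<beta> * s) * heat s (\<lambda>y. 1 - w t (s - s) y) y"
        using s by (intro w.survival_le) auto
      also have "heat s (\<lambda>y. 1 - w t (s - s) y) y = (1 - exp (- \<mu> t)) * heat s (indicator (target t)) y"
        by (simp add: w_def survival_bbm_laplace_0 motion.heat_cmult bounded_measurable_indicator)
      also have "\<dots> \<le> \<mu> t * (V * r\<^sub>0 ^ DIM('a) * exp (- (\<beta> * k * DIM('a) * t)) * exp (- Q\<^sup>2 / (2 * s)))"
      proof (rule mult_mono[OF \<mu>1])
        have "heat s (indicator (target t)) y \<le>
          V * radius t ^ DIM('a) * (1 / sqrt (2 * pi * s)) ^ DIM('a) * exp (- (dist y (centre t) - radius t)\<^sup>2 / (2 * s))"
          unfolding V_def by (rule motion.heat_ball_le) (use s rad Q in auto)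
        also have "\<dots> \<le> V * radius t ^ DIM('a) * 1 * exp (- Q\<^sup>2 / (2 * s))"
        proof (intro mult_mono order_refl)
          have "1 * 1 \<le> (2 * pi) * s" using s pi_ge_two by (intro mult_mono) auto
          then have "1 \<le> sqrt (2 * pi * s)" by simp
          then show "(1 / sqrt (2 * pi * s)) ^ DIM('a) \<le> 1" by (intro power_le_one) auto
          have "Q\<^sup>2 \<le> (dist y (centre t) - radius t)\<^sup>2" using Q by (intro power_mono) auto
          then have "Q\<^sup>2 / (2 * s) \<le> (dist y (centre t) - radius t)\<^sup>2 / (2 * s)" using s by (intro divide_right_mono) auto
          then show "exp (- (dist y (centre t) - radius t)\<^sup>2 / (2 * s)) \<le> exp (- Q\<^sup>2 / (2 * s))" by simp
        qed (use V rad s in auto)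
        also have "radius t ^ DIM('a) = r\<^sub>0 ^ DIM('a) * exp (- (\<beta> * k * DIM('a) * t))"
          by (simp add: power_mult_distrib exp_of_nat_mult[symmetric] mult_ac)
        finally show "heat s (indicator (target t)) y \<le> V * r\<^sub>0 ^ DIM('a) * exp (- (\<beta> * k * DIM('a) * t)) * exp (- Q\<^sup>2 / (2 * s))"
          by (simp add: mult_ac)
      qed (auto simp: \<mu>_def intro!: motion.heat_nonneg borel_measurable_indicator)
      finally have "1 - w t s y \<le> exp (\<beta> * s) * (\<mu> t * (V * r\<^sub>0 ^ DIM('a) * exp (- (\<beta> * k * DIM('a) * t)) * exp (- Q\<^sup>2 / (2 * s))))"
        by simp
      also have "\<dots> = V * r\<^sub>0 ^ DIM('a) * exp (\<beta> * s + - \<beta> * (a - \<epsilon>) * t + - (\<beta> * k * DIM('a) * t) + - Q\<^sup>2 / (2 * s))"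
        unfolding exp_add \<mu>_def by (simp only: mult_ac)
      also have "\<dots> \<le> V * r\<^sub>0 ^ DIM('a) * exp (C\<^sub>1 - \<beta> * \<epsilon> * t)"
      proof -
        have \<rho>1: "0 < 1 - \<rho>" using \<rho> by simp
        have "(K\<^sub>1 * t)\<^sup>2 - 2 * (1 + r\<^sub>0) * (K\<^sub>1 * t) \<le> Q\<^sup>2"
        proof -
          have "Q\<^sup>2 = (K\<^sub>1 * t)\<^sup>2 - 2 * (1 + r\<^sub>0) * (K\<^sub>1 * t) + (1 + r\<^sub>0)\<^sup>2"
            by (simp add: Q_def power2_eq_square algebra_simps)
          then show ?thesis by simp
        qed
        then have "((K\<^sub>1 * t)\<^sup>2 - 2 * (1 + r\<^sub>0) * (K\<^sub>1 * t)) / (2 * s) \<le> Q\<^sup>2 / (2 * s)"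
          using s by (intro divide_right_mono) auto
        moreover have "((K\<^sub>1 * t)\<^sup>2 - 2 * (1 + r\<^sub>0) * (K\<^sub>1 * t)) / (2 * s) = \<beta> * ((\<gamma> + \<eta>)\<^sup>2 / (1 - \<rho>)) * t - C\<^sub>1"
        proof -
          have "(K\<^sub>1 * t)\<^sup>2 / (2 * s) = \<beta> * ((\<gamma> + \<eta>)\<^sup>2 / (1 - \<rho>)) * t"
            using rate_pos elim \<rho>1 by (simp add: K\<^sub>1_def s_def power_mult_distrib) (simp add: power2_eq_square)
          moreover have "2 * (1 + r\<^sub>0) * (K\<^sub>1 * t) / (2 * s) = C\<^sub>1"
          proof -
            have "2 * (1 + r\<^sub>0) * (K\<^sub>1 * t) / (2 * s) = ((2 * t) * ((1 + r\<^sub>0) * K\<^sub>1)) / ((2 * t) * (1 - \<rho>))"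
              by (simp only: s_def mult_ac)
            also have "\<dots> = C\<^sub>1"
              unfolding C\<^sub>1_def by (rule mult_divide_mult_cancel_left) (use elim in simp)
            finally show ?thesis .
          qed
          ultimately show ?thesis by (simp only: diff_divide_distrib)
        qed
        moreover have "\<beta> * ((1 - \<rho>) - ?c + 2 * \<epsilon>) * t \<le> \<beta> * ((\<gamma> + \<eta>)\<^sup>2 / (1 - \<rho>)) * t"
        proof -
          have "0 \<le> \<gamma> * \<eta>" using \<gamma> \<theta> \<eta> by simp
          then have "\<gamma>\<^sup>2 + \<eta>\<^sup>2 \<le> (\<gamma> + \<eta>)\<^sup>2" by (simp add: power2_eq_square algebra_simps)
          moreover have "\<eta>\<^sup>2 * (1 - \<rho>) \<le> \<eta>\<^sup>2 * 1" using \<rho> by (intro mult_left_mono) auto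
          ultimately have "(1 - \<rho>)\<^sup>2 - ?c * (1 - \<rho>) + \<eta>\<^sup>2 * (1 - \<rho>) \<le> (\<gamma> + \<eta>)\<^sup>2"
            using \<gamma>(1) by linarith
          then have "((1 - \<rho>) - ?c + \<eta>\<^sup>2) * (1 - \<rho>) \<le> (\<gamma> + \<eta>)\<^sup>2"
            by (simp add: power2_eq_square left_diff_distrib distrib_right)
          then have "(1 - \<rho>) - ?c + 2 * \<epsilon> \<le> (\<gamma> + \<eta>)\<^sup>2 / (1 - \<rho>)"
            unfolding pos_le_divide_eq[OF \<rho>1] by (simp add: \<epsilon>_def)
          then show ?thesis using rate_pos elim by (intro mult_right_mono mult_left_mono) auto
        qed
        moreover have "\<beta> * s + - \<beta> * (a - \<epsilon>) * t + - (\<beta> * k * DIM('a) * t) = \<beta> * ((1 - \<rho>) - ?c + 2 * \<epsilon>) * t - \<beta> * \<epsilon> * t"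
          by (simp add: s_def algebra_simps)
        moreover have "- Q\<^sup>2 / (2 * s) = - (Q\<^sup>2 / (2 * s))" by simp
        ultimately have "\<beta> * s + - \<beta> * (a - \<epsilon>) * t + - (\<beta> * k * DIM('a) * t) + - Q\<^sup>2 / (2 * s) \<le> C\<^sub>1 - \<beta> * \<epsilon> * t"
          by linarith
        then show ?thesis using V r\<^sub>0 by (intro mult_left_mono) auto
      qed
      also have "\<dots> \<le> 1 / 2" using elim by simp
      finally show "1 / 2 \<le> w t ((1 - \<rho>) * t) y" by (simp add: s_def)
    qed
  qed
  have "0 < V / 2" "0 < \<beta> * (\<eta> / 2) / \<rho>" using V rate_pos \<eta> \<rho> by auto
  \<comment> \<open>With this constant \<open>2 * K\<close> is \<open>K\<^sub>2 / \<rho>\<close>,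
    the cross term of \<open>(K\<^sub>2 * t + 1)\<^sup>2 / (2 * \<rho> * t)\<close>. The rate is
    chosen to use up only \<open>\<eta> / 2\<close> after rescaling time by \<rho>.\<close>
  from eventually_overhead[OF this, of "DIM('a)" "K\<^sub>2 / (2 * \<rho>)"]
  have "\<forall>\<^sub>F t in at_top. exp (- (\<beta> * (\<eta> / 2) / \<rho>) * (\<rho> * t)) \<le>
      V / 2 * (1 / sqrt (2 * pi * (\<rho> * t))) ^ DIM('a) * exp (- (2 * (K\<^sub>2 / (2 * \<rho>)) + 2 / (\<rho> * t)))"
  proof (rule eventually_compose_filterlim)
    show "filterlim (\<lambda>t. \<rho> * t) at_top at_top" using \<rho> by real_asymp
  qed
  then have low: "\<forall>\<^sub>F t in at_top. exp (- \<beta> * (X + \<eta> / 2) * t) \<le> w t t 0"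
    using typical eventually_ge_at_top[of 1]
  proof eventually_elim
    case (elim t)
    interpret w: mild_solution M "W []" \<beta> "w t" by (rule mild)
    define r where "r = \<rho> * t"
    have r: "0 < r" "r \<le> t" "t - r = (1 - \<rho>) * t" using \<rho> elim by (auto simp: r_def algebra_simps mult_left_le_one_le)
    have bi: "bounded_measurable borel (indicator (ball (z t) 1) :: 'a \<Rightarrow> real)"
      by (rule bounded_measurable_indicator) simp
    have dz: "dist 0 (z t) = K\<^sub>2 * t" using K elim e by (simp add: z_def)
    have "exp (- \<beta> * (X + \<eta> / 2) * t) = exp (- \<beta> * X * t) * exp (- (\<beta> * (\<eta> / 2) / \<rho>) * (\<rho> * t))"
      using \<rho> by (simp add: exp_add[symmetric] algebra_simps)
    also have "\<dots> \<le> exp (- \<beta> * X * t) * (V / 2 * (1 / sqrt (2 * pi * r)) ^ DIM('a) * exp (- (2 * (K\<^sub>2 / (2 * \<rho>)) + 2 / r)))"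
      using elim(1) by (intro mult_left_mono) (auto simp: r_def)
    also have "\<dots> \<le> exp (- \<beta> * X * t) * (V / 2 * (1 / sqrt (2 * pi * r)) ^ DIM('a) * exp (- (K\<^sub>2 / \<rho> + 1 / (2 * r))))"
    proof -
      have "1 / (2 * r) \<le> 2 / r" using r by (simp add: field_simps)
      moreover have "2 * (K\<^sub>2 / (2 * \<rho>)) = K\<^sub>2 / \<rho>" by simp
      ultimately have "exp (- (2 * (K\<^sub>2 / (2 * \<rho>)) + 2 / r)) \<le> exp (- (K\<^sub>2 / \<rho> + 1 / (2 * r)))" by simp
      then show ?thesis using V r by (intro mult_left_mono) auto
    qed
    also have "\<dots> = exp (- \<beta> * r) * (1 / 2 * (V * 1 ^ DIM('a) * (1 / sqrt (2 * pi * r)) ^ DIM('a) * exp (- (dist 0 (z t) + 1)\<^sup>2 / (2 * r))))"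
    proof -
      have "(dist 0 (z t) + 1)\<^sup>2 / (2 * r) = \<beta> * (u\<^sup>2 / \<rho>) * t + (K\<^sub>2 / \<rho> + 1 / (2 * r))"
      proof -
        have "(K\<^sub>2 * t)\<^sup>2 / (2 * r) = \<beta> * (u\<^sup>2 / \<rho>) * t"
          using rate_pos \<rho> elim by (simp add: K\<^sub>2_def r_def power_mult_distrib) (simp add: power2_eq_square)
        moreover have "2 * (K\<^sub>2 * t) / (2 * r) = K\<^sub>2 / \<rho>" using elim \<rho> by (simp add: r_def)
        moreover have "(dist 0 (z t) + 1)\<^sup>2 = (K\<^sub>2 * t)\<^sup>2 + 2 * (K\<^sub>2 * t) + 1"
          unfolding dz by (simp add: power2_eq_square algebra_simps)
        ultimately show ?thesis by (simp only: add_divide_distrib)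
      qed
      then have "- \<beta> * X * t + - (K\<^sub>2 / \<rho> + 1 / (2 * r)) = - \<beta> * r + - (dist 0 (z t) + 1)\<^sup>2 / (2 * r)"
        by (simp add: X_def r_def algebra_simps)
      then have "exp (- \<beta> * X * t) * exp (- (K\<^sub>2 / \<rho> + 1 / (2 * r))) = exp (- \<beta> * r) * exp (- (dist 0 (z t) + 1)\<^sup>2 / (2 * r))"
        unfolding exp_add[symmetric] by (rule arg_cong)
      then show ?thesis by simp
    qed
    also have "\<dots> \<le> exp (- \<beta> * r) * (1 / 2 * heat r (indicator (ball (z t) 1)) 0)"
      using motion.heat_ball_ge[OF r(1), of 1 0 "z t"] by (intro mult_left_mono) (auto simp: V_def)
    also have "\<dots> = exp (- \<beta> * r) * heat r (\<lambda>y. 1 / 2 * indicator (ball (z t) 1) y) 0"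
      by (simp only: motion.heat_cmult[OF bi])
    also have "\<dots> \<le> exp (- \<beta> * r) * heat r (w t (t - r)) 0"
      using elim(2) w.w_nonneg r
      by (intro mult_left_mono motion.heat_mono bounded_measurable_mult bounded_measurable_const bi w.bounded_measurable_w_slice)
        (auto simp: indicator_def)
    also have "\<dots> \<le> w t t 0"
      using r by (intro w.ge_no_branching) auto
    finally show ?case .
  qed
  define q where "q = \<beta> * (X + \<eta> / 2)"
  \<comment> \<open>Here \<open>\<mu> t * exp (\<beta> * a * t) = exp (\<beta> * \<epsilon> *
    t)\<close>, so the additive error of the Laplace bound is negligible against
    \<open>exp (- q * t)\<close>.\<close>
  have ev4: "\<forall>\<^sub>F t in at_top. exp (q * t - exp (\<beta> * \<epsilon> * t)) < 1 / 2"
  proof -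
    define b where "b = \<beta> * \<epsilon>"
    have "0 < b" using rate_pos \<epsilon> by (simp add: b_def)
    then have "filterlim (\<lambda>t. q * t - exp (b * t)) at_bot at_top" by real_asymp
    then have "((\<lambda>t. exp (q * t - exp (b * t))) \<longlongrightarrow> 0) at_top"
      by (rule filterlim_compose[OF exp_at_bot])
    then show ?thesis unfolding b_def by (rule order_tendstoD) simp
  qed
  have ev5: "\<forall>\<^sub>F t in at_top. exp (- (\<beta> * (\<eta> / 2)) * t) < 1 / 2"
  proof -
    define b where "b = \<beta> * (\<eta> / 2)"
    have "0 < b" using rate_pos \<eta> by (simp add: b_def)
    then have "((\<lambda>t. exp (- b * t)) \<longlongrightarrow> 0) at_top" by real_asymp
    then show ?thesis unfolding b_def by (rule order_tendstoD) simp
  qed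
  from low ev4 ev5 show ?thesis
  proof eventually_elim
    case (elim t)
    have "exp (- \<beta> * (X + \<eta>) * t) = exp (- q * t) * exp (- (\<beta> * (\<eta> / 2)) * t)"
      by (simp add: q_def exp_add[symmetric] algebra_simps)
    also have "\<dots> \<le> exp (- q * t) * (1 - exp (q * t - exp (\<beta> * \<epsilon> * t)))"
      using elim by (intro mult_left_mono) auto
    also have "\<dots> = exp (- q * t) - exp (- q * t) * exp (q * t - exp (\<beta> * \<epsilon> * t))" by (simp add: right_diff_distrib)
    also have "exp (- q * t) * exp (q * t - exp (\<beta> * \<epsilon> * t)) = exp (- exp (\<beta> * \<epsilon> * t))"
      by (simp add: exp_add[symmetric])
    also have "exp (- q * t) \<le> w t t 0" using elim by (simp add: q_def)
    also have "exp (\<beta> * \<epsilon> * t) = \<mu> t * exp (\<beta> * a * t)"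
      by (simp add: \<mu>_def exp_add[symmetric] algebra_simps)
    also have "w t t 0 - exp (- (\<mu> t * exp (\<beta> * a * t))) \<le> few_prob t"
      using prob_hits_less_ge[of "\<mu> t" "target t" "exp (\<beta> * a * t)" t 0] by (simp add: w_def \<mu>_def)
    finally show ?case by (simp add: X_def u_def \<gamma>_def)
  qed
qed

lemma few_prob_limit:
  "((\<lambda>t. 1 / t * ln (few_prob t)) \<longlongrightarrow> - \<beta> * rate_function DIM('a) \<theta> k a) at_top"
proof (rule order_tendstoI)
  let ?I = "rate_function DIM('a) \<theta> k a"
  note hyps = \<theta> c_nonneg a(2)
  fix l assume l: "l < - \<beta> * ?I"
  then have "?I < - l / \<beta>" using rate_pos by (simp add: field_simps)
  from approximate_minimizer[OF hyps this] obtain \<rho> where \<rho>: "0 < \<rho>" "\<rho> \<le> rho_bar DIM('a) \<theta> k a" "\<rho> < 1"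
    and cost: "cost DIM('a) \<theta> k a \<rho> < - l / \<beta>" by metis
  define v where "v \<eta> = \<rho> + (typical_radius DIM('a) k a \<rho> - \<theta> + \<eta>)\<^sup>2 / \<rho> + \<eta>" for \<eta>
  \<comment> \<open>For a fixed near-minimizer \<rho> the exponent is continuous in the margin, so
    some positive margin keeps it below the bound.\<close>
  have "(v \<longlongrightarrow> v 0) (at_right 0)"
    unfolding v_def using \<rho> by (intro tendsto_intros) auto
  moreover have "v 0 < - l / \<beta>" using cost by (simp add: v_def cost_def)
  ultimately have "\<forall>\<^sub>F \<eta> in at_right 0. v \<eta> < - l / \<beta>" by (rule order_tendstoD)
  then have "\<forall>\<^sub>F \<eta> in at_right 0. v \<eta> < - l / \<beta> \<and> 0 < \<eta>"
    using eventually_at_right_less[of "0 :: real"] by eventually_elim simp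
  then obtain \<eta> where \<eta>: "v \<eta> < - l / \<beta>" "0 < \<eta>"
    using eventually_happens[of _ "at_right (0 :: real)"] by auto
  from few_prob_ge[OF \<rho> \<eta>(2)] eventually_gt_at_top[of 0]
  show "\<forall>\<^sub>F t in at_top. l < 1 / t * ln (few_prob t)"
  proof eventually_elim
    case (elim t)
    have "- \<beta> * v \<eta> * t \<le> ln (few_prob t)"
      using elim(1) by (subst ln_ge_iff) (auto simp: v_def intro: less_le_trans[OF exp_gt_zero])
    then have "- \<beta> * v \<eta> \<le> 1 / t * ln (few_prob t)" using elim by (simp add: field_simps)
    moreover have "l < - \<beta> * v \<eta>" using \<eta> rate_pos by (simp add: field_simps)
    ultimately show ?case by linarith
  qed
next
  let ?I = "rate_function DIM('a) \<theta> k a"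
  note hyps = \<theta> c_nonneg a(2)
  fix l assume l: "- \<beta> * ?I < l"
  have "?I < ?I + 1" by simp
  from approximate_minimizer[OF hyps this] obtain \<rho> where \<rho>: "0 < \<rho>" "\<rho> \<le> rho_bar DIM('a) \<theta> k a" "\<rho> < 1" by metis
  \<comment> \<open>Monotonicity of \<open>ln\<close> needs a positive probability; the lower bound
    with any admissible \<rho> and margin 1 provides it.\<close>
  have pos: "\<forall>\<^sub>F t in at_top. 0 < few_prob t"
    using few_prob_ge[OF \<rho>, of 1] by (auto elim!: eventually_mono intro: less_le_trans[OF exp_gt_zero])
  define v where "v \<epsilon> = - (1 - \<epsilon>) * \<beta> * min ((1 - \<epsilon>)\<^sup>2 * ?I) (?I - 4 * \<epsilon>)" for \<epsilon>
  have "(v \<longlongrightarrow> v 0) (at_right 0)"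
    unfolding v_def by (intro tendsto_intros)
  moreover have "v 0 < l" using l by (simp add: v_def)
  ultimately have "\<forall>\<^sub>F \<epsilon> in at_right 0. v \<epsilon> < l" by (rule order_tendstoD)
  moreover have "\<forall>\<^sub>F \<epsilon> in at_right 0. \<epsilon> \<in> {0<..<1 :: real}" by (rule eventually_at_right_real) simp
  ultimately have "\<forall>\<^sub>F \<epsilon> in at_right 0. v \<epsilon> < l \<and> \<epsilon> \<in> {0<..<1}" by eventually_elim simp
  then obtain \<epsilon> where \<epsilon>: "v \<epsilon> < l" "0 < \<epsilon>" "\<epsilon> < 1"
    using eventually_happens[of _ "at_right (0 :: real)"] by auto
  obtain A where A: "0 < A" and le: "\<forall>\<^sub>F t in at_top. few_prob t \<le> exp 1 * (1 + A * t) * exp (v \<epsilon> * t)"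
    using few_prob_le[OF \<epsilon>(2,3)] unfolding v_def by blast
  have "((\<lambda>t. (1 + ln (1 + A * t)) / t) \<longlongrightarrow> 0) at_top" using A by real_asymp
  then have small: "\<forall>\<^sub>F t in at_top. (1 + ln (1 + A * t)) / t < l - v \<epsilon>"
    by (rule order_tendstoD) (use \<epsilon> in simp)
  from le pos small eventually_gt_at_top[of 0]
  show "\<forall>\<^sub>F t in at_top. 1 / t * ln (few_prob t) < l"
  proof eventually_elim
    case (elim t)
    have A1: "0 < 1 + A * t" using A elim by (simp add: add_pos_pos)
    have "ln (few_prob t) \<le> ln (exp 1 * (1 + A * t) * exp (v \<epsilon> * t))"
      using elim A1 by (subst ln_le_cancel_iff) auto
    also have "\<dots> = 1 + ln (1 + A * t) + v \<epsilon> * t"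
      using A1 by (simp add: ln_mult)
    finally have "1 / t * ln (few_prob t) \<le> 1 / t * (1 + ln (1 + A * t) + v \<epsilon> * t)"
      using elim by (intro mult_left_mono) auto
    also have "\<dots> = (1 + ln (1 + A * t)) / t + v \<epsilon>" using elim by (simp add: field_simps)
    finally show ?case using elim by linarith
  qed
qed

end

end

theorem theorem1:
  fixes M :: "'w measure"
    and T :: "bool list \<Rightarrow> 'w \<Rightarrow> real"
    and W :: "bool list \<Rightarrow> real \<Rightarrow> 'w \<Rightarrow> 'a::euclidean_space"
    and \<beta> \<theta> k r\<^sub>0 a :: real
    and e :: 'a
  assumes "0 < \<beta>"
    and "dyadic_bbm M \<beta> T W"
    and "0 \<le> \<theta>" and "\<theta> < 1"
    and "0 \<le> k" and "k < (1 - \<theta>\<^sup>2) / real DIM('a)"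
    and "0 < r\<^sub>0"
    and "norm e = 1"
    and "0 \<le> a" and "a < 1 - \<theta>\<^sup>2 - k * real DIM('a)"
  shows "((\<lambda>t. 1 / t * ln (measure M {\<omega> \<in> space M.
            emeasure (bbm_measure T W t \<omega>)
              (ball ((\<theta> * sqrt (2 * \<beta>) * t) *\<^sub>R e) (r\<^sub>0 * exp (- (\<beta> * k * t))))
            < ennreal (exp (\<beta> * a * t))}))
          \<longlongrightarrow> - \<beta> * rate_function DIM('a) \<theta> k a) at_top"
proof -
  interpret dyadic_bbm M \<beta> T W by fact
  have "a + k * real DIM('a) < 1 - \<theta>\<^sup>2" using assms by simp
  from few_prob_limit[OF assms(3,4,5,7,8,9) this] show ?thesis
    by (simp add: emeasure_bbm_measure_eq_hits)
qed

end
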